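(* Let $M$ be a smooth manifold, $\Theta\in\Omega^n(M)$, and let $\alpha\in\Omega^{n-p}(M)$, $\beta\in\Omega^{n-q}(M)$, $\gamma\in\Omega^{n-r}(M)$ be conformal Hamiltonian forms. Then the cup product satisfies the graded Leibniz rule $$\{\alpha,\beta\vee\gamma\}=\{\alpha,\beta\}\vee\gamma+(-1)^{(p-1)q}\,\beta\vee\{\alpha,\gamma\}.$$
   Context: $\mathfrak{X}^p(M)=\Gamma(\bigwedge^p TM)$. Conventions: $\iota_{U\wedge V}=\iota_V\iota_U$; for $U\in\mathfrak{X}^p(M)$, $\mathcal{L}_U\alpha=d\iota_U\alpha-(-1)^p\iota_U d\alpha$; the Schouten--Nijenhuis bracket of $U\in\mathfrak{X}^p(M)$, $V\in\mathfrak{X}^q(M)$ is normalized by $\iota_{[U,V]}=(-1)^{(p-1)q}\mathcal{L}_U\iota_V-\iota_V\mathcal{L}_U$. Forms of negative degree are zero. For $1\le p\le n$, $X\in\mathfrak{X}^p(M)$ is an infinitesimal conformal transformation of $\Theta$ if $\mathcal{L}_X\Theta=\iota_V\Theta$ for some $V\in\mathfrak{X}^{p-1}(M)$. A form $\alpha\in\Omega^{n-p}(M)$ is conformal Hamiltonian if $\iota_{X_\alpha}\Theta=-\alpha$ for some infinitesimal conformal transformation $X_\alpha\in\mathfrak{X}^p(M)$. The graded Jacobi bracket is $\{\alpha,\beta\}:=-\iota_{[X_\alpha,X_\beta]}\Theta$ and the cup product is $\alpha\vee\beta:=-\iota_{X_\alpha\wedge X_\beta}\Theta$; both are independent of the choices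 of $X_\alpha,X_\beta$ and are again conformal Hamiltonian forms (with associated multivector fields $[X_\alpha,X_\beta]$ and $X_\alpha\wedge X_\beta$). *)

theory Defs
  imports "HOL-Analysis.Analysis"
begin

section \<open>Smooth manifolds\<close>

text \<open>
  \<open>Ck_on k S f\<close>: on the open set \<open>S\<close> of a finite-dimensional space, all directional derivatives
  of \<open>f\<close> of order at most \<open>k\<close> exist (as Frechet derivatives) and are continuous.
\<close>

fun Ck_on :: "nat \<Rightarrow> 'e::real_normed_vector set \<Rightarrow> ('e \<Rightarrow> 'f::real_normed_vector) \<Rightarrow> bool" where
  "Ck_on 0 S f \<longleftrightarrow> continuous_on S f"
| "Ck_on (Suc k) S f \<longleftrightarrow>
     (\<forall>x\<in>S. f differentiable (at x)) \<and> (\<forall>v. Ck_on k S (\<lambda>x. frechet_derivative f (at x) v))"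

definition smooth_on :: "'e::real_normed_vector set \<Rightarrow> ('e \<Rightarrow> 'f::real_normed_vector) \<Rightarrow> bool" where
  "smooth_on S f \<longleftrightarrow> (\<forall>k. Ck_on k S f)"

text \<open>
  The underlying space of the manifold is the whole (Hausdorff, second countable) type \<open>'a\<close>.
  A chart is a pair of its domain and its coordinate map into the Euclidean space \<open>'e\<close>; only the
  values of the coordinate map on the domain matter. The smooth structure is given by an atlas,
  which need not be maximal.
\<close>

type_synonym ('a, 'e) chart = "'a set \<times> ('a \<Rightarrow> 'e)"

definition chart_inv :: "('a, 'e) chart \<Rightarrow> 'e \<Rightarrow> 'a" where
  "chart_inv c = inv_into (fst c) (snd c)"

definition chart_range :: "('a, 'e) chart \<Rightarrow> 'e set" where
  "chart_range c = snd c ` fst c"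

definition smooth_atlas ::
  "('a::{t2_space, second_countable_topology}, 'e::euclidean_space) chart set \<Rightarrow> bool" where
  "smooth_atlas A \<longleftrightarrow>
     (\<forall>c\<in>A. open (fst c) \<and> open (chart_range c) \<and>
        homeomorphism (fst c) (chart_range c) (snd c) (chart_inv c)) \<and>
     (\<Union>c\<in>A. fst c) = UNIV \<and>
     (\<forall>c\<in>A. \<forall>d\<in>A. smooth_on (snd c ` (fst c \<inter> fst d)) (snd d \<circ> chart_inv c))"


section \<open>Tangent vectors, alternating forms and multivectors at a point\<close>

text \<open>
  A tangent vector at \<open>x\<close> is the family of its coordinate vectors in all charts around \<open>x\<close>, which
  transform into each other by the derivatives of the chart transitions.
\<close>

type_synonym ('a, 'e) tvec = "('a, 'e) chart \<Rightarrow> 'e"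

definition tangent_space ::
  "('a, 'e::euclidean_space) chart set \<Rightarrow> 'a \<Rightarrow> ('a, 'e) tvec set" where
  "tangent_space A x =
     {v. (\<forall>c. \<not> (c \<in> A \<and> x \<in> fst c) \<longrightarrow> v c = 0) \<and>
         (\<forall>c\<in>A. \<forall>d\<in>A. x \<in> fst c \<longrightarrow> x \<in> fst d \<longrightarrow>
            v d = frechet_derivative (snd d \<circ> chart_inv c) (at (snd c x)) (v c))}"

text \<open>The tangent vector at \<open>x\<close> whose coordinate vector in the chart \<open>c\<close> is \<open>e\<close>.\<close>

definition coord_vector ::
  "('a, 'e::euclidean_space) chart set \<Rightarrow> ('a, 'e) chart \<Rightarrow> 'a \<Rightarrow> 'e \<Rightarrow> ('a, 'e) tvec" where
  "coord_vector A c x e =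
     (\<lambda>d. if d \<in> A \<and> x \<in> fst d
          then frechet_derivative (snd d \<circ> chart_inv c) (at (snd c x)) e else 0)"

text \<open>
  \<open>alt_forms A x k\<close> is the space of alternating \<open>k\<close>-linear forms on the tangent space at \<open>x\<close>. Forms
  take a list of tangent vectors and vanish on all other lists, so that the zero form is the same
  object in all degrees; for negative \<open>k\<close> it is the only form.
\<close>

type_synonym ('a, 'e) altform = "('a, 'e) tvec list \<Rightarrow> real"

definition alt_forms ::
  "('a, 'e::euclidean_space) chart set \<Rightarrow> 'a \<Rightarrow> int \<Rightarrow> ('a, 'e) altform set" where
  "alt_forms A x k =
     {\<omega>. (\<forall>vs. \<not> (int (length vs) = k \<and> set vs \<subseteq> tangent_space A x) \<longrightarrow> \<omega> vs = 0) \<and>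
         (\<forall>vs i v w a b. set vs \<subseteq> tangent_space A x \<longrightarrow> i < length vs \<longrightarrow>
            v \<in> tangent_space A x \<longrightarrow> w \<in> tangent_space A x \<longrightarrow>
            \<omega> (vs[i := (\<lambda>c. a *\<^sub>R v c + b *\<^sub>R w c)]) = a * \<omega> (vs[i := v]) + b * \<omega> (vs[i := w])) \<and>
         (\<forall>vs i j. i < j \<longrightarrow> j < length vs \<longrightarrow> vs ! i = vs ! j \<longrightarrow> \<omega> vs = 0)}"

text \<open>
  The \<open>p\<close>-th exterior power of the tangent space is realized inside the dual of the space of
  alternating \<open>p\<close>-forms: the decomposable multivector of \<open>u\<^sub>1, \<dots>, u\<^sub>p\<close> is evaluation of alternating
  forms at \<open>[u\<^sub>1, \<dots>, u\<^sub>p]\<close>, and the exterior power is the linear span of the decomposables. By the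
  universal property, alternating \<open>p\<close>-forms are exactly the linear functionals on the exterior
  power, so this is a faithful model of it.
\<close>

type_synonym ('a, 'e) mvec = "('a, 'e) altform \<Rightarrow> real"

definition decomposable ::
  "('a, 'e::euclidean_space) chart set \<Rightarrow> 'a \<Rightarrow> ('a, 'e) tvec list \<Rightarrow> ('a, 'e) mvec" where
  "decomposable A x us = (\<lambda>\<omega>. if \<omega> \<in> (\<Union>k. alt_forms A x k) then \<omega> us else 0)"

definition ext_power ::
  "('a, 'e::euclidean_space) chart set \<Rightarrow> 'a \<Rightarrow> nat \<Rightarrow> ('a, 'e) mvec set" where
  "ext_power A x p =
     {(\<lambda>\<omega>. \<Sum>(r, us)\<leftarrow>l. r * decomposable A x us \<omega>) | l.
        \<forall>(r, us)\<in>set l. length us = p \<and> set us \<subseteq> tangent_space A x}"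


section \<open>Differential forms and multivector fields\<close>

text \<open>
  Smoothness means smoothness of the coefficients with respect to the coordinate frames of all
  charts of the atlas. In the local expression of a multivector field the index lists \<open>es\<close> range
  over all \<open>p\<close>-tuples of basis vectors; the coefficients are thus not unique.
\<close>

type_synonym ('a, 'e) form_field = "'a \<Rightarrow> ('a, 'e) altform"
type_synonym ('a, 'e) mv_field = "'a \<Rightarrow> ('a, 'e) mvec"

definition forms ::
  "('a, 'e::euclidean_space) chart set \<Rightarrow> int \<Rightarrow> ('a, 'e) form_field set" where
  "forms A k =
     {\<omega>. (\<forall>x. \<omega> x \<in> alt_forms A x k) \<and>
         (\<forall>c\<in>A. \<forall>es. smooth_on (chart_range c)
            (\<lambda>y. \<omega> (chart_inv c y) (map (coord_vector A c (chart_inv c y)) es)))}"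

definition mv_fields ::
  "('a, 'e::euclidean_space) chart set \<Rightarrow> nat \<Rightarrow> ('a, 'e) mv_field set" where
  "mv_fields A p =
     {U. (\<forall>x. U x \<in> ext_power A x p) \<and>
         (\<forall>c\<in>A. \<exists>f :: 'e list \<Rightarrow> 'e \<Rightarrow> real.
            (\<forall>es. smooth_on (chart_range c) (f es)) \<and>
            (\<forall>y\<in>chart_range c. U (chart_inv c y) =
               (\<lambda>\<omega>. \<Sum>es | length es = p \<and> set es \<subseteq> Basis. f es y *
                  decomposable A (chart_inv c y) (map (coord_vector A c (chart_inv c y)) es) \<omega>)))}"

text \<open>
  For \<open>U = u\<^sub>1 \<and> \<dots> \<and> u\<^sub>p\<close> this is \<open>\<omega>(u\<^sub>1, \<dots>, u\<^sub>p, \<dots>)\<close>, in accordance with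
  \<open>\<iota>\<^bsub>U \<and> V\<^esub> = \<iota>\<^sub>V \<iota>\<^sub>U\<close>. It is zero if \<open>U\<close> has larger degree than \<open>\<omega>\<close>.
\<close>

definition contract :: "('a, 'e) mv_field \<Rightarrow> ('a, 'e) form_field \<Rightarrow> ('a, 'e) form_field" where
  "contract U \<omega> = (\<lambda>x vs. U x (\<lambda>us. \<omega> x (us @ vs)))"

text \<open>The bilinear operation which concatenates the vector lists of decomposables.\<close>

definition wedge ::
  "('a, 'e::euclidean_space) chart set \<Rightarrow> ('a, 'e) mv_field \<Rightarrow> ('a, 'e) mv_field \<Rightarrow> ('a, 'e) mv_field"
  where
  "wedge A U V = (\<lambda>x \<omega>. if \<omega> \<in> (\<Union>k. alt_forms A x k)
     then V x (\<lambda>vs. U x (\<lambda>us. \<omega> (us @ vs))) else 0)"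

text \<open>
  The exterior derivative, computed in a chart \<open>c\<close> around \<open>x\<close>:
  \<open>d\<omega>(v\<^sub>0, \<dots>, v\<^sub>k) = \<Sum>\<^sub>i (-1)\<^sup>i v\<^sub>i(\<omega>(\<partial>\<^sub>0, \<dots>, \<partial>\<^sub>k without \<partial>\<^sub>i))\<close>, where \<open>\<partial>\<^sub>j\<close> is the vector field
  with constant coordinates in the chart which extends \<open>v\<^sub>j\<close>. The result does not depend on the
  choice of the chart.
\<close>

definition chart_at :: "('a, 'e) chart set \<Rightarrow> 'a \<Rightarrow> ('a, 'e) chart" where
  "chart_at A x = (SOME c. c \<in> A \<and> x \<in> fst c)"

definition ext_deriv ::
  "('a, 'e::euclidean_space) chart set \<Rightarrow> ('a, 'e) form_field \<Rightarrow> ('a, 'e) form_field" where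
  "ext_deriv A \<omega> = (\<lambda>x vs. if set vs \<subseteq> tangent_space A x then
     (let c = chart_at A x; es = map (\<lambda>v. v c) vs in
      \<Sum>i<length es. (-1) ^ i *
        frechet_derivative
          (\<lambda>y. \<omega> (chart_inv c y)
                 (map (coord_vector A c (chart_inv c y)) (take i es @ drop (Suc i) es)))
          (at (snd c x)) (es ! i))
     else 0)"

text \<open>In the following, \<open>p\<close> and \<open>q\<close> are the degrees of \<open>U\<close> and \<open>V\<close>.\<close>

definition lie_deriv ::
  "('a, 'e::euclidean_space) chart set \<Rightarrow> nat \<Rightarrow> ('a, 'e) mv_field \<Rightarrow>
   ('a, 'e) form_field \<Rightarrow> ('a, 'e) form_field" where
  "lie_deriv A p U \<omega> =
     (\<lambda>x vs. ext_deriv A (contract U \<omega>) x vs - (-1) ^ p * contract U (ext_deriv A \<omega>) x vs)"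

text \<open>
  The Schouten-Nijenhuis bracket for \<open>p, q \<ge> 1\<close>, in the normalization
  \<open>\<iota>\<^bsub>[U,V]\<^esub> = (-1)\<^bsup>(p-1)q\<^esup> \<L>\<^sub>U \<iota>\<^sub>V - \<iota>\<^sub>V \<L>\<^sub>U\<close>, which determines it uniquely.
\<close>

definition schouten ::
  "('a, 'e::euclidean_space) chart set \<Rightarrow> nat \<Rightarrow> nat \<Rightarrow>
   ('a, 'e) mv_field \<Rightarrow> ('a, 'e) mv_field \<Rightarrow> ('a, 'e) mv_field" where
  "schouten A p q U V =
     (THE W. W \<in> mv_fields A (p + q - 1) \<and>
        (\<forall>k. \<forall>\<omega>\<in>forms A k. contract W \<omega> =
           (\<lambda>x vs. (-1) ^ ((p - 1) * q) * lie_deriv A p U (contract V \<omega>) x vs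
                  - contract V (lie_deriv A p U \<omega>) x vs)))"


section \<open>Conformal Hamiltonian forms\<close>

text \<open>
  There is no upper bound on the degree \<open>p\<close> here: brackets and cup products of forms of degrees
  \<open>n - p\<close> and \<open>n - q\<close> may have negative degree, i.e. be zero, with an associated multivector field
  of degree greater than \<open>n\<close>.
\<close>

definition inf_conformal ::
  "('a, 'e::euclidean_space) chart set \<Rightarrow> ('a, 'e) form_field \<Rightarrow> nat \<Rightarrow> ('a, 'e) mv_field \<Rightarrow> bool"
  where
  "inf_conformal A \<Theta> p X \<longleftrightarrow> 1 \<le> p \<and> X \<in> mv_fields A p \<and>
     (\<exists>V\<in>mv_fields A (p - 1). lie_deriv A p X \<Theta> = contract V \<Theta>)"

definition associated_mv ::
  "('a, 'e::euclidean_space) chart set \<Rightarrow> ('a, 'e) form_field \<Rightarrow> nat \<Rightarrow>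
   ('a, 'e) form_field \<Rightarrow> ('a, 'e) mv_field \<Rightarrow> bool" where
  "associated_mv A \<Theta> p \<alpha> X \<longleftrightarrow> inf_conformal A \<Theta> p X \<and> contract X \<Theta> = (\<lambda>x vs. - \<alpha> x vs)"

definition conformal_hamiltonian ::
  "('a, 'e::euclidean_space) chart set \<Rightarrow> nat \<Rightarrow> ('a, 'e) form_field \<Rightarrow> nat \<Rightarrow>
   ('a, 'e) form_field \<Rightarrow> bool" where
  "conformal_hamiltonian A n \<Theta> p \<alpha> \<longleftrightarrow>
     \<alpha> \<in> forms A (int n - int p) \<and> (\<exists>X. associated_mv A \<Theta> p \<alpha> X)"

text \<open>
  Bracket and cup product do not depend on the associated multivector fields used to define them;
  \<open>ham_mv\<close> picks one.
\<close>

definition ham_mv ::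
  "('a, 'e::euclidean_space) chart set \<Rightarrow> ('a, 'e) form_field \<Rightarrow> nat \<Rightarrow>
   ('a, 'e) form_field \<Rightarrow> ('a, 'e) mv_field" where
  "ham_mv A \<Theta> p \<alpha> = (SOME X. associated_mv A \<Theta> p \<alpha> X)"

definition jacobi_bracket ::
  "('a, 'e::euclidean_space) chart set \<Rightarrow> ('a, 'e) form_field \<Rightarrow> nat \<Rightarrow> nat \<Rightarrow>
   ('a, 'e) form_field \<Rightarrow> ('a, 'e) form_field \<Rightarrow> ('a, 'e) form_field" where
  "jacobi_bracket A \<Theta> p q \<alpha> \<beta> =
     (\<lambda>x vs. - contract (schouten A p q (ham_mv A \<Theta> p \<alpha>) (ham_mv A \<Theta> q \<beta>)) \<Theta> x vs)"

definition cup_product ::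
  "('a, 'e::euclidean_space) chart set \<Rightarrow> ('a, 'e) form_field \<Rightarrow> nat \<Rightarrow> nat \<Rightarrow>
   ('a, 'e) form_field \<Rightarrow> ('a, 'e) form_field \<Rightarrow> ('a, 'e) form_field" where
  "cup_product A \<Theta> p q \<alpha> \<beta> =
     (\<lambda>x vs. - contract (wedge A (ham_mv A \<Theta> p \<alpha>) (ham_mv A \<Theta> q \<beta>)) \<Theta> x vs)"

end

theory Submission
  imports Defs
begin

text \<open>
  Bracket and cup product are, up to sign, contractions of \<open>\<Theta>\<close> with \<open>[X, Y]\<close> and \<open>X \<and> Y\<close>. For
  multivector fields \<open>X\<close>, \<open>Y\<close>, \<open>Z\<close> of degrees \<open>p\<close>, \<open>q\<close>, \<open>r\<close> the normalization of the Schouten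
  bracket and \<open>\<iota>\<^bsub>Y \<and> Z\<^esub> = \<iota>\<^sub>Z \<iota>\<^sub>Y\<close> give
  \<open>\<iota>\<^bsub>[X, Y \<and> Z]\<^esub> = (-1)\<^bsup>(p-1)(q+r)\<^esup> \<L>\<^sub>X \<iota>\<^sub>Z \<iota>\<^sub>Y - \<iota>\<^sub>Z \<iota>\<^sub>Y \<L>\<^sub>X\<close>,
  and inserting \<open>\<plusminus> (-1)\<^bsup>(p-1)q\<^esup> \<iota>\<^sub>Z \<L>\<^sub>X \<iota>\<^sub>Y\<close> turns the right side into
  \<open>\<iota>\<^sub>Z \<iota>\<^bsub>[X, Y]\<^esub> + (-1)\<^bsup>(p-1)q\<^esup> \<iota>\<^bsub>[X, Z]\<^esub> \<iota>\<^sub>Y\<close>. Applied to \<open>\<Theta>\<close> this is the Leibniz rule.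

  One point needs care. The field that is chosen for \<open>\<beta> \<or> \<gamma>\<close> need not be \<open>Y \<and> Z\<close>; the two merely
  have the same contraction with \<open>\<Theta>\<close>, while the formula above also contracts them with \<open>\<L>\<^sub>X \<Theta>\<close>.
  Here conformality enters: \<open>\<L>\<^sub>X \<Theta> = \<iota>\<^sub>V \<Theta>\<close>, and contractions commute up to sign, so fields with the
  same contraction with \<open>\<Theta>\<close> also have the same contraction with \<open>\<iota>\<^sub>V \<Theta>\<close>
  (\<open>contract_contract_cong\<close>). For such a choice to exist at all, \<open>[X, Y]\<close> and \<open>Y \<and> Z\<close> have to be
  conformal again. This follows from \<open>\<L>\<^bsub>[X, Y]\<^esub> = - (-1)\<^bsup>(p-1)q+p\<^esup> \<L>\<^sub>X \<L>\<^sub>Y - \<L>\<^sub>Y \<L>\<^sub>X\<close>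
  (\<open>lie_deriv_schouten\<close>, a consequence of \<open>d d = 0\<close>) and its analogue for wedge products.

  The main work is the existence and uniqueness of the Schouten bracket (lemma \<open>schouten\<close>). For
  existence, write \<open>X = \<Sum> f\<^sub>I \<partial>\<^sub>I\<close> and \<open>Y = \<Sum> g\<^sub>J \<partial>\<^sub>J\<close> in a chart: in
  \<open>(-1)\<^bsup>(p-1)q\<^esup> \<L>\<^sub>X \<iota>\<^sub>Y - \<iota>\<^sub>Y \<L>\<^sub>X\<close> all derivatives of the form it acts on cancel, and what is left is
  a contraction whose coefficients contain derivatives of \<open>f\<close> and \<open>g\<close> only (\<open>local_bracket\<close>). For
  uniqueness, and in order to glue the local expressions, every alternating form at a point is the
  value of a global form, by a bump function (\<open>alt_form_extends\<close>).

  That the exterior derivative does not depend on the chart (\<open>ext_d_pullback\<close>) and that its square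
  vanishes (\<open>ext_d_ext_d\<close>) rest on the symmetry of second derivatives and on one cancellation: if two
  entries of a list are removed one after the other, the two orders come with opposite signs
  (\<open>antisum_antisum_symmetric\<close>).
\<close>

section \<open>Calculus of smooth functions\<close>

lemma has_derivative_frechet:
  "f differentiable (at x) \<Longrightarrow> (f has_derivative frechet_derivative f (at x)) (at x)"
  by (simp add: frechet_derivative_works)

lemma frechet_derivativeI:
  "(f has_derivative f') (at x) \<Longrightarrow> frechet_derivative f (at x) = f'"
  by (rule frechet_derivative_at[symmetric])

lemma frechet_derivative_cong_open:
  assumes "open S" "x \<in> S" "\<And>y. y \<in> S \<Longrightarrow> f y = g y"
  shows "frechet_derivative f (at x) = frechet_derivative g (at x)"
proof -
  have "(f has_derivative D) (at x) \<longleftrightarrow> (g has_derivative D) (at x)" for D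
    using has_derivative_transform_within_open[OF _ assms(1,2), of f D UNIV g]
      has_derivative_transform_within_open[OF _ assms(1,2), of g D UNIV f] assms(3)
    by auto
  then show ?thesis
    by (simp add: frechet_derivative_def)
qed

lemma differentiable_cong_open:
  assumes "open S" "x \<in> S" "\<And>y. y \<in> S \<Longrightarrow> f y = g y" "f differentiable (at x)"
  shows "g differentiable (at x)"
proof -
  obtain D where "(f has_derivative D) (at x)"
    using assms(4) by (auto simp: differentiable_def)
  then have "(g has_derivative D) (at x)"
    by (rule has_derivative_transform_within_open[OF _ assms(1,2)]) (rule assms(3))
  then show ?thesis by (auto simp: differentiable_def)
qed

text \<open>
  The iterated derivatives in \<open>Ck_on\<close> are taken of functions on the whole space. Openness of the set
  makes them independent of the values outside of it.
\<close>

lemma Ck_on_cong: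
  assumes "open S" "\<And>y. y \<in> S \<Longrightarrow> f y = g y" "Ck_on k S f"
  shows "Ck_on k S g"
  using assms(2,3)
proof (induction k arbitrary: f g)
  case 0
  then show ?case by (simp cong: continuous_on_cong)
next
  case (Suc k)
  have "Ck_on k S (\<lambda>x. frechet_derivative g (at x) v)" for v
  proof (rule Suc.IH)
    show "frechet_derivative f (at y) v = frechet_derivative g (at y) v" if "y \<in> S" for y
      using frechet_derivative_cong_open[OF assms(1) that, of f g] Suc.prems(1) by simp
  qed (use Suc.prems in simp)
  moreover have "\<forall>x\<in>S. g differentiable (at x)"
    using differentiable_cong_open[OF assms(1), of _ f g] Suc.prems by simp
  ultimately show ?case by simp
qed

lemma Ck_on_Un: "open S \<Longrightarrow> open T \<Longrightarrow> Ck_on k S f \<Longrightarrow> Ck_on k T f \<Longrightarrow> Ck_on k (S \<union> T) f"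
  by (induction k arbitrary: f) (auto intro: continuous_on_open_Un)

lemma Ck_on_const: "Ck_on k S (\<lambda>x. c)"
  by (induction k arbitrary: c) auto

lemma Ck_on_SucD: "Ck_on (Suc k) S f \<Longrightarrow> Ck_on k S f"
proof (induction k arbitrary: f)
  case 0
  then show ?case
    by (auto intro!: continuous_at_imp_continuous_on differentiable_imp_continuous_within)
next
  case (Suc k)
  then show ?case by (metis Ck_on.simps(2))
qed

lemma Ck_on_linear:
  assumes "open S" "bounded_linear L" "Ck_on k S f"
  shows "Ck_on k S (\<lambda>x. L (f x))"
  using assms(3)
proof (induction k arbitrary: f)
  case 0
  then show ?case by (simp add: bounded_linear.continuous_on[OF assms(2)])
next
  case (Suc k)
  have D: "((\<lambda>x. L (f x)) has_derivative (\<lambda>v. L (frechet_derivative f (at x) v))) (at x)"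
    if "x \<in> S" for x
    using Suc.prems that
    by (intro bounded_linear.has_derivative[OF assms(2)] has_derivative_frechet) auto
  have "Ck_on k S (\<lambda>x. frechet_derivative (\<lambda>x. L (f x)) (at x) v)" for v
    by (rule Ck_on_cong[OF assms(1) _ Suc.IH[of "\<lambda>x. frechet_derivative f (at x) v"]])
       (use Suc.prems in \<open>simp_all add: frechet_derivativeI[OF D]\<close>)
  then show ?case
    using D by (auto simp: differentiable_def)
qed

lemma Ck_on_add:
  assumes "open S" "Ck_on k S f" "Ck_on k S g"
  shows "Ck_on k S (\<lambda>x. f x + g x)"
  using assms(2,3)
proof (induction k arbitrary: f g)
  case 0
  then show ?case by (simp add: continuous_on_add)
next
  case (Suc k)
  have D: "((\<lambda>x. f x + g x) has_derivative
      (\<lambda>v. frechet_derivative f (at x) v + frechet_derivative g (at x) v)) (at x)"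
    if "x \<in> S" for x
    using Suc.prems that by (intro has_derivative_add has_derivative_frechet) auto
  have "Ck_on k S (\<lambda>x. frechet_derivative (\<lambda>x. f x + g x) (at x) v)" for v
    by (rule Ck_on_cong[OF assms(1) _ Suc.IH[of "\<lambda>x. frechet_derivative f (at x) v"
          "\<lambda>x. frechet_derivative g (at x) v"]])
       (use Suc.prems in \<open>simp_all add: frechet_derivativeI[OF D]\<close>)
  then show ?case
    using D by (auto simp: differentiable_def)
qed

lemma Ck_on_mult:
  fixes f g :: "'e::real_normed_vector \<Rightarrow> real"
  assumes "open S" "Ck_on k S f" "Ck_on k S g"
  shows "Ck_on k S (\<lambda>x. f x * g x)"
  using assms(2,3)
proof (induction k arbitrary: f g)
  case 0
  then show ?case by (simp add: continuous_on_mult)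
next
  case (Suc k)
  have D: "((\<lambda>x. f x * g x) has_derivative
      (\<lambda>v. f x * frechet_derivative g (at x) v + frechet_derivative f (at x) v * g x)) (at x)"
    if "x \<in> S" for x
    using Suc.prems that by (intro has_derivative_mult has_derivative_frechet) auto
  have "Ck_on k S (\<lambda>x. frechet_derivative (\<lambda>x. f x * g x) (at x) v)" for v
  proof (rule Ck_on_cong[OF assms(1)])
    show "Ck_on k S (\<lambda>x. f x * frechet_derivative g (at x) v + frechet_derivative f (at x) v * g x)"
      using Suc.prems Suc.prems[THEN Ck_on_SucD] by (intro Ck_on_add[OF assms(1)] Suc.IH) auto
  qed (simp add: frechet_derivativeI[OF D])
  then show ?case
    using D by (auto simp: differentiable_def)
qed

lemma Ck_on_sum:
  assumes "open S" "\<And>i. i \<in> I \<Longrightarrow> Ck_on k S (f i)"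
  shows "Ck_on k S (\<lambda>x. \<Sum>i\<in>I. f i x)"
  using assms(2) by (induction I rule: infinite_finite_induct)
    (auto intro: Ck_on_const Ck_on_add[OF assms(1)])

lemma linear_euclidean_expansion:
  fixes L :: "'e::euclidean_space \<Rightarrow> 'f::real_vector"
  assumes "linear L"
  shows "L v = (\<Sum>b\<in>Basis. (v \<bullet> b) *\<^sub>R L b)"
proof -
  have "L v = L (\<Sum>b\<in>Basis. (v \<bullet> b) *\<^sub>R b)" by (simp add: euclidean_representation)
  also have "\<dots> = (\<Sum>b\<in>Basis. (v \<bullet> b) *\<^sub>R L b)"
    by (simp add: linear_sum[OF assms] linear_scale[OF assms])
  finally show ?thesis .
qed

text \<open>
  In the chain rule \<open>f'(g x) (g'(x) v)\<close> the direction in which \<open>f\<close> is differentiated varies with \<open>x\<close>,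
  whereas \<open>Ck_on\<close> speaks of fixed directions. Expanding \<open>g'(x) v\<close> in the orthonormal basis makes the
  directions constant, so that the induction applies to each partial derivative of \<open>f\<close>.
\<close>

lemma Ck_on_compose:
  fixes f :: "'f::euclidean_space \<Rightarrow> real" and g :: "'e::real_normed_vector \<Rightarrow> 'f"
  assumes "open S" "open T" "g ` S \<subseteq> T" "Ck_on k T f" "Ck_on k S g"
  shows "Ck_on k S (\<lambda>x. f (g x))"
  using assms(4,5)
proof (induction k arbitrary: f)
  case 0
  then show ?case using assms(3) by (auto intro: continuous_on_compose2)
next
  case (Suc k)
  have f: "f differentiable (at (g x))" and g: "g differentiable (at x)" if "x \<in> S" for x
    using Suc.prems that image_subset_iff[THEN iffD1, OF assms(3)] by simp_all
  have D: "((\<lambda>x. f (g x)) has_derivative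
      (\<lambda>v. \<Sum>b\<in>Basis. (frechet_derivative g (at x) v \<bullet> b) * frechet_derivative f (at (g x)) b)) (at x)"
    if "x \<in> S" for x
  proof -
    let ?L = "frechet_derivative f (at (g x))"
    have "(\<lambda>v. ?L (frechet_derivative g (at x) v)) =
        (\<lambda>v. \<Sum>b\<in>Basis. (frechet_derivative g (at x) v \<bullet> b) * ?L b)"
      by (rule ext, subst linear_euclidean_expansion[OF linear_frechet_derivative[OF f[OF that]]])
        (rule sum.cong, simp_all)
    then show ?thesis
      using diff_chain_at[OF has_derivative_frechet[OF g[OF that]] has_derivative_frechet[OF f[OF that]]]
      by (simp add: o_def)
  qed
  have "Ck_on k S (\<lambda>x. frechet_derivative (\<lambda>x. f (g x)) (at x) v)" for v
  proof (rule Ck_on_cong[OF assms(1)])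
    have "Ck_on k S g" "Ck_on k S (\<lambda>x. frechet_derivative g (at x) v)"
      using Ck_on_SucD[OF Suc.prems(2)] Suc.prems(2) by simp_all
    moreover have "Ck_on k T (\<lambda>x. frechet_derivative f (at x) b)" for b
      using Suc.prems(1) by simp
    ultimately have "Ck_on k S (\<lambda>x. (frechet_derivative g (at x) v \<bullet> b) *
        frechet_derivative f (at (g x)) b)" for b
      using Ck_on_mult[OF assms(1) Ck_on_linear[OF assms(1) bounded_linear_inner_left] Suc.IH]
      by blast
    then show "Ck_on k S (\<lambda>x. \<Sum>b\<in>Basis. (frechet_derivative g (at x) v \<bullet> b) *
        frechet_derivative f (at (g x)) b)"
      by (rule Ck_on_sum[OF assms(1)])
  qed (simp add: frechet_derivativeI[OF D])
  then show ?case
    using D by (auto simp: differentiable_def)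
qed

lemma smooth_on_cong:
  "open S \<Longrightarrow> (\<And>y. y \<in> S \<Longrightarrow> f y = g y) \<Longrightarrow> smooth_on S f \<Longrightarrow> smooth_on S g"
  unfolding smooth_on_def by (blast intro: Ck_on_cong[where f = f and g = g])

lemma smooth_on_Un: "open S \<Longrightarrow> open T \<Longrightarrow> smooth_on S f \<Longrightarrow> smooth_on T f \<Longrightarrow> smooth_on (S \<union> T) f"
  unfolding smooth_on_def using Ck_on_Un by blast

lemma smooth_on_const: "smooth_on S (\<lambda>x. c)"
  by (simp add: smooth_on_def Ck_on_const)

lemma smooth_on_linear: "open S \<Longrightarrow> bounded_linear L \<Longrightarrow> smooth_on S f \<Longrightarrow> smooth_on S (\<lambda>x. L (f x))"
  by (simp add: smooth_on_def Ck_on_linear)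

lemma smooth_on_add:
  "open S \<Longrightarrow> smooth_on S f \<Longrightarrow> smooth_on S g \<Longrightarrow> smooth_on S (\<lambda>x. f x + g x)"
  by (simp add: smooth_on_def Ck_on_add)

lemma smooth_on_mult:
  fixes f g :: "'e::real_normed_vector \<Rightarrow> real"
  shows "open S \<Longrightarrow> smooth_on S f \<Longrightarrow> smooth_on S g \<Longrightarrow> smooth_on S (\<lambda>x. f x * g x)"
  by (simp add: smooth_on_def Ck_on_mult)

lemma smooth_on_sum:
  "open S \<Longrightarrow> (\<And>i. i \<in> I \<Longrightarrow> smooth_on S (f i)) \<Longrightarrow> smooth_on S (\<lambda>x. \<Sum>i\<in>I. f i x)"
  by (simp add: smooth_on_def Ck_on_sum)

lemma smooth_on_compose:
  fixes f :: "'f::euclidean_space \<Rightarrow> real" and g :: "'e::real_normed_vector \<Rightarrow> 'f"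
  shows "open S \<Longrightarrow> open T \<Longrightarrow> g ` S \<subseteq> T \<Longrightarrow> smooth_on T f \<Longrightarrow> smooth_on S g
    \<Longrightarrow> smooth_on S (\<lambda>x. f (g x))"
  unfolding smooth_on_def by (blast intro: Ck_on_compose[where f = f and g = g])

lemma smooth_on_frechet: "smooth_on S f \<Longrightarrow> smooth_on S (\<lambda>x. frechet_derivative f (at x) v)"
  unfolding smooth_on_def by (metis Ck_on.simps(2))

lemma smooth_on_differentiable: "smooth_on S f \<Longrightarrow> x \<in> S \<Longrightarrow> f differentiable (at x)"
  unfolding smooth_on_def by (metis Ck_on.simps(2))

lemma smooth_on_continuous: "smooth_on S f \<Longrightarrow> continuous_on S f"
  unfolding smooth_on_def by (metis Ck_on.simps(1))

lemma smooth_on_ident: "smooth_on S (\<lambda>x. x)"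
  unfolding smooth_on_def
proof
  fix k show "Ck_on k S (\<lambda>x. x)"
    by (cases k) (simp_all add: Ck_on_const)
qed

section \<open>Symmetry of second derivatives\<close>

text \<open>
  Two applications of the mean value theorem, along \<open>u\<close> and then along \<open>v\<close>. The left side is symmetric
  in \<open>u\<close> and \<open>v\<close>; this is what makes second derivatives symmetric.
\<close>

lemma mixed_difference_mean_value:
  fixes f :: "'e::real_normed_vector \<Rightarrow> real"
  assumes S: "\<And>y. dist x y < d \<Longrightarrow> f differentiable (at y)"
    and S2: "\<And>y. dist x y < d \<Longrightarrow> (\<lambda>y. frechet_derivative f (at y) u) differentiable (at y)"
    and t: "0 < t" "t * (norm u + norm v) < d"
  obtains z where "dist x z < d"
    "f (x + t *\<^sub>R u + t *\<^sub>R v) - f (x + t *\<^sub>R u) - f (x + t *\<^sub>R v) + f x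
      = t * t * frechet_derivative (\<lambda>y. frechet_derivative f (at y) u) (at z) v"
proof -
  have near: "dist x (x + s *\<^sub>R u + r *\<^sub>R v) < d" if "0 \<le> s" "s \<le> t" "0 \<le> r" "r \<le> t" for s r
  proof -
    have "dist x (x + s *\<^sub>R u + r *\<^sub>R v) = norm (s *\<^sub>R u + r *\<^sub>R v)"
      by (metis add.assoc add_diff_cancel_left' dist_norm norm_minus_commute)
    also have "\<dots> \<le> s * norm u + r * norm v"
      using that norm_triangle_ineq[of "s *\<^sub>R u" "r *\<^sub>R v"] by simp
    also have "\<dots> \<le> t * norm u + t * norm v"
      using that by (intro add_mono mult_right_mono) auto
    finally show ?thesis using t by (simp add: algebra_simps)
  qed
  define \<phi> where "\<phi> = (\<lambda>s. f (x + s *\<^sub>R u + t *\<^sub>R v) - f (x + s *\<^sub>R u))"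
  have \<phi>: "(\<phi> has_real_derivative frechet_derivative f (at (x + s *\<^sub>R u + t *\<^sub>R v)) u
      - frechet_derivative f (at (x + s *\<^sub>R u)) u) (at s)" if "0 \<le> s" "s \<le> t" for s
  proof -
    have line: "((\<lambda>s. f (w + s *\<^sub>R u)) has_real_derivative frechet_derivative f (at (w + s *\<^sub>R u)) u) (at s)"
      if "dist x (w + s *\<^sub>R u) < d" for w
    proof -
      have "((\<lambda>s. w + s *\<^sub>R u) has_derivative (\<lambda>h. h *\<^sub>R u)) (at s)"
        by (auto intro!: derivative_eq_intros)
      from diff_chain_at[OF this has_derivative_frechet[OF S[OF that]]]
      show ?thesis
        using linear_scale[OF linear_frechet_derivative[OF S[OF that]]]
        by (simp add: has_field_derivative_def o_def mult.commute[of _ "frechet_derivative _ _ _"])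
    qed
    show ?thesis
      unfolding \<phi>_def
      using DERIV_diff[OF line[of "x + t *\<^sub>R v"] line[of x]] near[of s t] near[of s 0] that t
      by (simp add: algebra_simps)
  qed
  obtain s where s: "0 < s" "s < t" and eq1: "\<phi> t - \<phi> 0 = t *
      (frechet_derivative f (at (x + s *\<^sub>R u + t *\<^sub>R v)) u - frechet_derivative f (at (x + s *\<^sub>R u)) u)"
    using MVT2[OF t(1) \<phi>] by auto
  define a where "a = (\<lambda>y. frechet_derivative f (at y) u)"
  have \<psi>: "((\<lambda>r. a (x + s *\<^sub>R u + r *\<^sub>R v)) has_real_derivative
      frechet_derivative a (at (x + s *\<^sub>R u + r *\<^sub>R v)) v) (at r)" if "0 \<le> r" "r \<le> t" for r
  proof -
    have diff: "a differentiable (at (x + s *\<^sub>R u + r *\<^sub>R v))"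
      unfolding a_def using near[of s r] s that by (intro S2) auto
    have "((\<lambda>r. x + s *\<^sub>R u + r *\<^sub>R v) has_derivative (\<lambda>h. h *\<^sub>R v)) (at r)"
      by (auto intro!: derivative_eq_intros)
    from diff_chain_at[OF this has_derivative_frechet[OF diff]]
    show ?thesis
      using linear_scale[OF linear_frechet_derivative[OF diff]]
      by (simp add: has_field_derivative_def o_def mult.commute[of _ "frechet_derivative _ _ _"])
  qed
  obtain r where r: "0 < r" "r < t" and eq2: "a (x + s *\<^sub>R u + t *\<^sub>R v) - a (x + s *\<^sub>R u + 0 *\<^sub>R v)
      = t * frechet_derivative a (at (x + s *\<^sub>R u + r *\<^sub>R v)) v"
    using MVT2[OF t(1) \<psi>] by auto
  show ?thesis
  proof (rule that)
    show "dist x (x + s *\<^sub>R u + r *\<^sub>R v) < d" using near s r by simp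
    show "f (x + t *\<^sub>R u + t *\<^sub>R v) - f (x + t *\<^sub>R u) - f (x + t *\<^sub>R v) + f x
      = t * t * frechet_derivative (\<lambda>y. frechet_derivative f (at y) u) (at (x + s *\<^sub>R u + r *\<^sub>R v)) v"
      using eq1 eq2 unfolding \<phi>_def a_def by simp
  qed
qed

text \<open>
  If the two mixed derivatives differed at \<open>x\<close>, then by continuity they would have no common value on
  a small ball; but both attain the same second difference quotient there.
\<close>

lemma frechet_derivative_commute_real:
  fixes f :: "'e::real_normed_vector \<Rightarrow> real"
  assumes "open S" "x \<in> S" "smooth_on S f"
  shows "frechet_derivative (\<lambda>y. frechet_derivative f (at y) u) (at x) v =
    frechet_derivative (\<lambda>y. frechet_derivative f (at y) v) (at x) u" (is "?g x = ?h x")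
proof (rule ccontr)
  assume neq: "?g x \<noteq> ?h x"
  define e where "e = dist (?g x) (?h x) / 2"
  have e: "e > 0" using neq by (simp add: e_def)
  have cont: "isCont ?g x" "isCont ?h x"
    using smooth_on_continuous[OF smooth_on_frechet[OF smooth_on_frechet[OF assms(3)]]] assms(1,2)
    by (auto simp: continuous_on_eq_continuous_at)
  obtain d1 where d1: "d1 > 0" "\<And>y. dist y x < d1 \<Longrightarrow> dist (?g y) (?g x) < e"
    using cont(1) e unfolding continuous_at_eps_delta dist_norm by blast
  obtain d2 where d2: "d2 > 0" "\<And>y. dist y x < d2 \<Longrightarrow> dist (?h y) (?h x) < e"
    using cont(2) e unfolding continuous_at_eps_delta dist_norm by blast
  obtain d3 where d3: "d3 > 0" "ball x d3 \<subseteq> S"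
    using assms(1,2) open_contains_ball by blast
  define d where "d = min d1 (min d2 d3)"
  have d: "d > 0" using d1 d2 d3 by (simp add: d_def)
  \<comment> \<open>The summand \<open>1\<close> keeps the denominator positive when \<open>u\<close> and \<open>v\<close> vanish.\<close>
  define t where "t = d / (2 * (norm u + norm v + 1))"
  have pos: "2 * (norm u + norm v + 1) > 0"
    by (simp add: add_nonneg_pos)
  then have t: "t > 0" using d by (simp add: t_def)
  have "t * (2 * (norm u + norm v + 1)) = d"
    using pos unfolding t_def by (metis less_irrefl nonzero_eq_divide_eq)
  then have "2 * (t * (norm u + norm v)) + 2 * t = d" by (simp add: algebra_simps)
  moreover have "0 \<le> t * (norm u + norm v)" using t by simp
  ultimately have "t * (norm u + norm v) < d" using t by linarith
  then have td: "t * (norm u + norm v) < d" "t * (norm v + norm u) < d"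
    by (simp_all only: add.commute)
  have inS: "y \<in> S" if "dist x y < d" for y
    using that d3(2) by (auto simp: d_def)
  note diff = smooth_on_differentiable[OF assms(3) inS]
    smooth_on_differentiable[OF smooth_on_frechet[OF assms(3)] inS]
  obtain z where z: "dist x z < d"
    "f (x + t *\<^sub>R u + t *\<^sub>R v) - f (x + t *\<^sub>R u) - f (x + t *\<^sub>R v) + f x = t * t * ?g z"
    using mixed_difference_mean_value[OF diff t td(1)] by blast
  obtain w where w: "dist x w < d"
    "f (x + t *\<^sub>R v + t *\<^sub>R u) - f (x + t *\<^sub>R v) - f (x + t *\<^sub>R u) + f x = t * t * ?h w"
    using mixed_difference_mean_value[OF diff t td(2)] by blast
  have "t * t * ?g z = t * t * ?h w"
    using z(2) w(2) by (simp add: algebra_simps)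
  then have "?g z = ?h w" using t by simp
  moreover have "dist (?g z) (?g x) < e" "dist (?h w) (?h x) < e"
    using d1(2)[of z] d2(2)[of w] z(1) w(1) by (simp_all add: d_def dist_commute)
  ultimately have "dist (?g x) (?h x) < e + e"
    using dist_triangle_less_add[of "?g x" "?g z" e "?h x" e] by (metis dist_commute)
  then show False by (simp add: e_def)
qed

lemma frechet_derivative_inner:
  "f differentiable (at x) \<Longrightarrow>
    frechet_derivative (\<lambda>y. f y \<bullet> b) (at x) = (\<lambda>v. frechet_derivative f (at x) v \<bullet> b)"
  by (intro frechet_derivativeI bounded_linear.has_derivative[OF bounded_linear_inner_left]
      has_derivative_frechet)

lemma frechet_derivative_commute:
  fixes f :: "'e::real_normed_vector \<Rightarrow> 'f::euclidean_space"
  assumes "open S" "x \<in> S" "smooth_on S f"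
  shows "frechet_derivative (\<lambda>y. frechet_derivative f (at y) u) (at x) v =
    frechet_derivative (\<lambda>y. frechet_derivative f (at y) v) (at x) u"
proof (rule euclidean_eqI)
  fix b :: 'f
  have inner: "frechet_derivative (\<lambda>y. frechet_derivative (\<lambda>y. f y \<bullet> b) (at y) u) (at x) v
      = frechet_derivative (\<lambda>y. frechet_derivative f (at y) u) (at x) v \<bullet> b" for u v
  proof -
    have "frechet_derivative (\<lambda>y. frechet_derivative (\<lambda>y. f y \<bullet> b) (at y) u) (at x) =
        frechet_derivative (\<lambda>y. frechet_derivative f (at y) u \<bullet> b) (at x)"
      by (rule frechet_derivative_cong_open[OF assms(1,2)])
        (simp add: frechet_derivative_inner[OF smooth_on_differentiable[OF assms(3)]])
    then show ?thesis
      by (simp add: frechet_derivative_inner[OF smooth_on_differentiable[OF smooth_on_frechet[OF assms(3)] assms(2)]])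
  qed
  show "frechet_derivative (\<lambda>y. frechet_derivative f (at y) u) (at x) v \<bullet> b =
    frechet_derivative (\<lambda>y. frechet_derivative f (at y) v) (at x) u \<bullet> b"
    using frechet_derivative_commute_real[OF assms(1,2)
        smooth_on_linear[OF assms(1) bounded_linear_inner_left assms(3)], of b u v]
    by (simp add: inner)
qed

section \<open>Bump functions\<close>

text \<open>
  The polynomial factor makes this family of functions, which are flat at \<open>0\<close>, closed under
  differentiation.
\<close>

definition flat_exp :: "real poly \<Rightarrow> real \<Rightarrow> real" where
  "flat_exp P t = (if t > 0 then poly P (1 / t) * exp (- 1 / t) else 0)"

text \<open>In terms of \<open>x = 1 / t\<close> this says that the exponential function outgrows all polynomials.\<close>

lemma flat_exp_tendsto_0: "(flat_exp P \<longlongrightarrow> 0) (at 0)"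
proof -
  have "((\<lambda>x. \<Sum>i\<le>degree P. coeff P i * (x ^ i / exp x)) \<longlongrightarrow> (\<Sum>i\<le>degree P. coeff P i * 0)) at_top"
    by (intro tendsto_intros tendsto_power_div_exp_0)
  then have "((\<lambda>x. poly P x * exp (- x)) \<longlongrightarrow> 0) at_top"
    by (simp add: poly_altdef sum_distrib_right exp_minus divide_inverse mult.assoc)
  then have "((\<lambda>t. poly P (inverse t) * exp (- inverse t)) \<longlongrightarrow> 0) (at_right 0)"
    by (rule filterlim_compose[OF _ filterlim_inverse_at_top_right])
  moreover have "\<forall>\<^sub>F t in at_right 0. poly P (inverse t) * exp (- inverse t) = flat_exp P t"
    by (auto simp: eventually_at_filter flat_exp_def field_simps)
  ultimately have "(flat_exp P \<longlongrightarrow> 0) (at_right 0)"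
    by (rule Lim_transform_eventually)
  moreover have "(flat_exp P \<longlongrightarrow> 0) (at_left 0)"
    by (rule Lim_transform_eventually[OF tendsto_const])
      (auto simp: eventually_at_filter flat_exp_def)
  ultimately show ?thesis
    by (rule filterlim_split_at[rotated])
qed

lemma flat_exp_deriv:
  "(flat_exp P has_real_derivative flat_exp (pCons 0 (pCons 0 (P - pderiv P))) t) (at t)"
proof -
  consider "t > 0" | "t < 0" | "t = 0" by linarith
  then show ?thesis
  proof cases
    case 1
    have "((\<lambda>t. poly P (1 / t) * exp (- 1 / t)) has_real_derivative
        flat_exp (pCons 0 (pCons 0 (P - pderiv P))) t) (at t)"
      using 1 by (auto intro!: derivative_eq_intros DERIV_chain2[OF poly_DERIV]
          simp: flat_exp_def field_simps power2_eq_square)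
    then show ?thesis
      by (rule has_field_derivative_transform_within_open[where S="{0<..}"])
        (use 1 in \<open>auto simp: flat_exp_def\<close>)
  next
    case 2
    have "((\<lambda>t. 0) has_real_derivative flat_exp (pCons 0 (pCons 0 (P - pderiv P))) t) (at t)"
      using 2 by (simp add: flat_exp_def)
    then show ?thesis
      by (rule has_field_derivative_transform_within_open[where S="{..<0}"])
        (use 2 in \<open>auto simp: flat_exp_def\<close>)
  next
    case 3
    \<comment> \<open>The difference quotient at \<open>0\<close> is again in the family, with the polynomial \<open>X P\<close>.\<close>
    have "((\<lambda>h. (flat_exp P (0 + h) - flat_exp P 0) / h) \<longlongrightarrow> 0) (at 0)"
      by (rule Lim_transform_eventually[OF flat_exp_tendsto_0[of "pCons 0 P"]])
        (auto simp: flat_exp_def eventually_at_filter)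
    then show ?thesis
      using 3 by (simp add: DERIV_def flat_exp_def)
  qed
qed

lemma smooth_flat_exp: "smooth_on UNIV (flat_exp P)"
  unfolding smooth_on_def
proof
  fix k show "Ck_on k UNIV (flat_exp P)"
  proof (induction k arbitrary: P)
    case 0
    show ?case
      using flat_exp_deriv DERIV_isCont continuous_at_imp_continuous_on by (simp, blast)
  next
    case (Suc k)
    have D: "(flat_exp P has_derivative (*) (flat_exp (pCons 0 (pCons 0 (P - pderiv P))) t)) (at t)" for t
      using flat_exp_deriv by (simp add: has_field_derivative_def)
    have "Ck_on k UNIV (\<lambda>t. flat_exp (pCons 0 (pCons 0 (P - pderiv P))) t * v)" for v
      by (intro Ck_on_mult Ck_on_const Suc open_UNIV)
    then show ?case
      using D by (auto simp: frechet_derivativeI[OF D] differentiable_def)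
  qed
qed

text \<open>
  The bump is \<open>exp (- 1 / t)\<close> evaluated at \<open>t = d\<^sup>2 - dist(z\<^sub>0, z)\<^sup>2\<close>, which is positive exactly inside
  the ball, and normalized at the center.
\<close>

lemma smooth_bump_exists:
  fixes z0 :: "'e::euclidean_space"
  assumes "d > 0"
  obtains \<phi> :: "'e \<Rightarrow> real"
  where "smooth_on UNIV \<phi>" "\<phi> z0 = 1" "\<And>z. d \<le> dist z0 z \<Longrightarrow> \<phi> z = 0"
proof
  let ?h = "flat_exp 1"
  let ?q = "\<lambda>z. d\<^sup>2 + (\<Sum>b\<in>Basis. - (((z \<bullet> b) + - (z0 \<bullet> b)) * ((z \<bullet> b) + - (z0 \<bullet> b))))"
  let ?\<phi> = "\<lambda>z. ?h (?q z) * (1 / ?h (d\<^sup>2))"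
  have q: "?q z = d\<^sup>2 - (dist z0 z)\<^sup>2" for z
  proof -
    have "(dist z0 z)\<^sup>2 = (z0 - z) \<bullet> (z0 - z)"
      by (simp add: dist_norm power2_norm_eq_inner)
    also have "\<dots> = (\<Sum>b\<in>Basis. (z \<bullet> b + - (z0 \<bullet> b)) * (z \<bullet> b + - (z0 \<bullet> b)))"
      by (subst euclidean_inner) (auto simp: inner_diff_left algebra_simps intro!: sum.cong)
    finally show ?thesis
      by (simp add: sum_negf)
  qed
  have "smooth_on UNIV (\<lambda>z. ?h (?q z))"
    by (rule smooth_on_compose[where f="?h" and T=UNIV])
      (auto simp del: add_uminus_conv_diff
        intro!: smooth_flat_exp smooth_on_add smooth_on_const smooth_on_sum smooth_on_mult
        smooth_on_linear[OF _ bounded_linear_minus[OF bounded_linear_ident]]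
        smooth_on_linear[OF _ bounded_linear_inner_left] smooth_on_ident)
  then show "smooth_on UNIV ?\<phi>"
    by (intro smooth_on_mult smooth_on_const open_UNIV)
  show "?\<phi> z0 = 1" using assms unfolding q by (simp add: flat_exp_def)
  show "?\<phi> z = 0" if "d \<le> dist z0 z" for z
  proof -
    have "d\<^sup>2 \<le> (dist z0 z)\<^sup>2" using assms that by (intro power_mono) auto
    then show ?thesis unfolding q by (simp add: flat_exp_def)
  qed
qed

section \<open>Alternating multilinear forms\<close>

text \<open>
  The coordinate version of the forms on a tangent space. The degree is an integer because
  contractions may lower it below zero, where the zero form is the only one.
\<close>

definition alternating :: "int \<Rightarrow> ('e::real_vector list \<Rightarrow> real) \<Rightarrow> bool" where
  "alternating k f \<longleftrightarrow>
     (\<forall>vs. int (length vs) \<noteq> k \<longrightarrow> f vs = 0) \<and>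
     (\<forall>us v w a b ws. f (us @ (a *\<^sub>R v + b *\<^sub>R w) # ws) = a * f (us @ v # ws) + b * f (us @ w # ws)) \<and>
     (\<forall>us v ws zs. f (us @ v # ws @ v # zs) = 0)"

lemma alternatingI:
  assumes "\<And>vs. int (length vs) \<noteq> k \<Longrightarrow> f vs = 0"
    and "\<And>us v w a b ws. f (us @ (a *\<^sub>R v + b *\<^sub>R w) # ws) = a * f (us @ v # ws) + b * f (us @ w # ws)"
    and "\<And>us v ws zs. f (us @ v # ws @ v # zs) = 0"
  shows "alternating k f"
  using assms by (simp add: alternating_def)

lemma alternating_length: "alternating k f \<Longrightarrow> int (length vs) \<noteq> k \<Longrightarrow> f vs = 0"
  by (simp add: alternating_def)

lemma alternating_lincomb:
  "alternating k f \<Longrightarrow> f (us @ (a *\<^sub>R v + b *\<^sub>R w) # ws) = a * f (us @ v # ws) + b * f (us @ w # ws)"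
  unfolding alternating_def by blast

lemma alternating_repeat: "alternating k f \<Longrightarrow> f (us @ v # ws @ v # zs) = 0"
  unfolding alternating_def by blast

lemma alternating_linear:
  assumes "alternating k f"
  shows "linear (\<lambda>v. f (us @ v # ws))"
proof (rule linearI)
  show "f (us @ (v + w) # ws) = f (us @ v # ws) + f (us @ w # ws)" for v w
    using alternating_lincomb[OF assms, of us 1 v 1 w ws] by simp
  show "f (us @ (a *\<^sub>R v) # ws) = a *\<^sub>R f (us @ v # ws)" for a v
    using alternating_lincomb[OF assms, of us a v 0 v ws] by simp
qed

text \<open>
  Used to replace an argument that varies from point to point by constant ones with variable
  coefficients.
\<close>

lemma alternating_expand:
  fixes f :: "'e::euclidean_space list \<Rightarrow> real"
  assumes "alternating k f"
  shows "f (us @ v # ws) = (\<Sum>b\<in>Basis. (v \<bullet> b) * f (us @ b # ws))"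
  using linear_euclidean_expansion[OF alternating_linear[OF assms, of us ws], of v] by simp

text \<open>Polarization: expand the value on a list in which \<open>v + w\<close> occurs twice.\<close>

lemma alternating_swap:
  assumes "alternating k f"
  shows "f (us @ v # w # zs) = - f (us @ w # v # zs)"
proof -
  have "0 = f (us @ (1 *\<^sub>R v + 1 *\<^sub>R w) # [] @ (1 *\<^sub>R v + 1 *\<^sub>R w) # zs)"
    by (simp only: alternating_repeat[OF assms])
  also have "\<dots> = f (us @ v # (1 *\<^sub>R v + 1 *\<^sub>R w) # zs) + f (us @ w # (1 *\<^sub>R v + 1 *\<^sub>R w) # zs)"
    by (simp only: alternating_lincomb[OF assms] append_Nil mult_1)
  also have "\<dots> = f (us @ v # [] @ v # zs) + f (us @ v # w # zs) + (f (us @ w # v # zs) + f (us @ w # [] @ w # zs))"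
    using alternating_lincomb[OF assms, of "us @ [v]" 1 v 1 w zs]
      alternating_lincomb[OF assms, of "us @ [w]" 1 v 1 w zs] by simp
  also have "\<dots> = f (us @ v # w # zs) + f (us @ w # v # zs)"
    by (simp only: alternating_repeat[OF assms] add_0 add_0_right)
  finally show ?thesis by simp
qed

lemma alternating_move:
  assumes "alternating k f"
  shows "f (us @ v # ws @ zs) = (-1) ^ length ws * f (us @ ws @ v # zs)"
proof (induction ws arbitrary: us)
  case (Cons w ws)
  have "f (us @ v # (w # ws) @ zs) = - f ((us @ [w]) @ v # ws @ zs)"
    using alternating_swap[OF assms, of us v w "ws @ zs"] by simp
  then show ?case by (simp add: Cons.IH del: append_assoc) simp
qed simp

lemma alternating_swap_blocks:
  assumes "alternating k f"
  shows "f (us @ vs @ ws @ zs) = (-1) ^ (length vs * length ws) * f (us @ ws @ vs @ zs)"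
proof (induction vs arbitrary: us)
  case (Cons v vs)
  have "f (us @ (v # vs) @ ws @ zs) = (-1) ^ (length vs * length ws) * f (us @ v # ws @ vs @ zs)"
    using Cons.IH[of "us @ [v]"] by simp
  also have "\<dots> = (-1) ^ (length vs * length ws) * ((-1) ^ length ws * f (us @ ws @ v # vs @ zs))"
    by (simp only: alternating_move[OF assms])
  finally show ?case by (simp add: power_add)
qed simp

lemmas alternating_swap_front = alternating_swap_blocks[where us = "[]", simplified]

lemma alternating_sum:
  assumes "\<And>i. i \<in> I \<Longrightarrow> alternating k (f i)"
  shows "alternating k (\<lambda>vs. \<Sum>i\<in>I. c i * f i vs)"
proof (rule alternatingI)
  show "(\<Sum>i\<in>I. c i * f i (us @ (a *\<^sub>R v + b *\<^sub>R w) # ws)) =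
      a * (\<Sum>i\<in>I. c i * f i (us @ v # ws)) + b * (\<Sum>i\<in>I. c i * f i (us @ w # ws))" for us v w a b ws
    unfolding sum_distrib_left sum.distrib[symmetric]
    by (rule sum.cong) (simp_all add: alternating_lincomb[OF assms] algebra_simps)
qed (simp_all add: alternating_length[OF assms] alternating_repeat[OF assms])

lemma alternating_prepend:
  assumes "alternating k f"
  shows "alternating (k - int (length us)) (\<lambda>vs. f (us @ vs))"
proof (rule alternatingI)
  show "f (us @ us' @ (a *\<^sub>R v + b *\<^sub>R w) # ws) = a * f (us @ us' @ v # ws) + b * f (us @ us' @ w # ws)"
    for us' v w a b ws
    using alternating_lincomb[OF assms, of "us @ us'"] by simp
  show "f (us @ us' @ v # ws @ v # zs) = 0" for us' v ws zs
    using alternating_repeat[OF assms, of "us @ us'"] by simp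
qed (rule alternating_length[OF assms], simp)

lemma alternating_append:
  assumes "alternating k f"
  shows "alternating (k - int (length vs)) (\<lambda>us. f (us @ vs))"
proof (rule alternatingI)
  show "f ((us @ (a *\<^sub>R v + b *\<^sub>R w) # ws) @ vs) = a * f ((us @ v # ws) @ vs) + b * f ((us @ w # ws) @ vs)"
    for us v w a b ws
    using alternating_lincomb[OF assms, of us a v b w "ws @ vs"] by simp
  show "f ((us @ v # ws @ v # zs) @ vs) = 0" for us v ws zs
    using alternating_repeat[OF assms, of us v ws "zs @ vs"] by simp
qed (rule alternating_length[OF assms], simp)

lemma alternating_map_linear:
  assumes "alternating k f" "linear L"
  shows "alternating k (\<lambda>es. f (map L es))"
  by (rule alternatingI)
    (simp_all add: alternating_length[OF assms(1)] alternating_lincomb[OF assms(1)]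
      alternating_repeat[OF assms(1)] linear_add[OF assms(2)] linear_scale[OF assms(2)])

lemma alternating_form_lincomb:
  assumes "alternating k f" "alternating k g"
  shows "alternating k (\<lambda>es. a * f es + b * g es)"
  by (rule alternatingI)
    (simp_all add: assms[THEN alternating_length] assms[THEN alternating_lincomb]
      assms[THEN alternating_repeat] algebra_simps)

lemma alternating_zero: "alternating k (\<lambda>es. 0)"
  by (rule alternatingI) auto

section \<open>Alternating sums over the entries of a list\<close>

text \<open>
  The combinatorial pattern of the exterior derivative: \<open>G\<close> receives the entry that is removed and the
  list of the remaining ones.
\<close>

definition antisum :: "('v \<Rightarrow> 'v list \<Rightarrow> real) \<Rightarrow> 'v list \<Rightarrow> real" where
  "antisum G vs = (\<Sum>i<length vs. (-1) ^ i * G (vs ! i) (take i vs @ drop (Suc i) vs))"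

lemma antisum_Nil [simp]: "antisum G [] = 0"
  by (simp add: antisum_def)

text \<open>
  This recursion changes \<open>G\<close>. It reduces identities between alternating sums to inductions over the
  list with arbitrary \<open>G\<close>, without any manipulation of indices and signs.
\<close>

lemma antisum_Cons: "antisum G (v # vs) = G v vs - antisum (\<lambda>w us. G w (v # us)) vs"
  by (simp add: antisum_def sum.lessThan_Suc_shift sum_negf del: sum.lessThan_Suc)

text \<open>
  After a contraction, the arguments of a form are the contracted vectors followed by the remaining
  ones; the two summands are the derivatives along the former and along the latter.
\<close>

lemma antisum_append:
  "antisum G (us @ vs) = antisum (\<lambda>v ws. G v (ws @ vs)) us +
     (-1) ^ length us * antisum (\<lambda>v ws. G v (us @ ws)) vs"
  by (induction us arbitrary: G) (simp_all add: antisum_Cons algebra_simps)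

lemma antisum_map: "antisum G (map f vs) = antisum (\<lambda>v us. G (f v) (map f us)) vs"
  by (induction vs arbitrary: G) (simp_all add: antisum_Cons)

lemma antisum_cong:
  assumes "\<And>v us. v \<in> set vs \<Longrightarrow> set us \<subseteq> set vs \<Longrightarrow> Suc (length us) = length vs \<Longrightarrow> G v us = H v us"
  shows "antisum G vs = antisum H vs"
  unfolding antisum_def
proof (rule sum.cong)
  fix i assume "i \<in> {..<length vs}"
  then have "G (vs ! i) (take i vs @ drop (Suc i) vs) = H (vs ! i) (take i vs @ drop (Suc i) vs)"
    by (intro assms) (auto dest: in_set_takeD in_set_dropD)
  then show "(-1) ^ i * G (vs ! i) (take i vs @ drop (Suc i) vs) =
      (-1) ^ i * H (vs ! i) (take i vs @ drop (Suc i) vs)" by simp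
qed simp

lemma antisum_add: "antisum (\<lambda>v us. G v us + H v us) vs = antisum G vs + antisum H vs"
  by (simp add: antisum_def sum.distrib algebra_simps)

lemma antisum_mult: "antisum (\<lambda>v us. c * G v us) vs = c * antisum G vs"
  by (simp add: antisum_def sum_distrib_left algebra_simps)

lemma antisum_zero [simp]: "antisum (\<lambda>v us. 0) vs = 0"
  by (simp add: antisum_def)

lemma antisum_sum: "antisum (\<lambda>v us. \<Sum>i\<in>I. G i v us) vs = (\<Sum>i\<in>I. antisum (G i) vs)"
  by (induction I rule: infinite_finite_induct) (simp_all add: antisum_add)

text \<open>
  Every pair of entries is removed in both orders, with opposite signs, so symmetric terms cancel. In
  the applications \<open>H v w\<close> contains a second derivative in the directions \<open>v\<close> and \<open>w\<close>.
\<close>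

lemma antisum_antisum_symmetric:
  assumes "\<And>v w us. H v w us = H w v us"
  shows "antisum (\<lambda>v us. antisum (H v) us) vs = 0"
  using assms
proof (induction vs arbitrary: H)
  case (Cons x vs)
  have "antisum (\<lambda>v us. antisum (H v) us) (x # vs) =
      antisum (H x) vs - antisum (\<lambda>v us. H v x us + (-1) * antisum (\<lambda>w zs. H v w (x # zs)) us) vs"
    by (simp add: antisum_Cons)
  also have "\<dots> = antisum (H x) vs - antisum (\<lambda>v. H v x) vs + antisum (\<lambda>v us. antisum (\<lambda>w zs. H v w (x # zs)) us) vs"
    by (simp only: antisum_add antisum_mult)
  also have "(\<lambda>v. H v x) = H x"
    using Cons.prems by blast
  also have "antisum (\<lambda>v us. antisum (\<lambda>w zs. H v w (x # zs)) us) vs = 0"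
    using Cons.IH[of "\<lambda>v w zs. H v w (x # zs)"] Cons.prems by blast
  finally show ?case by simp
qed simp

text \<open>
  If the entry \<open>v\<close> is repeated, only the two terms survive in which one of its copies is removed. They
  differ by moving the other copy past the entries in between, and thereby cancel.
\<close>

lemma alternating_antisum:
  fixes G :: "'e::real_vector \<Rightarrow> 'e list \<Rightarrow> real"
  assumes G: "\<And>v. alternating k (G v)" and lin: "\<And>us. linear (\<lambda>v. G v us)"
  shows "alternating (k + 1) (antisum G)"
proof (rule alternatingI)
  show "antisum G vs = 0" if "int (length vs) \<noteq> k + 1" for vs
  proof -
    have "antisum G vs = antisum (\<lambda>v us. 0) vs"
      by (rule antisum_cong) (use that alternating_length[OF G] in auto)
    then show ?thesis by simp
  qed
  show "antisum G (us @ (a *\<^sub>R v + b *\<^sub>R w) # ws) = a * antisum G (us @ v # ws) + b * antisum G (us @ w # ws)"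
    for us v w a b ws
  proof -
    have "antisum (\<lambda>x zs. G x (zs @ (a *\<^sub>R v + b *\<^sub>R w) # ws)) us =
        a * antisum (\<lambda>x zs. G x (zs @ v # ws)) us + b * antisum (\<lambda>x zs. G x (zs @ w # ws)) us"
      by (simp add: alternating_lincomb[OF G] antisum_add antisum_mult)
    moreover have "antisum (\<lambda>x zs. G x (us @ (a *\<^sub>R v + b *\<^sub>R w) # zs)) ws =
        a * antisum (\<lambda>x zs. G x (us @ v # zs)) ws + b * antisum (\<lambda>x zs. G x (us @ w # zs)) ws"
      by (simp add: alternating_lincomb[OF G] antisum_add antisum_mult)
    moreover have "G (a *\<^sub>R v + b *\<^sub>R w) (us @ ws) = a * G v (us @ ws) + b * G w (us @ ws)"
      using linear_add[OF lin] linear_scale[OF lin] by simp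
    ultimately show ?thesis
      by (simp add: antisum_append antisum_Cons algebra_simps)
  qed
  show "antisum G (us @ v # ws @ v # zs) = 0" for us v ws zs
  proof -
    have "antisum (\<lambda>x xs. G x (xs @ v # ws @ v # zs)) us = 0"
      by (simp add: alternating_repeat[OF G])
    moreover have "antisum (\<lambda>x xs. G x (us @ v # xs @ v # zs)) ws = 0"
      by (simp add: alternating_repeat[OF G])
    moreover have "antisum (\<lambda>x xs. G x (us @ v # ws @ v # xs)) zs = 0"
      by (simp add: alternating_repeat[OF G])
    moreover have "G v (us @ v # ws @ zs) = (-1) ^ length ws * G v (us @ ws @ v # zs)"
      by (rule alternating_move[OF G])
    ultimately show ?thesis
      by (simp add: antisum_append antisum_Cons power_mult_distrib[symmetric] algebra_simps)
  qed
qed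

lemma antisum_has_derivative:
  assumes "\<And>v us. ((\<lambda>y. K y v us) has_derivative K' v us) F"
  shows "((\<lambda>y. antisum (K y) vs) has_derivative (\<lambda>h. antisum (\<lambda>v us. K' v us h) vs)) F"
  unfolding antisum_def by (intro has_derivative_sum has_derivative_mult_right assms)

lemma smooth_on_antisum:
  assumes "open S" "\<And>v us. smooth_on S (\<lambda>y. K y v us)"
  shows "smooth_on S (\<lambda>y. antisum (K y) vs)"
  unfolding antisum_def by (intro smooth_on_sum smooth_on_mult smooth_on_const assms)

section \<open>Calculus of forms on open sets of a Euclidean space\<close>

definition local_form :: "'e::euclidean_space set \<Rightarrow> int \<Rightarrow> ('e \<Rightarrow> 'e list \<Rightarrow> real) \<Rightarrow> bool" where
  "local_form S k F \<longleftrightarrow> (\<forall>y\<in>S. alternating k (F y)) \<and> (\<forall>es. smooth_on S (\<lambda>y. F y es))"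

abbreviation basis_lists :: "nat \<Rightarrow> 'e::euclidean_space list set" where
  "basis_lists p \<equiv> {es. length es = p \<and> set es \<subseteq> Basis}"

text \<open>
  The exterior derivative in coordinates. The arguments are vector fields with constant coefficients;
  these commute, so there are no bracket terms.
\<close>

definition ext_d :: "('e::euclidean_space \<Rightarrow> 'e list \<Rightarrow> real) \<Rightarrow> 'e \<Rightarrow> 'e list \<Rightarrow> real" where
  "ext_d F y = antisum (\<lambda>v us. frechet_derivative (\<lambda>y. F y us) (at y) v)"

text \<open>Contraction with the multivector field \<open>\<Sum> f\<^sub>I \<partial>\<^sub>I\<close>.\<close>

definition contr ::
  "nat \<Rightarrow> ('e::euclidean_space list \<Rightarrow> 'e \<Rightarrow> real) \<Rightarrow> ('e \<Rightarrow> 'e list \<Rightarrow> real) \<Rightarrow> 'e \<Rightarrow> 'e list \<Rightarrow> real"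
  where "contr p f F y vs = (\<Sum>I\<in>basis_lists p. f I y * F y (I @ vs))"

definition lie ::
  "nat \<Rightarrow> ('e::euclidean_space list \<Rightarrow> 'e \<Rightarrow> real) \<Rightarrow> ('e \<Rightarrow> 'e list \<Rightarrow> real) \<Rightarrow> 'e \<Rightarrow> 'e list \<Rightarrow> real"
  where "lie p f F y vs = ext_d (contr p f F) y vs - (-1) ^ p * contr p f (ext_d F) y vs"

text \<open>
  The coefficients of the Schouten bracket of \<open>\<Sum> f\<^sub>I \<partial>\<^sub>I\<close> and \<open>\<Sum> g\<^sub>J \<partial>\<^sub>J\<close>: either an entry of \<open>I\<close> is
  used up for differentiating \<open>g\<^sub>J\<close>, or an entry of \<open>J\<close> for differentiating \<open>f\<^sub>I\<close>. The index lists
  \<open>es\<close> are not sorted, which avoids any normalization of the concatenated lists.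
\<close>

definition bracket_coeff ::
  "nat \<Rightarrow> nat \<Rightarrow> ('e::euclidean_space list \<Rightarrow> 'e \<Rightarrow> real) \<Rightarrow> ('e list \<Rightarrow> 'e \<Rightarrow> real) \<Rightarrow> 'e list \<Rightarrow> 'e \<Rightarrow> real"
  where "bracket_coeff p q f g es y = (\<Sum>I\<in>basis_lists p. \<Sum>J\<in>basis_lists q.
     antisum (\<lambda>v us. if J @ us = es
       then - ((-1) ^ ((p - 1) * q + p) * (f I y * frechet_derivative (g J) (at y) v)) else 0) I +
     antisum (\<lambda>v us. if I @ us = es then - (g J y * frechet_derivative (f I) (at y) v) else 0) J)"

lemma finite_basis_lists: "finite (basis_lists p :: 'e::euclidean_space list set)"
proof -
  have "basis_lists p = {es :: 'e list. set es \<subseteq> Basis \<and> length es = p}" by auto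
  then show ?thesis using finite_lists_length_eq[OF finite_Basis] by simp
qed

lemma local_form_alternating: "local_form S k F \<Longrightarrow> y \<in> S \<Longrightarrow> alternating k (F y)"
  by (simp add: local_form_def)

lemma local_form_smooth: "local_form S k F \<Longrightarrow> smooth_on S (\<lambda>y. F y es)"
  by (simp add: local_form_def)

lemma local_form_has_derivative:
  "local_form S k F \<Longrightarrow> y \<in> S \<Longrightarrow>
    ((\<lambda>y. F y es) has_derivative frechet_derivative (\<lambda>y. F y es) (at y)) (at y)"
  by (rule has_derivative_frechet[OF smooth_on_differentiable[OF local_form_smooth]])

lemma frechet_sum_mult:
  fixes f g :: "'i \<Rightarrow> 'e::real_normed_vector \<Rightarrow> real"
  assumes "\<And>i. i \<in> I \<Longrightarrow> f i differentiable (at y)" "\<And>i. i \<in> I \<Longrightarrow> g i differentiable (at y)"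
  shows "frechet_derivative (\<lambda>y. \<Sum>i\<in>I. f i y * g i y) (at y) v =
    (\<Sum>i\<in>I. frechet_derivative (f i) (at y) v * g i y + f i y * frechet_derivative (g i) (at y) v)"
proof -
  have "((\<lambda>y. \<Sum>i\<in>I. f i y * g i y) has_derivative
      (\<lambda>v. \<Sum>i\<in>I. f i y * frechet_derivative (g i) (at y) v + frechet_derivative (f i) (at y) v * g i y)) (at y)"
    by (intro has_derivative_sum has_derivative_mult has_derivative_frechet assms)
  from frechet_derivativeI[OF this] show ?thesis by (simp add: add.commute)
qed

text \<open>The relations between the values of \<open>F\<close> hold on an open set and can therefore be differentiated.\<close>

lemma alternating_frechet:
  assumes "open S" "local_form S k F" "y \<in> S"
  shows "alternating k (\<lambda>us. frechet_derivative (\<lambda>y. F y us) (at y) v)"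
proof (rule alternatingI)
  note alt = local_form_alternating[OF assms(2)]
  have zero: "frechet_derivative (\<lambda>y. F y us) (at y) v = 0" if "\<And>z. z \<in> S \<Longrightarrow> F z us = 0" for us
    using frechet_derivative_cong_open[OF assms(1,3), of "\<lambda>y. F y us" "\<lambda>y. 0"] that by simp
  show "frechet_derivative (\<lambda>y. F y us) (at y) v = 0" if "int (length us) \<noteq> k" for us
    by (rule zero) (rule alternating_length[OF alt that])
  show "frechet_derivative (\<lambda>y. F y (us @ w # ws @ w # zs)) (at y) v = 0" for us w ws zs
    by (rule zero) (rule alternating_repeat[OF alt])
  show "frechet_derivative (\<lambda>y. F y (us @ (a *\<^sub>R u + b *\<^sub>R w) # ws)) (at y) v =
    a * frechet_derivative (\<lambda>y. F y (us @ u # ws)) (at y) v + b * frechet_derivative (\<lambda>y. F y (us @ w # ws)) (at y) v"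
    for us u w a b ws
  proof -
    have "frechet_derivative (\<lambda>y. F y (us @ (a *\<^sub>R u + b *\<^sub>R w) # ws)) (at y) =
        frechet_derivative (\<lambda>y. a * F y (us @ u # ws) + b * F y (us @ w # ws)) (at y)"
      by (rule frechet_derivative_cong_open[OF assms(1,3)]) (rule alternating_lincomb[OF alt])
    also have "\<dots> = (\<lambda>v. a * frechet_derivative (\<lambda>y. F y (us @ u # ws)) (at y) v +
        b * frechet_derivative (\<lambda>y. F y (us @ w # ws)) (at y) v)"
      by (intro frechet_derivativeI has_derivative_add has_derivative_mult_right
          local_form_has_derivative[OF assms(2,3)])
    finally show ?thesis by simp
  qed
qed

lemma local_form_ext_d:
  assumes "open S" "local_form S k F"
  shows "local_form S (k + 1) (ext_d F)"
  unfolding local_form_def ext_d_def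
proof (intro conjI ballI allI)
  show "alternating (k + 1) (antisum (\<lambda>v us. frechet_derivative (\<lambda>y. F y us) (at y) v))" if "y \<in> S" for y
    by (intro alternating_antisum alternating_frechet[OF assms that] linear_frechet_derivative
        smooth_on_differentiable[OF local_form_smooth[OF assms(2)] that])
  show "smooth_on S (\<lambda>y. antisum (\<lambda>v us. frechet_derivative (\<lambda>y. F y us) (at y) v) es)" for es
    by (intro smooth_on_antisum smooth_on_frechet local_form_smooth[OF assms(2)] assms(1))
qed

lemma ext_d_ext_d:
  assumes "open S" "local_form S k F" "y \<in> S"
  shows "ext_d (ext_d F) y vs = 0"
proof -
  let ?K = "\<lambda>y v us. frechet_derivative (\<lambda>y. F y us) (at y) v"
  have "((\<lambda>y. antisum (?K y) us) has_derivative
      (\<lambda>h. antisum (\<lambda>v us. frechet_derivative (\<lambda>y. ?K y v us) (at y) h) us)) (at y)" for us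
    by (intro antisum_has_derivative has_derivative_frechet smooth_on_differentiable[OF _ assms(3)]
        smooth_on_frechet local_form_smooth[OF assms(2)])
  from frechet_derivativeI[OF this]
  have "ext_d (ext_d F) y vs =
      antisum (\<lambda>h us. antisum (\<lambda>v us. frechet_derivative (\<lambda>y. ?K y v us) (at y) h) us) vs"
    by (simp add: ext_d_def)
  also have "\<dots> = 0"
    by (rule antisum_antisum_symmetric)
      (rule frechet_derivative_commute_real[OF assms(1,3) local_form_smooth[OF assms(2)]])
  finally show ?thesis .
qed

lemma local_form_contr:
  assumes "open S" "local_form S k F" "\<And>es. smooth_on S (f es)"
  shows "local_form S (k - int p) (contr p f F)"
  unfolding local_form_def
proof (intro conjI ballI allI)
  fix y assume "y \<in> S"
  then have "alternating (k - int p) (\<lambda>vs. F y (I @ vs))" if "I \<in> basis_lists p" for I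
    using that alternating_prepend[OF local_form_alternating[OF assms(2)], of y I] by simp
  then show "alternating (k - int p) (contr p f F y)"
    unfolding contr_def by (rule alternating_sum)
next
  show "smooth_on S (\<lambda>y. contr p f F y es)" for es
    unfolding contr_def
    by (intro smooth_on_sum smooth_on_mult assms local_form_smooth[OF assms(2)])
qed

lemma frechet_contr:
  assumes "local_form S k F" "\<And>es. smooth_on S (f es)" "y \<in> S"
  shows "frechet_derivative (\<lambda>y. contr p f F y us) (at y) v = (\<Sum>I\<in>basis_lists p.
    frechet_derivative (f I) (at y) v * F y (I @ us) + f I y * frechet_derivative (\<lambda>y. F y (I @ us)) (at y) v)"
  unfolding contr_def
  by (rule frechet_sum_mult)
    (use smooth_on_differentiable[OF assms(2,3)]
      smooth_on_differentiable[OF local_form_smooth[OF assms(1)] assms(3)] in auto)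

text \<open>
  Cartan's formula in coordinates: the derivatives of \<open>F\<close> in the directions of the remaining arguments
  cancel between \<open>d \<iota>\<close> and \<open>\<iota> d\<close>. What remains are derivatives of \<open>f\<close> and derivatives of \<open>F\<close> along the
  vectors of \<open>I\<close>.
\<close>

lemma lie_eq:
  assumes "local_form S k F" "\<And>es. smooth_on S (f es)" "y \<in> S"
  shows "lie p f F y vs =
    (\<Sum>I\<in>basis_lists p. antisum (\<lambda>v us. frechet_derivative (f I) (at y) v * F y (I @ us)) vs) -
    (-1) ^ p * (\<Sum>I\<in>basis_lists p. f I y * antisum (\<lambda>v us. frechet_derivative (\<lambda>y. F y (us @ vs)) (at y) v) I)"
proof -
  let ?A = "\<lambda>I. antisum (\<lambda>v us. frechet_derivative (\<lambda>y. F y (us @ vs)) (at y) v) I"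
  let ?B = "\<lambda>I. antisum (\<lambda>v us. frechet_derivative (\<lambda>y. F y (I @ us)) (at y) v) vs"
  have d: "ext_d (contr p f F) y vs =
      (\<Sum>I\<in>basis_lists p. antisum (\<lambda>v us. frechet_derivative (f I) (at y) v * F y (I @ us)) vs) +
      (\<Sum>I\<in>basis_lists p. f I y * ?B I)"
    by (simp add: ext_d_def frechet_contr[OF assms] antisum_sum antisum_add antisum_mult sum.distrib)
  have "contr p f (ext_d F) y vs = (\<Sum>I\<in>basis_lists p. f I y * (?A I + (-1) ^ p * ?B I))"
    unfolding contr_def ext_d_def by (rule sum.cong) (simp_all add: antisum_append)
  also have "\<dots> = (\<Sum>I\<in>basis_lists p. f I y * ?A I) + (-1) ^ p * (\<Sum>I\<in>basis_lists p. f I y * ?B I)"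
    by (simp add: sum.distrib sum_distrib_left algebra_simps)
  finally show ?thesis
    unfolding lie_def d by (simp add: algebra_simps power_mult_distrib[symmetric])
qed

lemma smooth_bracket_coeff:
  assumes "open S" "\<And>es. smooth_on S (f es)" "\<And>es. smooth_on S (g es)"
  shows "smooth_on S (bracket_coeff p q f g es)"
proof -
  have neg: "smooth_on S (\<lambda>y. - h y)" if "smooth_on S h" for h :: "'a \<Rightarrow> real"
    using smooth_on_linear[OF assms(1) bounded_linear_minus[OF bounded_linear_ident] that] .
  have if_smooth: "smooth_on S (\<lambda>y. if b then h y else 0)" if "smooth_on S h" for b and h :: "'a \<Rightarrow> real"
    using that by (cases b) (simp_all add: smooth_on_const)
  show ?thesis
    unfolding bracket_coeff_def[abs_def]
    by (intro if_smooth smooth_on_sum smooth_on_add smooth_on_antisum assms neg smooth_on_mult smooth_on_const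
        smooth_on_frechet)
qed

lemma sum_basis_lists_delta:
  fixes e :: "'e::euclidean_space list"
  assumes "e \<in> basis_lists m"
  shows "(\<Sum>es\<in>basis_lists m. (if e = es then c else 0) * h es) = c * (h e :: real)"
proof -
  have "(\<Sum>es\<in>basis_lists m. (if e = es then c else 0) * h es) =
      (\<Sum>es\<in>basis_lists m. if e = es then c * h es else 0)"
    by (rule sum.cong) auto
  then show ?thesis
    using assms by (simp only: sum.delta'[OF finite_basis_lists] if_True)
qed

text \<open>
  The sum over all index lists \<open>es\<close> picks, for every term of the alternating sum, the only list that
  the term contributes to.
\<close>

lemma sum_antisum_coeff:
  fixes J K :: "'e::euclidean_space list"
  assumes "K \<in> basis_lists k" "J \<in> basis_lists j" "m + 1 = j + k"
  shows "(\<Sum>es\<in>basis_lists m. antisum (\<lambda>v us. if J @ us = es then c v else 0) K * h es) =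
    antisum (\<lambda>v us. c v * h (J @ us)) K"
proof -
  have "(\<Sum>es\<in>basis_lists m. antisum (\<lambda>v us. if J @ us = es then c v else 0) K * h es) =
      antisum (\<lambda>v us. \<Sum>es\<in>basis_lists m. (if J @ us = es then c v else 0) * h es) K"
    unfolding antisum_sum
    by (rule sum.cong) (simp_all add: mult.commute[of _ "h _"] antisum_mult)
  also have "\<dots> = antisum (\<lambda>v us. c v * h (J @ us)) K"
  proof (rule antisum_cong)
    fix v us assume "set us \<subseteq> set K" "Suc (length us) = length K"
    then have "J @ us \<in> basis_lists m" using assms by auto
    then show "(\<Sum>es\<in>basis_lists m. (if J @ us = es then c v else 0) * h es) = c v * h (J @ us)"
      by (rule sum_basis_lists_delta)
  qed
  finally show ?thesis .
qed

lemma antisum_minus: "antisum (\<lambda>v us. - G v us) vs = - antisum G vs"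
  using antisum_mult[of "-1" G vs] by simp

lemma contr_bracket_coeff:
  assumes "1 \<le> p"
  shows "contr (p + q - 1) (bracket_coeff p q f g) F y vs =
    (\<Sum>I\<in>basis_lists p. \<Sum>J\<in>basis_lists q.
      - ((-1) ^ ((p - 1) * q + p) * (f I y * antisum (\<lambda>v us. frechet_derivative (g J) (at y) v * F y (J @ us @ vs)) I)) -
      g J y * antisum (\<lambda>v us. frechet_derivative (f I) (at y) v * F y (I @ us @ vs)) J)"
proof -
  let ?m = "p + q - 1"
  let ?a = "\<lambda>I J es. antisum (\<lambda>v us. if J @ us = es
       then - ((-1) ^ ((p - 1) * q + p) * (f I y * frechet_derivative (g J) (at y) v)) else 0) I"
  let ?b = "\<lambda>I J es. antisum (\<lambda>v us. if I @ us = es then - (g J y * frechet_derivative (f I) (at y) v) else 0) J"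
  have "contr ?m (bracket_coeff p q f g) F y vs =
      (\<Sum>es\<in>basis_lists ?m. \<Sum>I\<in>basis_lists p. \<Sum>J\<in>basis_lists q. ?a I J es * F y (es @ vs) + ?b I J es * F y (es @ vs))"
    by (simp add: contr_def bracket_coeff_def sum_distrib_right distrib_right)
  also have "\<dots> = (\<Sum>I\<in>basis_lists p. \<Sum>J\<in>basis_lists q. \<Sum>es\<in>basis_lists ?m.
      ?a I J es * F y (es @ vs) + ?b I J es * F y (es @ vs))"
    by (subst sum.swap, rule sum.cong[OF refl], subst sum.swap, rule refl)
  also have "\<dots> = (\<Sum>I\<in>basis_lists p. \<Sum>J\<in>basis_lists q.
      antisum (\<lambda>v us. - ((-1) ^ ((p - 1) * q + p) * (f I y * frechet_derivative (g J) (at y) v)) * F y ((J @ us) @ vs)) I +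
      antisum (\<lambda>v us. - (g J y * frechet_derivative (f I) (at y) v) * F y ((I @ us) @ vs)) J)"
  proof (intro sum.cong refl)
    fix I J :: "'a list" assume I: "I \<in> basis_lists p" and J: "J \<in> basis_lists q"
    show "(\<Sum>es\<in>basis_lists ?m. ?a I J es * F y (es @ vs) + ?b I J es * F y (es @ vs)) =
      antisum (\<lambda>v us. - ((-1) ^ ((p - 1) * q + p) * (f I y * frechet_derivative (g J) (at y) v)) * F y ((J @ us) @ vs)) I +
      antisum (\<lambda>v us. - (g J y * frechet_derivative (f I) (at y) v) * F y ((I @ us) @ vs)) J"
      unfolding sum.distrib
      by (subst sum_antisum_coeff[OF I J], use assms in simp, subst sum_antisum_coeff[OF J I], use assms in simp)
        (rule refl)
  qed
  also have "\<dots> = (\<Sum>I\<in>basis_lists p. \<Sum>J\<in>basis_lists q.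
      - ((-1) ^ ((p - 1) * q + p) * (f I y * antisum (\<lambda>v us. frechet_derivative (g J) (at y) v * F y (J @ us @ vs)) I)) -
      g J y * antisum (\<lambda>v us. frechet_derivative (f I) (at y) v * F y (I @ us @ vs)) J)"
    by (simp only: minus_mult_left[symmetric] antisum_minus antisum_mult append_assoc
        diff_conv_add_uminus mult.assoc)
  finally show ?thesis .
qed

lemma neg_one_power_same: "(-1::real) ^ k * ((-1) ^ k * x) = x"
  by (simp add: mult.assoc[symmetric] power_mult_distrib[symmetric])

text \<open>
  The operator that the Schouten bracket has to represent is of order zero in \<open>F\<close>. By \<open>lie_eq\<close> two kinds
  of terms have to cancel: those with a derivative of \<open>F\<close> along an entry of \<open>I\<close>, and those with a
  derivative of \<open>f\<close> along one of the remaining arguments. In both cases the terms differ by exchanging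
  the block \<open>J\<close> with what is left of \<open>I\<close>, a block of length \<open>p - 1\<close> or \<open>p\<close> respectively. The sign
  \<open>(-1)\<^bsup>(p-1)q\<^esup>\<close> of the normalization compensates for this; in the second case the derivative also
  passes the block \<open>J\<close>, at the cost of \<open>(-1)\<^bsup>q\<^esup>\<close>.
\<close>

lemma local_bracket:
  assumes S: "open S" "y \<in> S" and F: "local_form S k F"
    and f: "\<And>es. smooth_on S (f es)" and g: "\<And>es. smooth_on S (g es)" and p: "1 \<le> p"
  shows "(-1) ^ ((p - 1) * q) * lie p f (contr q g F) y vs - contr q g (lie p f F) y vs =
    contr (p + q - 1) (bracket_coeff p q f g) F y vs"
proof -
  let ?D = "\<lambda>h v. frechet_derivative h (at y) v"
  let ?\<epsilon> = "(-1) ^ ((p - 1) * q) :: real"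
  let ?Z = "\<lambda>I J. antisum (\<lambda>v us. ?D (f I) v * F y (J @ I @ us)) vs"
  let ?X2 = "\<lambda>I J. antisum (\<lambda>v us. ?D (g J) v * F y (J @ us @ vs)) I"
  let ?X3 = "\<lambda>I J. antisum (\<lambda>v us. ?D (\<lambda>y. F y (J @ us @ vs)) v) I"
  let ?Y1 = "\<lambda>I J. antisum (\<lambda>v us. ?D (f I) v * F y (I @ us @ vs)) J"
  let ?Y2 = "\<lambda>I J. antisum (\<lambda>v us. ?D (f I) v * F y (I @ J @ us)) vs"
  let ?Y3 = "\<lambda>I J. antisum (\<lambda>v us. ?D (\<lambda>y. F y (us @ J @ vs)) v) I"
  have alt: "alternating k (F y)" "alternating k (\<lambda>us. ?D (\<lambda>y. F y us) v)" for v
    using local_form_alternating[OF F] alternating_frechet[OF S(1) F] S(2) by auto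
  have 1: "lie p f (contr q g F) y vs = (\<Sum>I\<in>basis_lists p. \<Sum>J\<in>basis_lists q.
      g J y * ?Z I J - (-1) ^ p * (f I y * (?X2 I J + g J y * ?X3 I J)))"
  proof -
    have "antisum (\<lambda>v us. ?D (f I) v * contr q g F y (I @ us)) vs = (\<Sum>J\<in>basis_lists q. g J y * ?Z I J)" for I
      by (simp add: contr_def sum_distrib_left antisum_sum mult.left_commute[of "?D _ _"] antisum_mult)
    moreover have "antisum (\<lambda>v us. ?D (\<lambda>y. contr q g F y (us @ vs)) v) I =
        (\<Sum>J\<in>basis_lists q. ?X2 I J + g J y * ?X3 I J)" for I
      by (simp add: frechet_contr[OF F g S(2)] antisum_sum antisum_add antisum_mult)
    ultimately show ?thesis
      unfolding lie_eq[OF local_form_contr[OF S(1) F g] f S(2)]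
      by (simp add: sum_distrib_left sum_subtractf)
  qed
  have 2: "contr q g (lie p f F) y vs = (\<Sum>I\<in>basis_lists p. \<Sum>J\<in>basis_lists q.
      g J y * (?Y1 I J + (-1) ^ q * ?Y2 I J) - (-1) ^ p * (f I y * (g J y * ?Y3 I J)))"
  proof -
    have "contr q g (lie p f F) y vs = (\<Sum>J\<in>basis_lists q. \<Sum>I\<in>basis_lists p.
      g J y * (?Y1 I J + (-1) ^ q * ?Y2 I J) - (-1) ^ p * (f I y * (g J y * ?Y3 I J)))"
      unfolding contr_def
    proof (intro sum.cong refl)
      fix J :: "'a list" assume "J \<in> basis_lists q"
      then show "g J y * lie p f F y (J @ vs) = (\<Sum>I\<in>basis_lists p.
          g J y * (?Y1 I J + (-1) ^ q * ?Y2 I J) - (-1) ^ p * (f I y * (g J y * ?Y3 I J)))"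
        unfolding lie_eq[OF F f S(2)]
        by (simp add: antisum_append sum_distrib_left sum_subtractf right_diff_distrib mult.left_commute[of "g J y"])
    qed
    then show ?thesis by (subst sum.swap)
  qed
  have 3: "?\<epsilon> * ?Z I J = (-1) ^ q * ?Y2 I J" if "I \<in> basis_lists p" "J \<in> basis_lists q" for I J
  proof -
    have "F y (J @ I @ us) = (-1) ^ (p * q) * F y (I @ J @ us)" for us
      using alternating_swap_front[OF alt(1), of J I us] that by (simp add: mult.commute)
    then have "?Z I J = (-1) ^ (p * q) * ?Y2 I J"
      by (simp add: mult.left_commute[of "?D _ _"] antisum_mult)
    moreover have "?\<epsilon> * (-1) ^ (p * q) = (-1) ^ q"
    proof -
      have "p * q = (p - 1) * q + q" using p by (cases p) auto
      then show ?thesis by (simp add: power_add neg_one_power_same)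
    qed
    ultimately show ?thesis by (simp add: mult.assoc[symmetric])
  qed
  have 4: "?\<epsilon> * ?X3 I J = ?Y3 I J" if "I \<in> basis_lists p" "J \<in> basis_lists q" for I J
    unfolding antisum_mult[symmetric]
  proof (rule antisum_cong)
    fix v and us :: "'a list" assume "Suc (length us) = length I"
    then have "?D (\<lambda>y. F y (J @ us @ vs)) v = ?\<epsilon> * ?D (\<lambda>y. F y (us @ J @ vs)) v"
      using alternating_swap_front[OF alt(2), of J us vs v] that by (auto simp: mult.commute)
    then show "?\<epsilon> * ?D (\<lambda>y. F y (J @ us @ vs)) v = ?D (\<lambda>y. F y (us @ J @ vs)) v"
      by (simp add: neg_one_power_same)
  qed
  have "?\<epsilon> * lie p f (contr q g F) y vs - contr q g (lie p f F) y vs =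
    (\<Sum>I\<in>basis_lists p. \<Sum>J\<in>basis_lists q.
      g J y * (?\<epsilon> * ?Z I J) - (-1) ^ p * (?\<epsilon> * (f I y * ?X2 I J) + f I y * (g J y * (?\<epsilon> * ?X3 I J))) -
      (g J y * (?Y1 I J + (-1) ^ q * ?Y2 I J) - (-1) ^ p * (f I y * (g J y * ?Y3 I J))))"
    unfolding 1 2 sum_distrib_left sum_subtractf[symmetric]
    by (intro sum.cong refl) (simp add: algebra_simps)
  also have "\<dots> = contr (p + q - 1) (bracket_coeff p q f g) F y vs"
    unfolding contr_bracket_coeff[OF p]
  proof (intro sum.cong refl)
    fix I J :: "'a list" assume IJ: "I \<in> basis_lists p" "J \<in> basis_lists q"
    show "g J y * (?\<epsilon> * ?Z I J) - (-1) ^ p * (?\<epsilon> * (f I y * ?X2 I J) + f I y * (g J y * (?\<epsilon> * ?X3 I J))) -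
      (g J y * (?Y1 I J + (-1) ^ q * ?Y2 I J) - (-1) ^ p * (f I y * (g J y * ?Y3 I J))) =
      - ((-1) ^ ((p - 1) * q + p) * (f I y * ?X2 I J)) - g J y * ?Y1 I J"
      unfolding 3[OF IJ] 4[OF IJ] by (simp add: power_add algebra_simps)
  qed
  finally show ?thesis .
qed

lemma local_form_cong:
  assumes "open S" "\<And>y es. y \<in> S \<Longrightarrow> F y es = G y es" "local_form S k F"
  shows "local_form S k G"
  unfolding local_form_def
proof (intro conjI ballI allI)
  fix y assume "y \<in> S"
  then have "F y = G y" using assms(2) by auto
  then show "alternating k (G y)" using local_form_alternating[OF assms(3) \<open>y \<in> S\<close>] by simp
next
  show "smooth_on S (\<lambda>y. G y es)" for es
    by (rule smooth_on_cong[OF assms(1) _ local_form_smooth[OF assms(3)]]) (rule assms(2))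
qed

lemma local_form_lincomb:
  assumes "open S" "local_form S k F" "local_form S k G"
  shows "local_form S k (\<lambda>y es. a * F y es + b * G y es)"
  unfolding local_form_def
proof (intro conjI ballI allI)
  show "alternating k (\<lambda>es. a * F y es + b * G y es)" if "y \<in> S" for y
    by (intro alternating_form_lincomb local_form_alternating[OF assms(2) that] local_form_alternating[OF assms(3) that])
  show "smooth_on S (\<lambda>y. a * F y es + b * G y es)" for es
    by (intro smooth_on_add smooth_on_mult smooth_on_const local_form_smooth[OF assms(2)]
        local_form_smooth[OF assms(3)] assms(1))
qed

lemma ext_d_cong:
  assumes "open S" "y \<in> S" "\<And>y es. y \<in> S \<Longrightarrow> F y es = G y es"
  shows "ext_d F y es = ext_d G y es"
  unfolding ext_d_def
  by (intro antisum_cong fun_cong[OF frechet_derivative_cong_open[OF assms(1,2)]] assms(3))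

lemma ext_d_lincomb:
  assumes "local_form S k F" "local_form S k G" "y \<in> S"
  shows "ext_d (\<lambda>y es. a * F y es + b * G y es) y es = a * ext_d F y es + b * ext_d G y es"
proof -
  have "frechet_derivative (\<lambda>y. a * F y us + b * G y us) (at y) =
      (\<lambda>v. a * frechet_derivative (\<lambda>y. F y us) (at y) v + b * frechet_derivative (\<lambda>y. G y us) (at y) v)" for us
    by (intro frechet_derivativeI has_derivative_add has_derivative_mult_right
        local_form_has_derivative[OF assms(1,3)] local_form_has_derivative[OF assms(2,3)])
  then show ?thesis
    by (simp add: ext_d_def antisum_add antisum_mult)
qed

lemma contr_lincomb:
  "contr p f (\<lambda>y es. a * F y es + b * G y es) y es = a * contr p f F y es + b * contr p f G y es"
  unfolding contr_def sum_distrib_left sum.distrib[symmetric]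
  by (rule sum.cong) (simp_all add: algebra_simps)

lemma contr_commute:
  assumes "alternating k (F y)"
  shows "contr q g (contr p f F) y es = (-1) ^ (p * q) * contr p f (contr q g F) y es"
proof -
  have "contr q g (contr p f F) y es = (\<Sum>J\<in>basis_lists q. \<Sum>I\<in>basis_lists p. g J y * (f I y * F y (I @ J @ es)))"
    by (simp add: contr_def sum_distrib_left)
  also have "\<dots> = (\<Sum>J\<in>basis_lists q. \<Sum>I\<in>basis_lists p. (-1) ^ (p * q) * (f I y * (g J y * F y (J @ I @ es))))"
  proof (intro sum.cong refl)
    fix I J :: "'a list" assume "J \<in> basis_lists q" "I \<in> basis_lists p"
    then have "F y (I @ J @ es) = (-1) ^ (p * q) * F y (J @ I @ es)"
      using alternating_swap_front[OF assms, of I J es] by simp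
    then show "g J y * (f I y * F y (I @ J @ es)) = (-1) ^ (p * q) * (f I y * (g J y * F y (J @ I @ es)))"
      by simp
  qed
  also have "\<dots> = (-1) ^ (p * q) * contr p f (contr q g F) y es"
    by (subst sum.swap) (simp add: contr_def sum_distrib_left)
  finally show ?thesis .
qed

text \<open>
  For the induction, the arguments \<open>B y e\<close> are expanded in the basis one after the other; the list \<open>ws\<close>
  collects the basis vectors that have been chosen already.
\<close>

lemma smooth_on_alternating_map:
  fixes G :: "'f::real_normed_vector \<Rightarrow> 'e::euclidean_space list \<Rightarrow> real"
  assumes "open S" "\<And>y. y \<in> S \<Longrightarrow> alternating k (G y)" "\<And>us. smooth_on S (\<lambda>y. G y us)"
    and B: "\<And>e. smooth_on S (\<lambda>y. B y e)"
  shows "smooth_on S (\<lambda>y. G y (ws @ map (B y) es))"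
proof (induction es arbitrary: ws)
  case (Cons e es)
  have "smooth_on S (\<lambda>y. G y (ws @ b # map (B y) es))" for b
    using Cons.IH[of "ws @ [b]"] by simp
  then have "smooth_on S (\<lambda>y. \<Sum>b\<in>Basis. (B y e \<bullet> b) * G y (ws @ b # map (B y) es))"
    by (intro smooth_on_sum smooth_on_mult smooth_on_linear[OF _ bounded_linear_inner_left] B assms(1))
  then show ?case
    by (rule smooth_on_cong[OF assms(1), rotated]) (simp add: alternating_expand[OF assms(2), symmetric])
qed (simp add: assms(3))

text \<open>
  The product rule for an alternating form with variable arguments. The differentiated argument is
  moved to the front, so that its position turns into the sign of an alternating sum. This is the
  form in which \<open>antisum_antisum_symmetric\<close> can cancel second derivatives of chart transitions.
\<close>

lemma alternating_map_has_derivative: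
  assumes S: "open S" "y0 \<in> S" and G: "local_form S k G"
    and B: "\<And>e. ((\<lambda>y. B y e) has_derivative B' e) (at y0)"
  shows "((\<lambda>y. G y (ws @ map (B y) es)) has_derivative
    (\<lambda>h. frechet_derivative (\<lambda>y. G y (ws @ map (B y0) es)) (at y0) h +
      antisum (\<lambda>w zs. (-1) ^ length ws * G y0 (B' w h # ws @ map (B y0) zs)) es)) (at y0)"
proof (induction es arbitrary: ws)
  case Nil
  show ?case using local_form_has_derivative[OF G S(2)] by simp
next
  case (Cons e es)
  let ?M = "\<lambda>es. map (B y0) es"
  let ?D = "\<lambda>us h. frechet_derivative (\<lambda>y. G y us) (at y0) h"
  note alt = local_form_alternating[OF G S(2)] alternating_frechet[OF S(1) G S(2)]
  have "((\<lambda>y. G y (ws @ b # map (B y) es)) has_derivative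
      (\<lambda>h. ?D (ws @ b # ?M es) h +
        antisum (\<lambda>w zs. (-1) ^ Suc (length ws) * G y0 ((B' w h # ws) @ b # ?M zs)) es)) (at y0)" for b
    using Cons.IH[of "ws @ [b]"] by simp
  then have "((\<lambda>y. \<Sum>b\<in>Basis. (B y e \<bullet> b) * G y (ws @ b # map (B y) es)) has_derivative
      (\<lambda>h. \<Sum>b\<in>Basis. (B y0 e \<bullet> b) * (?D (ws @ b # ?M es) h +
        antisum (\<lambda>w zs. (-1) ^ Suc (length ws) * G y0 ((B' w h # ws) @ b # ?M zs)) es) +
        (B' e h \<bullet> b) * G y0 (ws @ b # ?M es))) (at y0)"
    by (intro has_derivative_sum has_derivative_mult B
        bounded_linear.has_derivative[OF bounded_linear_inner_left])
  then have deriv: "((\<lambda>y. G y (ws @ B y e # map (B y) es)) has_derivative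
      (\<lambda>h. \<Sum>b\<in>Basis. (B y0 e \<bullet> b) * (?D (ws @ b # ?M es) h +
        antisum (\<lambda>w zs. (-1) ^ Suc (length ws) * G y0 ((B' w h # ws) @ b # ?M zs)) es) +
        (B' e h \<bullet> b) * G y0 (ws @ b # ?M es))) (at y0)"
    by (rule has_derivative_transform_within_open[OF _ S])
      (simp add: alternating_expand[OF local_form_alternating[OF G], symmetric])
  have eq: "(\<Sum>b\<in>Basis. (B y0 e \<bullet> b) * (?D (ws @ b # ?M es) h +
        antisum (\<lambda>w zs. (-1) ^ Suc (length ws) * G y0 ((B' w h # ws) @ b # ?M zs)) es) +
        (B' e h \<bullet> b) * G y0 (ws @ b # ?M es)) =
      ?D (ws @ B y0 e # ?M es) h +
      antisum (\<lambda>w zs. (-1) ^ Suc (length ws) * G y0 ((B' w h # ws) @ B y0 e # ?M zs)) es +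
      (-1) ^ length ws * G y0 (B' e h # ws @ ?M es)" for h
  proof -
    have "(\<Sum>b\<in>Basis. (B y0 e \<bullet> b) *
        antisum (\<lambda>w zs. (-1) ^ Suc (length ws) * G y0 ((B' w h # ws) @ b # ?M zs)) es) =
      antisum (\<lambda>w zs. (-1) ^ Suc (length ws) * G y0 ((B' w h # ws) @ B y0 e # ?M zs)) es"
      unfolding alternating_expand[OF alt(1), of "_ # ws" "B y0 e"] antisum_mult antisum_sum
      by (simp add: sum_distrib_left mult.left_commute)
    moreover have "(\<Sum>b\<in>Basis. (B y0 e \<bullet> b) * ?D (ws @ b # ?M es) h) = ?D (ws @ B y0 e # ?M es) h"
      by (rule alternating_expand[OF alt(2), symmetric])
    moreover have "(\<Sum>b\<in>Basis. (B' e h \<bullet> b) * G y0 (ws @ b # ?M es)) = (-1) ^ length ws * G y0 (B' e h # ws @ ?M es)"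
      using alternating_expand[OF alt(1), of ws "B' e h" "?M es", symmetric]
        alternating_move[OF alt(1), of "[]" "B' e h" ws "?M es"]
      by (simp add: neg_one_power_same)
    ultimately show ?thesis
      by (simp add: distrib_left sum.distrib del: power_Suc)
  qed
  show ?case
    using deriv unfolding eq by (simp add: antisum_Cons antisum_minus algebra_simps)
qed

text \<open>
  Naturality of the exterior derivative. By the product rule the difference of the two sides is an
  alternating double sum over the second derivatives of \<open>\<psi>\<close>, and these are symmetric.
\<close>

lemma ext_d_pullback:
  fixes \<psi> :: "'e::euclidean_space \<Rightarrow> 'e"
  assumes S: "open S" "y \<in> S" and T: "open T" "\<psi> ` S \<subseteq> T" and \<psi>: "smooth_on S \<psi>"
    and F: "local_form T k F"
    and G: "\<And>y es. y \<in> S \<Longrightarrow> G y es = F (\<psi> y) (map (frechet_derivative \<psi> (at y)) es)"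
  shows "ext_d G y es = ext_d F (\<psi> y) (map (frechet_derivative \<psi> (at y)) es)"
proof -
  let ?B = "\<lambda>y. frechet_derivative \<psi> (at y)"
  let ?s = "\<lambda>w h. frechet_derivative (\<lambda>y. ?B y w) (at y) h"
  have F\<psi>: "local_form S k (\<lambda>y. F (\<psi> y))"
    unfolding local_form_def
    using T by (auto intro!: local_form_alternating[OF F]
        smooth_on_compose[OF S(1) T local_form_smooth[OF F] \<psi>])
  have B: "((\<lambda>y. ?B y e) has_derivative ?s e) (at y)" for e
    by (intro has_derivative_frechet smooth_on_differentiable[OF smooth_on_frechet[OF \<psi>] S(2)])
  have chain: "frechet_derivative (\<lambda>y. F (\<psi> y) us) (at y) h =
      frechet_derivative (\<lambda>z. F z us) (at (\<psi> y)) (?B y h)" for us h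
  proof -
    have "\<psi> y \<in> T" using S T by auto
    from diff_chain_at[OF has_derivative_frechet[OF smooth_on_differentiable[OF \<psi> S(2)]]
        local_form_has_derivative[OF F this], of us]
    have "((\<lambda>y. F (\<psi> y) us) has_derivative
        (\<lambda>h. frechet_derivative (\<lambda>z. F z us) (at (\<psi> y)) (?B y h))) (at y)"
      by (simp add: o_def)
    then show ?thesis by (simp add: frechet_derivativeI)
  qed
  have dG: "frechet_derivative (\<lambda>y. G y us) (at y) h =
      frechet_derivative (\<lambda>z. F z (map (?B y) us)) (at (\<psi> y)) (?B y h) +
      antisum (\<lambda>w zs. F (\<psi> y) (?s w h # map (?B y) zs)) us" for us h
  proof -
    have "frechet_derivative (\<lambda>y. G y us) (at y) =
        frechet_derivative (\<lambda>y. F (\<psi> y) ([] @ map (?B y) us)) (at y)"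
      by (rule frechet_derivative_cong_open[OF S]) (simp add: G)
    then show ?thesis
      unfolding frechet_derivativeI[OF alternating_map_has_derivative[OF S F\<psi> B, where ws = "[]" and es = us]]
      by (simp add: chain)
  qed
  have "ext_d G y es = ext_d F (\<psi> y) (map (?B y) es) +
      antisum (\<lambda>h us. antisum (\<lambda>w zs. F (\<psi> y) (?s w h # map (?B y) zs)) us) es"
    by (simp add: ext_d_def dG antisum_add antisum_map)
  also have "antisum (\<lambda>h us. antisum (\<lambda>w zs. F (\<psi> y) (?s w h # map (?B y) zs)) us) es = 0"
    by (rule antisum_antisum_symmetric) (simp add: frechet_derivative_commute[OF S \<psi>])
  finally show ?thesis by simp
qed

section \<open>Charts, tangent vectors and local representatives\<close>

definition overlap :: "('a, 'e) chart \<Rightarrow> ('a, 'e) chart \<Rightarrow> 'e set" where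
  "overlap c d = snd c ` (fst c \<inter> fst d)"

text \<open>The Jacobian of the transition from the chart \<open>c\<close> to the chart \<open>d\<close>.\<close>

abbreviation jac :: "('a, 'e::real_normed_vector) chart \<Rightarrow> ('a, 'e) chart \<Rightarrow> 'e \<Rightarrow> 'e \<Rightarrow> 'e" where
  "jac c d y \<equiv> frechet_derivative (snd d \<circ> chart_inv c) (at y)"

text \<open>The coordinate expression of a form in the chart \<open>c\<close>.\<close>

definition loc ::
  "('a, 'e::euclidean_space) chart set \<Rightarrow> ('a, 'e) chart \<Rightarrow> ('a, 'e) form_field \<Rightarrow> 'e \<Rightarrow> 'e list \<Rightarrow> real"
  where "loc A c \<omega> y es = \<omega> (chart_inv c y) (map (coord_vector A c (chart_inv c y)) es)"

text \<open>
  The default value \<open>0\<close> on lists that contain anything else than tangent vectors; together with the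
  coordinate expressions it determines the field.
\<close>

definition tensorial :: "('a, 'e::euclidean_space) chart set \<Rightarrow> ('a, 'e) form_field \<Rightarrow> bool" where
  "tensorial A \<omega> \<longleftrightarrow> (\<forall>x vs. \<not> set vs \<subseteq> tangent_space A x \<longrightarrow> \<omega> x vs = 0)"

locale smooth_manifold =
  fixes A :: "('a::{t2_space, second_countable_topology}, 'e::euclidean_space) chart set"
  assumes atlas: "smooth_atlas A"
begin

lemma chart_homeo:
  assumes "c \<in> A"
  shows "homeomorphism (fst c) (chart_range c) (snd c) (chart_inv c)"
    and open_dom: "open (fst c)" and open_range: "open (chart_range c)"
  using atlas assms by (auto simp: smooth_atlas_def)

lemma chart_simps:
  assumes "c \<in> A"
  shows "x \<in> fst c \<Longrightarrow> chart_inv c (snd c x) = x" "x \<in> fst c \<Longrightarrow> snd c x \<in> chart_range c"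
    "y \<in> chart_range c \<Longrightarrow> snd c (chart_inv c y) = y" "y \<in> chart_range c \<Longrightarrow> chart_inv c y \<in> fst c"
  using chart_homeo[OF assms] by (auto simp: homeomorphism_def)

lemma continuous_chart_inv: "c \<in> A \<Longrightarrow> continuous_on (chart_range c) (chart_inv c)"
  using chart_homeo by (simp add: homeomorphism_def)

lemma chart_exists: obtains c where "c \<in> A" "x \<in> fst c"
proof -
  have "x \<in> (\<Union>c\<in>A. fst c)" using atlas by (simp add: smooth_atlas_def)
  then show ?thesis using that by blast
qed

lemma chart_at: "chart_at A x \<in> A" "x \<in> fst (chart_at A x)"
proof -
  have "\<exists>c. c \<in> A \<and> x \<in> fst c" by (meson chart_exists)
  then have "chart_at A x \<in> A \<and> x \<in> fst (chart_at A x)"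
    unfolding chart_at_def by (rule someI_ex)
  then show "chart_at A x \<in> A" "x \<in> fst (chart_at A x)" by auto
qed

lemma overlap_eq: "c \<in> A \<Longrightarrow> overlap c d = chart_range c \<inter> chart_inv c -` fst d"
  unfolding overlap_def
proof (intro equalityI subsetI)
  fix y assume c: "c \<in> A"
  show "y \<in> chart_range c \<inter> chart_inv c -` fst d" if "y \<in> snd c ` (fst c \<inter> fst d)"
    using that chart_simps(1,2)[OF c] by auto
  show "y \<in> snd c ` (fst c \<inter> fst d)" if "y \<in> chart_range c \<inter> chart_inv c -` fst d"
    using that chart_simps(3,4)[OF c, of y] by (intro image_eqI[of _ _ "chart_inv c y"]) auto
qed

lemma open_overlap: "c \<in> A \<Longrightarrow> d \<in> A \<Longrightarrow> open (overlap c d)"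
proof -
  assume A: "c \<in> A" "d \<in> A"
  show ?thesis
    unfolding overlap_eq[OF A(1)]
    by (rule continuous_open_preimage[OF continuous_chart_inv[OF A(1)] open_range[OF A(1)] open_dom[OF A(2)]])
qed

lemma overlapI: "x \<in> fst c \<Longrightarrow> x \<in> fst d \<Longrightarrow> snd c x \<in> overlap c d"
  by (auto simp: overlap_def)

lemma transition_maps: "c \<in> A \<Longrightarrow> (snd d \<circ> chart_inv c) ` overlap c d \<subseteq> chart_range d"
  by (auto simp: overlap_eq chart_range_def)

lemma smooth_transition: "c \<in> A \<Longrightarrow> d \<in> A \<Longrightarrow> smooth_on (overlap c d) (snd d \<circ> chart_inv c)"
  using atlas by (auto simp: smooth_atlas_def overlap_def)

lemma jac_has_derivative:
  "c \<in> A \<Longrightarrow> d \<in> A \<Longrightarrow> y \<in> overlap c d \<Longrightarrow> ((snd d \<circ> chart_inv c) has_derivative jac c d y) (at y)"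
  by (rule has_derivative_frechet[OF smooth_on_differentiable[OF smooth_transition]])

lemma linear_jac: "c \<in> A \<Longrightarrow> d \<in> A \<Longrightarrow> x \<in> fst c \<Longrightarrow> x \<in> fst d \<Longrightarrow> linear (jac c d (snd c x))"
  using jac_has_derivative[OF _ _ overlapI] has_derivative_linear by blast

lemma jac_cocycle:
  assumes A: "c \<in> A" "d \<in> A" "d' \<in> A" and x: "x \<in> fst c" "x \<in> fst d" "x \<in> fst d'"
  shows "jac d d' (snd d x) (jac c d (snd c x) e) = jac c d' (snd c x) e"
proof -
  have "((snd d' \<circ> chart_inv d) has_derivative jac d d' (snd d x)) (at ((snd d \<circ> chart_inv c) (snd c x)))"
    using jac_has_derivative[OF A(2,3) overlapI[OF x(2,3)]] chart_simps[OF A(1)] x by simp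
  from diff_chain_at[OF jac_has_derivative[OF A(1,2) overlapI[OF x(1,2)]] this]
  have "(((snd d' \<circ> chart_inv d) \<circ> (snd d \<circ> chart_inv c)) has_derivative
      (jac d d' (snd d x) \<circ> jac c d (snd c x))) (at (snd c x))" .
  then have "((snd d' \<circ> chart_inv c) has_derivative (jac d d' (snd d x) \<circ> jac c d (snd c x))) (at (snd c x))"
    by (rule has_derivative_transform_within_open[OF _ open_overlap[OF A(1,2)] overlapI[OF x(1,2)]])
      (use A chart_simps in \<open>auto simp: overlap_eq\<close>)
  from frechet_derivativeI[OF this] show ?thesis by simp
qed

lemma coord_vector_apply:
  "d \<in> A \<Longrightarrow> x \<in> fst d \<Longrightarrow> coord_vector A c x e d = jac c d (snd c x) e"
  by (simp add: coord_vector_def)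

text \<open>The compatibility of the components in different charts is the chain rule \<open>jac_cocycle\<close>.\<close>

lemma coord_vector_tangent: "c \<in> A \<Longrightarrow> x \<in> fst c \<Longrightarrow> coord_vector A c x e \<in> tangent_space A x"
  by (auto simp: tangent_space_def coord_vector_apply jac_cocycle) (auto simp: coord_vector_def)

lemma coord_vector_of_tangent:
  assumes "c \<in> A" "x \<in> fst c" "v \<in> tangent_space A x"
  shows "coord_vector A c x (v c) = v"
proof
  fix d
  show "coord_vector A c x (v c) d = v d"
  proof (cases "d \<in> A \<and> x \<in> fst d")
    case True
    then have "v d = jac c d (snd c x) (v c)"
      using assms unfolding tangent_space_def by blast
    then show ?thesis using True by (simp add: coord_vector_apply)
  next
    case False
    then have "v d = 0"
      using assms(3) unfolding tangent_space_def by blast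
    then show ?thesis
      using False by (auto simp: coord_vector_def)
  qed
qed

lemma coord_vector_change:
  assumes "c \<in> A" "d \<in> A" "x \<in> fst c" "x \<in> fst d"
  shows "coord_vector A d x (jac c d (snd c x) e) = coord_vector A c x e"
  using coord_vector_of_tangent[OF assms(2,4) coord_vector_tangent[OF assms(1,3)], of e] assms
  by (simp add: coord_vector_apply)

lemma coord_vector_lincomb:
  assumes "c \<in> A" "x \<in> fst c"
  shows "coord_vector A c x (a *\<^sub>R v + b *\<^sub>R w) =
    (\<lambda>d. a *\<^sub>R coord_vector A c x v d + b *\<^sub>R coord_vector A c x w d)"
proof
  fix d
  show "coord_vector A c x (a *\<^sub>R v + b *\<^sub>R w) d =
      a *\<^sub>R coord_vector A c x v d + b *\<^sub>R coord_vector A c x w d"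
    using linear_jac[OF assms(1) _ assms(2), of d]
    by (auto simp: coord_vector_def linear_add linear_scale)
qed

lemma map_coord_vector:
  assumes "c \<in> A" "x \<in> fst c" "set vs \<subseteq> tangent_space A x"
  shows "map (coord_vector A c x) (map (\<lambda>v. v c) vs) = vs"
  unfolding map_map
proof (rule map_idI)
  show "(coord_vector A c x \<circ> (\<lambda>v. v c)) v = v" if "v \<in> set vs" for v
    using coord_vector_of_tangent[OF assms(1,2), of v] assms(3) that by auto
qed

lemma set_map_coord_vector:
  "c \<in> A \<Longrightarrow> x \<in> fst c \<Longrightarrow> set (map (coord_vector A c x) es) \<subseteq> tangent_space A x"
  using coord_vector_tangent[of c x] by auto

text \<open>
  The coordinate frame identifies the tangent space with the Euclidean space. From here on, identities
  of forms can be checked for coordinate expressions.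
\<close>

lemma alt_forms_iff_alternating:
  assumes c: "c \<in> A" "x \<in> fst c"
  shows "\<omega> \<in> alt_forms A x k \<longleftrightarrow>
    (\<forall>vs. \<not> set vs \<subseteq> tangent_space A x \<longrightarrow> \<omega> vs = 0) \<and>
    alternating k (\<lambda>es. \<omega> (map (coord_vector A c x) es))" (is "_ \<longleftrightarrow> ?supp \<and> ?alt")
proof
  let ?C = "coord_vector A c x"
  note tan = coord_vector_tangent[OF c]
  assume \<omega>: "\<omega> \<in> alt_forms A x k"
  have ?supp using \<omega> by (auto simp: alt_forms_def)
  moreover have ?alt
  proof (rule alternatingI)
    show "\<omega> (map ?C es) = 0" if "int (length es) \<noteq> k" for es
      using \<omega> that by (simp add: alt_forms_def)
    show "\<omega> (map ?C (us @ (a *\<^sub>R v + b *\<^sub>R w) # ws)) = a * \<omega> (map ?C (us @ v # ws)) + b * \<omega> (map ?C (us @ w # ws))"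
      for us v w a b ws
    proof -
      let ?vs = "map ?C (us @ v # ws)"
      have "set ?vs \<subseteq> tangent_space A x" "length us < length ?vs" using tan by auto
      then have "\<omega> (?vs[length us := \<lambda>d. a *\<^sub>R ?C v d + b *\<^sub>R ?C w d]) =
          a * \<omega> (?vs[length us := ?C v]) + b * \<omega> (?vs[length us := ?C w])"
        using \<omega> tan unfolding alt_forms_def by blast
      then show ?thesis
        by (simp add: list_update_append coord_vector_lincomb[OF c])
    qed
    show "\<omega> (map ?C (us @ v # ws @ v # zs)) = 0" for us v ws zs
    proof -
      let ?vs = "map ?C (us @ v # ws @ v # zs)"
      let ?j = "length us + Suc (length ws)"
      have "length us < ?j" "?j < length ?vs" "?vs ! length us = ?vs ! ?j"
        by (simp_all add: nth_append)
      then show ?thesis using \<omega> unfolding alt_forms_def by blast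
    qed
  qed
  ultimately show "?supp \<and> ?alt" ..
next
  let ?C = "coord_vector A c x"
  assume "?supp \<and> ?alt"
  then have supp: ?supp and alt: ?alt by auto
  define f where "f = (\<lambda>es. \<omega> (map ?C es))"
  have f: "alternating k f" using alt by (simp add: f_def)
  have \<omega>f: "\<omega> vs = f (map (\<lambda>v. v c) vs)" if "set vs \<subseteq> tangent_space A x" for vs
    unfolding f_def using map_coord_vector[OF c that] by simp
  have upd: "f (es[i := a *\<^sub>R v + b *\<^sub>R w]) = a * f (es[i := v]) + b * f (es[i := w])"
    if "i < length es" for es i a b v w
    using that alternating_lincomb[OF f] by (simp add: upd_conv_take_nth_drop)
  have rep: "f es = 0" if "i < j" "j < length es" "es ! i = es ! j" for es and i j :: nat
  proof -
    have "es = take i es @ es ! i # drop (Suc i) es"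
      by (rule id_take_nth_drop) (use that in linarith)
    moreover have "drop (Suc i) es = take (j - Suc i) (drop (Suc i) es) @ es ! j # drop (Suc (j - Suc i)) (drop (Suc i) es)"
      using that id_take_nth_drop[of "j - Suc i" "drop (Suc i) es"] by simp
    ultimately have "es = take i es @ es ! i # take (j - Suc i) (drop (Suc i) es) @ es ! i # drop (Suc (j - Suc i)) (drop (Suc i) es)"
      unfolding that(3) by argo
    then show ?thesis
      by (rule ssubst[where P = "\<lambda>es. f es = 0"]) (rule alternating_repeat[OF f])
  qed
  show "\<omega> \<in> alt_forms A x k"
    unfolding alt_forms_def
  proof (intro CollectI conjI allI impI)
    show "\<omega> vs = 0" if "\<not> (int (length vs) = k \<and> set vs \<subseteq> tangent_space A x)" for vs
      using that supp \<omega>f alternating_length[OF f] by (cases "set vs \<subseteq> tangent_space A x") auto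
    show "\<omega> (vs[i := (\<lambda>c. a *\<^sub>R v c + b *\<^sub>R w c)]) = a * \<omega> (vs[i := v]) + b * \<omega> (vs[i := w])"
      if "set vs \<subseteq> tangent_space A x" "i < length vs" "v \<in> tangent_space A x" "w \<in> tangent_space A x"
      for vs i v w a b
    proof -
      have "(\<lambda>c. a *\<^sub>R v c + b *\<^sub>R w c) = ?C (a *\<^sub>R v c + b *\<^sub>R w c)"
        using coord_vector_lincomb[OF c] coord_vector_of_tangent[OF c] that by simp
      then have t: "(\<lambda>c. a *\<^sub>R v c + b *\<^sub>R w c) \<in> tangent_space A x"
        using coord_vector_tangent[OF c] by simp
      have sub: "set (vs[i := u]) \<subseteq> tangent_space A x" if "u \<in> tangent_space A x" for u
        using that \<open>set vs \<subseteq> _\<close> by (rule set_update_subsetI[rotated])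
      show ?thesis
        unfolding \<omega>f[OF sub[OF t]] \<omega>f[OF sub[OF that(3)]] \<omega>f[OF sub[OF that(4)]] map_update
        by (rule upd) (simp add: that)
    qed
    show "\<omega> vs = 0" if "i < j" "j < length vs" "vs ! i = vs ! j" for vs i j
    proof (cases "set vs \<subseteq> tangent_space A x")
      case True
      show ?thesis unfolding \<omega>f[OF True] by (rule rep[OF that(1)]) (use that in auto)
    qed (use supp in simp)
  qed
qed

lemma forms_iff_local:
  "\<omega> \<in> forms A k \<longleftrightarrow> tensorial A \<omega> \<and> (\<forall>c\<in>A. local_form (chart_range c) k (loc A c \<omega>))"
proof -
  have "(\<forall>x. \<omega> x \<in> alt_forms A x k) \<longleftrightarrow>
      tensorial A \<omega> \<and> (\<forall>c\<in>A. \<forall>y\<in>chart_range c. alternating k (loc A c \<omega> y))" (is "?l \<longleftrightarrow> ?r")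
  proof
    assume ?l
    then show ?r
    proof (intro conjI ballI)
      show "tensorial A \<omega>"
        using \<open>?l\<close> by (simp add: tensorial_def alt_forms_def)
      show "alternating k (loc A c \<omega> y)" if c: "c \<in> A" "y \<in> chart_range c" for c y
      proof -
        have "\<omega> (chart_inv c y) \<in> alt_forms A (chart_inv c y) k" using \<open>?l\<close> by simp
        then show ?thesis
          unfolding alt_forms_iff_alternating[OF c(1) chart_simps(4)[OF c]] loc_def[abs_def] by simp
      qed
    qed
  next
    assume r: ?r
    show ?l
    proof
      fix x
      obtain c where c: "c \<in> A" "x \<in> fst c" using chart_exists .
      show "\<omega> x \<in> alt_forms A x k"
        unfolding alt_forms_iff_alternating[OF c]
      proof
        show "\<forall>vs. \<not> set vs \<subseteq> tangent_space A x \<longrightarrow> \<omega> x vs = 0"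
          using r by (simp add: tensorial_def)
        have "alternating k (loc A c \<omega> (snd c x))"
          using r c(1) chart_simps(2)[OF c] by simp
        then show "alternating k (\<lambda>es. \<omega> x (map (coord_vector A c x) es))"
          by (simp add: loc_def[abs_def] chart_simps(1)[OF c])
      qed
    qed
  qed
  then show ?thesis
    unfolding forms_def local_form_def by (auto simp: loc_def)
qed

lemma forms_tensorial: "\<omega> \<in> forms A k \<Longrightarrow> tensorial A \<omega>"
  and forms_local: "\<omega> \<in> forms A k \<Longrightarrow> c \<in> A \<Longrightarrow> local_form (chart_range c) k (loc A c \<omega>)"
  by (auto simp: forms_iff_local)

lemma tensorial_eval:
  assumes "c \<in> A" "x \<in> fst c" "set vs \<subseteq> tangent_space A x"
  shows "\<omega> x vs = loc A c \<omega> (snd c x) (map (\<lambda>v. v c) vs)"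
  using map_coord_vector[OF assms] chart_simps[OF assms(1)] assms(2) by (simp add: loc_def)

lemma tensorial_eqI:
  assumes "tensorial A \<omega>" "tensorial A \<eta>"
    and "\<And>c y es. c \<in> A \<Longrightarrow> y \<in> chart_range c \<Longrightarrow> loc A c \<omega> y es = loc A c \<eta> y es"
  shows "\<omega> = \<eta>"
proof (intro ext)
  fix x vs
  obtain c where c: "c \<in> A" "x \<in> fst c" using chart_exists .
  show "\<omega> x vs = \<eta> x vs"
  proof (cases "set vs \<subseteq> tangent_space A x")
    case True
    then show ?thesis
      using assms(3) c chart_simps[OF c(1)] by (simp add: tensorial_eval[OF c])
  qed (use assms(1,2) in \<open>simp add: tensorial_def\<close>)
qed

lemma loc_transition:
  assumes "c \<in> A" "d \<in> A" "y \<in> overlap c d"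
  shows "loc A c \<omega> y es = loc A d \<omega> ((snd d \<circ> chart_inv c) y) (map (jac c d y) es)"
proof -
  obtain x where x: "x \<in> fst c" "x \<in> fst d" "y = snd c x"
    using assms(3) by (auto simp: overlap_def)
  show ?thesis
    using x assms chart_simps coord_vector_change[OF assms(1,2) x(1,2)] by (simp add: loc_def o_def)
qed

end

section \<open>Differential forms and multivector fields\<close>

text \<open>
  The pointwise vector space operations, for forms as well as for multivector fields. A single
  operation is used for sums and scalar multiples, so that every linear operator needs one linearity
  lemma only.
\<close>

definition lincomb :: "real \<Rightarrow> ('i \<Rightarrow> 'j \<Rightarrow> real) \<Rightarrow> real \<Rightarrow> ('i \<Rightarrow> 'j \<Rightarrow> real) \<Rightarrow> 'i \<Rightarrow> 'j \<Rightarrow> real" where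
  "lincomb a \<omega> b \<eta> = (\<lambda>x vs. a * \<omega> x vs + b * \<eta> x vs)"

definition mv_coeffs ::
  "('a, 'e::euclidean_space) chart set \<Rightarrow> ('a, 'e) chart \<Rightarrow> nat \<Rightarrow> ('a, 'e) mv_field \<Rightarrow>
   ('e list \<Rightarrow> 'e \<Rightarrow> real) \<Rightarrow> bool" where
  "mv_coeffs A c p U f \<longleftrightarrow> (\<forall>es. smooth_on (chart_range c) (f es)) \<and>
     (\<forall>y\<in>chart_range c. U (chart_inv c y) = (\<lambda>\<omega>. \<Sum>es\<in>basis_lists p. f es y *
        decomposable A (chart_inv c y) (map (coord_vector A c (chart_inv c y)) es) \<omega>))"

lemma mv_fieldsD: "U \<in> mv_fields A p \<Longrightarrow> c \<in> A \<Longrightarrow> \<exists>f. mv_coeffs A c p U f"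
  by (auto simp: mv_fields_def mv_coeffs_def)

lemma loc_lincomb: "loc A c (lincomb a \<omega> b \<eta>) = (\<lambda>y es. a * loc A c \<omega> y es + b * loc A c \<eta> y es)"
  by (simp add: loc_def[abs_def] lincomb_def)

lemma tensorial_lincomb: "tensorial A \<omega> \<Longrightarrow> tensorial A \<eta> \<Longrightarrow> tensorial A (lincomb a \<omega> b \<eta>)"
  by (simp add: tensorial_def lincomb_def)

lemma contract_lincomb_left: "contract (lincomb a U b V) \<omega> = lincomb a (contract U \<omega>) b (contract V \<omega>)"
  by (simp add: contract_def lincomb_def)

lemma lie_deriv_eq:
  "lie_deriv A p U \<omega> = lincomb 1 (ext_deriv A (contract U \<omega>)) (- ((-1) ^ p)) (contract U (ext_deriv A \<omega>))"
  by (simp add: lie_deriv_def lincomb_def)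

context smooth_manifold
begin

text \<open>
  The exterior derivative is computed in an arbitrarily chosen chart. By naturality under chart
  transitions every other chart gives the same result.
\<close>

lemma loc_ext_deriv:
  assumes "\<omega> \<in> forms A k" "c \<in> A" "y \<in> chart_range c"
  shows "loc A c (ext_deriv A \<omega>) y es = ext_d (loc A c \<omega>) y es"
proof -
  define x where "x = chart_inv c y"
  define d where "d = chart_at A x"
  have d: "d \<in> A" "x \<in> fst d" unfolding d_def by (rule chart_at)+
  have x: "x \<in> fst c" "snd c x = y" unfolding x_def using chart_simps[OF assms(2)] assms(3) by auto
  have y: "y \<in> overlap c d" using overlapI[OF x(1) d(2)] x(2) by simp
  have "loc A c (ext_deriv A \<omega>) y es = ext_deriv A \<omega> x (map (coord_vector A c x) es)"
    by (simp add: loc_def x_def)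
  also have "\<dots> = ext_d (loc A d \<omega>) (snd d x) (map (\<lambda>v. v d) (map (coord_vector A c x) es))"
    using set_map_coord_vector[OF assms(2) x(1), of es]
    unfolding ext_deriv_def Let_def d_def[symmetric] ext_d_def antisum_def loc_def by simp
  also have "map (\<lambda>v. v d) (map (coord_vector A c x) es) = map (jac c d y) es"
    using x(2) by (simp add: coord_vector_apply[OF d] o_def)
  also have "snd d x = (snd d \<circ> chart_inv c) y"
    by (simp add: x_def)
  also have "ext_d (loc A d \<omega>) ((snd d \<circ> chart_inv c) y) (map (jac c d y) es) = ext_d (loc A c \<omega>) y es"
    by (rule ext_d_pullback[OF open_overlap[OF assms(2) d(1)] y open_range[OF d(1)]
          transition_maps[OF assms(2)] smooth_transition[OF assms(2) d(1)] forms_local[OF assms(1) d(1)], symmetric])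
      (rule loc_transition[OF assms(2) d(1)])
  finally show ?thesis .
qed

lemma tensorial_ext_deriv: "tensorial A (ext_deriv A \<omega>)"
  by (simp add: tensorial_def ext_deriv_def)

lemma ext_deriv_forms:
  assumes "\<omega> \<in> forms A k"
  shows "ext_deriv A \<omega> \<in> forms A (k + 1)"
  unfolding forms_iff_local
proof (intro conjI ballI tensorial_ext_deriv)
  fix c assume c: "c \<in> A"
  show "local_form (chart_range c) (k + 1) (loc A c (ext_deriv A \<omega>))"
    by (rule local_form_cong[OF open_range[OF c] _ local_form_ext_d[OF open_range[OF c] forms_local[OF assms c]]])
      (simp add: loc_ext_deriv[OF assms c])
qed

lemma ext_deriv_ext_deriv:
  assumes "\<omega> \<in> forms A k"
  shows "ext_deriv A (ext_deriv A \<omega>) = (\<lambda>x vs. 0)"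
proof (rule tensorial_eqI[OF tensorial_ext_deriv])
  fix c y es assume c: "c \<in> A" "y \<in> chart_range c"
  have "loc A c (ext_deriv A (ext_deriv A \<omega>)) y es = ext_d (loc A c (ext_deriv A \<omega>)) y es"
    by (rule loc_ext_deriv[OF ext_deriv_forms[OF assms] c])
  also have "\<dots> = ext_d (ext_d (loc A c \<omega>)) y es"
    by (rule ext_d_cong[OF open_range[OF c(1)] c(2)]) (rule loc_ext_deriv[OF assms c(1)])
  also have "\<dots> = 0"
    by (rule ext_d_ext_d[OF open_range[OF c(1)] forms_local[OF assms c(1)] c(2)])
  finally show "loc A c (ext_deriv A (ext_deriv A \<omega>)) y es = loc A c (\<lambda>x vs. 0) y es"
    by (simp add: loc_def)
qed (simp add: tensorial_def)

lemma lincomb_forms: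
  "\<omega> \<in> forms A k \<Longrightarrow> \<eta> \<in> forms A k \<Longrightarrow> lincomb a \<omega> b \<eta> \<in> forms A k"
  by (auto simp: forms_iff_local loc_lincomb tensorial_lincomb intro!: local_form_lincomb open_range)

lemma ext_deriv_lincomb:
  assumes "\<omega> \<in> forms A k" "\<eta> \<in> forms A k"
  shows "ext_deriv A (lincomb a \<omega> b \<eta>) = lincomb a (ext_deriv A \<omega>) b (ext_deriv A \<eta>)"
  by (rule tensorial_eqI[OF tensorial_ext_deriv tensorial_lincomb[OF tensorial_ext_deriv tensorial_ext_deriv]])
    (simp add: loc_ext_deriv[OF lincomb_forms[OF assms]] loc_ext_deriv[OF assms(1)] loc_ext_deriv[OF assms(2)]
      loc_lincomb ext_d_lincomb[OF forms_local[OF assms(1)] forms_local[OF assms(2)]])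

lemma zero_alt_form: "(\<lambda>vs. 0) \<in> alt_forms A x k"
  by (simp add: alt_forms_def)

lemma alt_forms_append:
  assumes "\<omega> \<in> alt_forms A x k"
  shows "(\<lambda>us. \<omega> (us @ vs)) \<in> alt_forms A x (k - int (length vs))"
proof -
  obtain c where c: "c \<in> A" "x \<in> fst c" using chart_exists .
  have \<omega>: "\<not> set us \<subseteq> tangent_space A x \<Longrightarrow> \<omega> us = 0" for us
    using assms unfolding alt_forms_iff_alternating[OF c] by blast
  show ?thesis
  proof (cases "set vs \<subseteq> tangent_space A x")
    case True
    have "alternating k (\<lambda>es. \<omega> (map (coord_vector A c x) es))"
      using assms unfolding alt_forms_iff_alternating[OF c] by blast
    from alternating_append[OF this, of "map (\<lambda>v. v c) vs"]
    have "alternating (k - int (length vs)) (\<lambda>es. \<omega> (map (coord_vector A c x) es @ vs))"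
      by (simp only: map_append map_coord_vector[OF c True] length_map)
    then show ?thesis
      unfolding alt_forms_iff_alternating[OF c] using \<omega> by auto
  next
    case False
    then have "(\<lambda>us. \<omega> (us @ vs)) = (\<lambda>us. 0)" using \<omega> by auto
    then show ?thesis by (simp add: zero_alt_form)
  qed
qed

text \<open>A local expression at a point already exhibits the value there as a sum of decomposables.\<close>

lemma mv_fieldsI:
  assumes "\<And>c. c \<in> A \<Longrightarrow> \<exists>f. mv_coeffs A c p U f"
  shows "U \<in> mv_fields A p"
  unfolding mv_fields_def
proof (intro CollectI conjI allI ballI)
  fix x
  obtain c where c: "c \<in> A" "x \<in> fst c" using chart_exists .
  obtain f where f: "mv_coeffs A c p U f" using assms c by blast
  let ?C = "map (coord_vector A c x)"
  obtain ess where ess: "set ess = (basis_lists p :: 'e list set)" "distinct ess"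
    using finite_distinct_list[OF finite_basis_lists] by blast
  define l where "l = map (\<lambda>es. (f es (snd c x), ?C es)) ess"
  have "U x = (\<lambda>\<omega>. \<Sum>es\<in>basis_lists p. f es (snd c x) * decomposable A x (?C es) \<omega>)"
    using f chart_simps(1,2)[OF c] unfolding mv_coeffs_def by force
  also have "\<dots> = (\<lambda>\<omega>. \<Sum>(r, us)\<leftarrow>l. r * decomposable A x us \<omega>)"
    unfolding ess(1)[symmetric] l_def by (simp add: sum.distinct_set_conv_list[OF ess(2)] o_def)
  finally have "U x = (\<lambda>\<omega>. \<Sum>(r, us)\<leftarrow>l. r * decomposable A x us \<omega>)" .
  moreover have "\<forall>(r, us)\<in>set l. length us = p \<and> set us \<subseteq> tangent_space A x"
    using ess(1) coord_vector_tangent[OF c] unfolding l_def by auto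
  ultimately show "U x \<in> ext_power A x p"
    unfolding ext_power_def by blast
next
  fix c assume "c \<in> A"
  then show "\<exists>f. (\<forall>es. smooth_on (chart_range c) (f es)) \<and>
      (\<forall>y\<in>chart_range c. U (chart_inv c y) = (\<lambda>\<omega>. \<Sum>es | length es = p \<and> set es \<subseteq> Basis. f es y *
        decomposable A (chart_inv c y) (map (coord_vector A c (chart_inv c y)) es) \<omega>))"
    using assms unfolding mv_coeffs_def by blast
qed

text \<open>
  Only for alternating forms, of any degree: on other functions of lists a multivector takes the default value
  \<open>0\<close> of decomposables.
\<close>

lemma mv_eval:
  assumes "mv_coeffs A c p U f" "c \<in> A" "x \<in> fst c" "\<omega> \<in> alt_forms A x k"
  shows "U x \<omega> = (\<Sum>es\<in>basis_lists p. f es (snd c x) * \<omega> (map (coord_vector A c x) es))"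
proof -
  have "decomposable A x us \<omega> = \<omega> us" for us
    using assms(4) unfolding decomposable_def by auto
  moreover have "U x = (\<lambda>\<omega>. \<Sum>es\<in>basis_lists p. f es (snd c x) * decomposable A x (map (coord_vector A c x) es) \<omega>)"
    using assms(1) chart_simps(1,2)[OF assms(2,3)] unfolding mv_coeffs_def by force
  ultimately show ?thesis by simp
qed

lemma contract_alt_forms:
  assumes "U \<in> mv_fields A p" "\<omega> \<in> alt_forms A x k"
  shows "(\<lambda>vs. U x (\<lambda>us. \<omega> (us @ vs))) \<in> alt_forms A x (k - int p)"
proof -
  obtain c where c: "c \<in> A" "x \<in> fst c" using chart_exists .
  obtain f where f: "mv_coeffs A c p U f" using mv_fieldsD[OF assms(1) c(1)] by blast
  let ?C = "map (coord_vector A c x)"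
  have eq: "U x (\<lambda>us. \<omega> (us @ vs)) = (\<Sum>es\<in>basis_lists p. f es (snd c x) * \<omega> (?C es @ vs))" for vs
    by (rule mv_eval[OF f c alt_forms_append[OF assms(2)]])
  have supp: "\<not> set us \<subseteq> tangent_space A x \<Longrightarrow> \<omega> us = 0" for us
    using assms(2) unfolding alt_forms_iff_alternating[OF c] by blast
  have alt: "alternating k (\<lambda>es. \<omega> (?C es))"
    using assms(2) unfolding alt_forms_iff_alternating[OF c] by blast
  have "alternating (k - int p) (\<lambda>vs. \<Sum>es\<in>basis_lists p. f es (snd c x) * \<omega> (?C (es @ vs)))"
  proof (rule alternating_sum)
    fix es :: "'e list" assume "es \<in> basis_lists p"
    then show "alternating (k - int p) (\<lambda>vs. \<omega> (?C (es @ vs)))"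
      using alternating_prepend[OF alt, of es] by simp
  qed
  then show ?thesis
    unfolding alt_forms_iff_alternating[OF c] eq using supp by auto
qed

lemma loc_contract:
  assumes "\<omega> \<in> forms A k" "mv_coeffs A c p U f" "c \<in> A" "y \<in> chart_range c"
  shows "loc A c (contract U \<omega>) y es = contr p f (loc A c \<omega>) y es"
proof -
  let ?x = "chart_inv c y"
  have "\<omega> ?x \<in> alt_forms A ?x k" using assms(1) by (simp add: forms_def)
  from mv_eval[OF assms(2,3) chart_simps(4)[OF assms(3,4)] alt_forms_append[OF this]]
  show ?thesis
    by (simp add: loc_def contract_def contr_def chart_simps(3)[OF assms(3,4)])
qed

lemma contract_forms:
  assumes "U \<in> mv_fields A p" "\<omega> \<in> forms A k"
  shows "contract U \<omega> \<in> forms A (k - int p)"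
proof -
  have "contract U \<omega> x \<in> alt_forms A x (k - int p)" for x
    unfolding contract_def by (rule contract_alt_forms[OF assms(1)]) (use assms(2) in \<open>simp add: forms_def\<close>)
  then have "tensorial A (contract U \<omega>)"
    unfolding tensorial_def alt_forms_def by blast
  moreover have "local_form (chart_range c) (k - int p) (loc A c (contract U \<omega>))" if c: "c \<in> A" for c
  proof -
    obtain f where f: "mv_coeffs A c p U f" using mv_fieldsD[OF assms(1) c] by blast
    have "local_form (chart_range c) (k - int p) (contr p f (loc A c \<omega>))"
      using f by (intro local_form_contr[OF open_range[OF c] forms_local[OF assms(2) c]])
        (simp add: mv_coeffs_def)
    then show ?thesis
      by (rule local_form_cong[OF open_range[OF c], rotated]) (simp add: loc_contract[OF assms(2) f c])
  qed
  ultimately show ?thesis by (simp add: forms_iff_local)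
qed

lemma contract_lincomb:
  assumes "U \<in> mv_fields A p" "\<omega> \<in> forms A k" "\<eta> \<in> forms A k"
  shows "contract U (lincomb a \<omega> b \<eta>) = lincomb a (contract U \<omega>) b (contract U \<eta>)"
proof (rule tensorial_eqI)
  note l = lincomb_forms[OF assms(2,3)]
  show "tensorial A (contract U (lincomb a \<omega> b \<eta>))"
    by (rule forms_tensorial[OF contract_forms[OF assms(1) l]])
  show "tensorial A (lincomb a (contract U \<omega>) b (contract U \<eta>))"
    by (intro tensorial_lincomb forms_tensorial[OF contract_forms[OF assms(1,2)]]
        forms_tensorial[OF contract_forms[OF assms(1,3)]])
  fix c y es assume c: "c \<in> A" "y \<in> chart_range c"
  obtain f where f: "mv_coeffs A c p U f" using mv_fieldsD[OF assms(1) c(1)] by blast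
  show "loc A c (contract U (lincomb a \<omega> b \<eta>)) y es = loc A c (lincomb a (contract U \<omega>) b (contract U \<eta>)) y es"
    by (simp add: loc_contract[OF l f c] loc_contract[OF assms(2) f c] loc_contract[OF assms(3) f c]
        loc_lincomb contr_lincomb)
qed

text \<open>
  In coordinates, the two sides differ by an exchange of the vectors of \<open>U\<close> and of \<open>V\<close> in the first
  \<open>p + q\<close> arguments.
\<close>

lemma contract_commute:
  assumes "U \<in> mv_fields A p" "V \<in> mv_fields A q" "\<omega> \<in> forms A k"
  shows "contract V (contract U \<omega>) x vs = (-1) ^ (p * q) * contract U (contract V \<omega>) x vs"
proof -
  note UV = contract_forms[OF assms(2) contract_forms[OF assms(1,3)]]
  note VU = contract_forms[OF assms(1) contract_forms[OF assms(2,3)]]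
  have "contract V (contract U \<omega>) = lincomb ((-1) ^ (p * q)) (contract U (contract V \<omega>)) 0 (contract U (contract V \<omega>))"
  proof (rule tensorial_eqI[OF forms_tensorial[OF UV] tensorial_lincomb[OF forms_tensorial[OF VU] forms_tensorial[OF VU]]])
    fix c y es assume c: "c \<in> A" "y \<in> chart_range c"
    obtain f where f: "mv_coeffs A c p U f" using mv_fieldsD[OF assms(1) c(1)] by blast
    obtain g where g: "mv_coeffs A c q V g" using mv_fieldsD[OF assms(2) c(1)] by blast
    have "loc A c (contract V (contract U \<omega>)) y es = contr q g (contr p f (loc A c \<omega>)) y es"
      unfolding loc_contract[OF contract_forms[OF assms(1,3)] g c] contr_def[of q]
      by (simp add: loc_contract[OF assms(3) f c])
    moreover have "loc A c (contract U (contract V \<omega>)) y es = contr p f (contr q g (loc A c \<omega>)) y es"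
      unfolding loc_contract[OF contract_forms[OF assms(2,3)] f c] contr_def[of p]
      by (simp add: loc_contract[OF assms(3) g c])
    ultimately show "loc A c (contract V (contract U \<omega>)) y es =
        loc A c (lincomb ((-1) ^ (p * q)) (contract U (contract V \<omega>)) 0 (contract U (contract V \<omega>))) y es"
      using contr_commute[of k "loc A c \<omega>" y q g p f es] local_form_alternating[OF forms_local[OF assms(3) c(1)] c(2)]
      by (simp add: loc_lincomb)
  qed
  then show ?thesis by (simp add: lincomb_def)
qed

lemma contract_wedge:
  assumes "\<omega> \<in> forms A k"
  shows "contract (wedge A U V) \<omega> = contract V (contract U \<omega>)"
proof (intro ext)
  fix x vs
  have "(\<lambda>us. \<omega> x (us @ vs)) \<in> alt_forms A x (k - int (length vs))"
    by (rule alt_forms_append) (use assms in \<open>simp add: forms_def\<close>)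
  then have "(\<lambda>us. \<omega> x (us @ vs)) \<in> (\<Union>k. alt_forms A x k)" by blast
  then show "contract (wedge A U V) \<omega> x vs = contract V (contract U \<omega>) x vs"
    by (simp add: contract_def wedge_def)
qed

lemma sum_basis_lists_add:
  "(\<Sum>es\<in>basis_lists (p + q). h (take p es) (drop p es)) =
   (\<Sum>I\<in>(basis_lists p :: 'e list set). \<Sum>J\<in>basis_lists q. h I J :: real)"
proof -
  have "(\<Sum>I\<in>(basis_lists p :: 'e list set). \<Sum>J\<in>basis_lists q. h I J) =
      (\<Sum>(I, J)\<in>basis_lists p \<times> basis_lists q. h I J)"
    by (rule sum.cartesian_product)
  also have "\<dots> = (\<Sum>es\<in>basis_lists (p + q). h (take p es) (drop p es))"
    by (rule sum.reindex_bij_witness[where i = "\<lambda>es. (take p es, drop p es)" and j = "\<lambda>(I, J). I @ J"])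
      (auto dest: in_set_takeD in_set_dropD)
  finally show ?thesis ..
qed

lemma wedge_mv_fields:
  assumes "U \<in> mv_fields A p" "V \<in> mv_fields A q"
  shows "wedge A U V \<in> mv_fields A (p + q)"
proof (rule mv_fieldsI)
  fix c assume c: "c \<in> A"
  obtain f where f: "mv_coeffs A c p U f" using mv_fieldsD[OF assms(1) c] by blast
  obtain g where g: "mv_coeffs A c q V g" using mv_fieldsD[OF assms(2) c] by blast
  have "mv_coeffs A c (p + q) (wedge A U V) (\<lambda>es y. f (take p es) y * g (drop p es) y)"
    unfolding mv_coeffs_def
  proof (intro conjI allI ballI ext)
    show "smooth_on (chart_range c) (\<lambda>y. f (take p es) y * g (drop p es) y)" for es
      using f g by (intro smooth_on_mult open_range[OF c]) (simp_all add: mv_coeffs_def)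
    fix y \<omega> assume y: "y \<in> chart_range c"
    let ?x = "chart_inv c y" and ?C = "map (coord_vector A c (chart_inv c y))"
    note x = chart_simps(3,4)[OF c y]
    show "wedge A U V ?x \<omega> = (\<Sum>es\<in>basis_lists (p + q). f (take p es) y * g (drop p es) y *
        decomposable A ?x (?C es) \<omega>)"
    proof (cases "\<omega> \<in> (\<Union>k. alt_forms A ?x k)")
      case True
      then obtain k where k: "\<omega> \<in> alt_forms A ?x k" by blast
      have "wedge A U V ?x \<omega> = V ?x (\<lambda>vs. U ?x (\<lambda>us. \<omega> (us @ vs)))"
        using True by (simp add: wedge_def)
      also have "\<dots> = (\<Sum>J\<in>basis_lists q. g J y * U ?x (\<lambda>us. \<omega> (us @ ?C J)))"
        using mv_eval[OF g c x(2) contract_alt_forms[OF assms(1) k]] by (simp add: x(1))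
      also have "\<dots> = (\<Sum>J\<in>basis_lists q. \<Sum>I\<in>basis_lists p. g J y * (f I y * \<omega> (?C (I @ J))))"
        using mv_eval[OF f c x(2) alt_forms_append[OF k]] by (simp add: x(1) sum_distrib_left)
      also have "\<dots> = (\<Sum>I\<in>basis_lists p. \<Sum>J\<in>basis_lists q. f I y * g J y * decomposable A ?x (?C (I @ J)) \<omega>)"
        using True by (subst sum.swap) (simp add: decomposable_def mult_ac)
      also have "\<dots> = (\<Sum>es\<in>basis_lists (p + q). f (take p es) y * g (drop p es) y *
          decomposable A ?x (?C (take p es @ drop p es)) \<omega>)"
        by (rule sum_basis_lists_add[symmetric])
      finally show ?thesis by simp
    next
      case False
      then show ?thesis by (simp add: wedge_def decomposable_def)
    qed
  qed
  then show "\<exists>f. mv_coeffs A c (p + q) (wedge A U V) f" by blast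
qed

lemma lincomb_mv_fields:
  assumes "U \<in> mv_fields A p" "V \<in> mv_fields A p"
  shows "lincomb a U b V \<in> mv_fields A p"
proof (rule mv_fieldsI)
  fix c assume c: "c \<in> A"
  obtain f where f: "mv_coeffs A c p U f" using mv_fieldsD[OF assms(1) c] by blast
  obtain g where g: "mv_coeffs A c p V g" using mv_fieldsD[OF assms(2) c] by blast
  have "mv_coeffs A c p (lincomb a U b V) (\<lambda>es y. a * f es y + b * g es y)"
    using f g unfolding mv_coeffs_def lincomb_def
    by (auto intro!: smooth_on_add smooth_on_mult smooth_on_const open_range[OF c]
        simp: sum_distrib_left sum.distrib algebra_simps)
  then show "\<exists>f. mv_coeffs A c p (lincomb a U b V) f" by blast
qed

lemma lie_deriv_forms:
  assumes "U \<in> mv_fields A p" "\<omega> \<in> forms A k"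
  shows "lie_deriv A p U \<omega> \<in> forms A (k - int p + 1)"
  unfolding lie_deriv_eq
  using ext_deriv_forms[OF contract_forms[OF assms]] contract_forms[OF assms(1) ext_deriv_forms[OF assms(2)]]
  by (intro lincomb_forms) (simp_all add: algebra_simps)

lemma loc_lie_deriv:
  assumes "mv_coeffs A c p U f" "U \<in> mv_fields A p" "\<omega> \<in> forms A k" "c \<in> A" "y \<in> chart_range c"
  shows "loc A c (lie_deriv A p U \<omega>) y es = lie p f (loc A c \<omega>) y es"
proof -
  have "loc A c (ext_deriv A (contract U \<omega>)) y es = ext_d (contr p f (loc A c \<omega>)) y es"
    unfolding loc_ext_deriv[OF contract_forms[OF assms(2,3)] assms(4,5)]
    by (rule ext_d_cong[OF open_range[OF assms(4)] assms(5)]) (rule loc_contract[OF assms(3,1,4)])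
  moreover have "loc A c (contract U (ext_deriv A \<omega>)) y es = contr p f (ext_d (loc A c \<omega>)) y es"
    unfolding loc_contract[OF ext_deriv_forms[OF assms(3)] assms(1,4,5)] contr_def
    by (simp add: loc_ext_deriv[OF assms(3-5)])
  ultimately show ?thesis
    by (simp add: lie_deriv_eq loc_lincomb lie_def)
qed

section \<open>Extension of alternating forms\<close>

text \<open>
  Near \<open>x\<close> take the form with constant coefficients in a chart, and cut it off by a bump function with
  support in a compact ball of the chart range. As \<open>M\<close> is Hausdorff, the image of the ball in \<open>M\<close> is
  closed, so that the extension by zero is smooth in every chart.
\<close>

lemma alt_form_extends:
  assumes \<omega>: "\<omega> \<in> alt_forms A x k"
  obtains \<Omega> where "\<Omega> \<in> forms A k" "\<Omega> x = \<omega>"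
proof -
  obtain c where c: "c \<in> A" "x \<in> fst c" using chart_exists .
  obtain r where r: "r > 0" "cball (snd c x) r \<subseteq> chart_range c"
    using open_range[OF c(1)] chart_simps(2)[OF c] open_contains_cball by blast
  obtain \<phi> :: "'e \<Rightarrow> real" where \<phi>: "smooth_on UNIV \<phi>" "\<phi> (snd c x) = 1"
    "\<And>z. r \<le> dist (snd c x) z \<Longrightarrow> \<phi> z = 0"
    by (rule smooth_bump_exists[OF r(1), of "snd c x"]) blast
  define K where "K = chart_inv c ` cball (snd c x) r"
  have "compact K"
    unfolding K_def
    by (intro compact_continuous_image continuous_on_subset[OF continuous_chart_inv[OF c(1)] r(2)]) auto
  then have K: "closed K" by (rule compact_imp_closed)
  have Kc: "K \<subseteq> fst c"
    using r(2) chart_simps(4)[OF c(1)] unfolding K_def by blast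
  have off_K: "\<phi> (snd c z) = 0" if "z \<in> fst c" "z \<notin> K" for z
  proof (rule \<phi>(3), rule ccontr)
    assume "\<not> r \<le> dist (snd c x) (snd c z)"
    then have "snd c z \<in> cball (snd c x) r" by simp
    then have "chart_inv c (snd c z) \<in> K" unfolding K_def by (rule imageI)
    then show False using that chart_simps(1)[OF c(1)] by simp
  qed
  define F where "F = (\<lambda>es. \<omega> (map (coord_vector A c x) es))"
  have F: "alternating k F"
    using \<omega> unfolding alt_forms_iff_alternating[OF c] F_def by blast
  define \<Omega> :: "('a, 'e) form_field" where "\<Omega> = (\<lambda>z vs. if z \<in> fst c \<and> set vs \<subseteq> tangent_space A z
    then \<phi> (snd c z) * F (map (\<lambda>v. v c) vs) else 0)"
  have "tensorial A \<Omega>" by (simp add: tensorial_def \<Omega>_def)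
  moreover have "local_form (chart_range d) k (loc A d \<Omega>)" if d: "d \<in> A" for d
  proof -
    let ?\<psi> = "snd c \<circ> chart_inv d"
    have inside: "loc A d \<Omega> y es = \<phi> (?\<psi> y) * F (map (jac d c y) es)" if y: "y \<in> overlap d c" for y es
    proof -
      have yr: "y \<in> chart_range d" and yc: "chart_inv d y \<in> fst c"
        using y overlap_eq[OF d] by auto
      then show ?thesis
        using set_map_coord_vector[OF d chart_simps(4)[OF d yr], of es]
        by (simp add: loc_def \<Omega>_def coord_vector_apply[OF c(1) yc] chart_simps(3)[OF d yr] o_def)
    qed
    define W where "W = chart_range d \<inter> chart_inv d -` (- K)"
    have outside: "loc A d \<Omega> y es = 0" if "y \<in> W" for y es
      using that off_K by (simp add: loc_def \<Omega>_def W_def)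
    have W: "open W"
      unfolding W_def
      by (rule continuous_open_preimage[OF continuous_chart_inv[OF d]]) (use K open_range[OF d] in auto)
    note S = open_overlap[OF d c(1)]
    have union: "chart_range d = overlap d c \<union> W"
      unfolding overlap_eq[OF d] W_def using Kc by auto
    show ?thesis
      unfolding local_form_def
    proof (intro conjI ballI allI)
      fix y assume "y \<in> chart_range d"
      then consider "y \<in> overlap d c" | "y \<in> W" using union by auto
      then show "alternating k (loc A d \<Omega> y)"
      proof cases
        case 1
        have "linear (jac d c y)"
          using jac_has_derivative[OF d c(1) 1] by (rule has_derivative_linear)
        from alternating_form_lincomb[OF alternating_map_linear[OF F this] alternating_zero, of "\<phi> (?\<psi> y)" 0]
        have "alternating k (\<lambda>es. \<phi> (?\<psi> y) * F (map (jac d c y) es) + 0 * 0)" .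
        moreover have "loc A d \<Omega> y = (\<lambda>es. \<phi> (?\<psi> y) * F (map (jac d c y) es) + 0 * 0)"
          using inside[OF 1] by auto
        ultimately show ?thesis by simp
      next
        case 2
        then have "loc A d \<Omega> y = (\<lambda>es. 0)" using outside by blast
        then show ?thesis by (simp add: alternating_zero)
      qed
    next
      fix es
      have "smooth_on (overlap d c) (\<lambda>y. \<phi> (?\<psi> y))"
        by (rule smooth_on_compose[OF S open_UNIV subset_UNIV \<phi>(1) smooth_transition[OF d c(1)]])
      moreover have "smooth_on (overlap d c) (\<lambda>y. F ([] @ map (jac d c y) es))"
        by (rule smooth_on_alternating_map[OF S F smooth_on_const
              smooth_on_frechet[OF smooth_transition[OF d c(1)]]])
      ultimately have "smooth_on (overlap d c) (\<lambda>y. \<phi> (?\<psi> y) * F ([] @ map (jac d c y) es))"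
        by (rule smooth_on_mult[OF S])
      then have "smooth_on (overlap d c) (\<lambda>y. loc A d \<Omega> y es)"
        by (rule smooth_on_cong[OF S, rotated]) (simp add: inside)
      moreover have "smooth_on W (\<lambda>y. loc A d \<Omega> y es)"
        by (rule smooth_on_cong[OF W _ smooth_on_const[of _ 0]]) (simp add: outside)
      ultimately show "smooth_on (chart_range d) (\<lambda>y. loc A d \<Omega> y es)"
        unfolding union by (rule smooth_on_Un[OF S W])
    qed
  qed
  ultimately have "\<Omega> \<in> forms A k" by (simp add: forms_iff_local)
  moreover have "\<Omega> x = \<omega>"
  proof
    fix vs
    show "\<Omega> x vs = \<omega> vs"
    proof (cases "set vs \<subseteq> tangent_space A x")
      case True
      then show ?thesis
        using c map_coord_vector[OF c True] \<phi>(2) by (simp add: \<Omega>_def F_def)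
    next
      case False
      then show ?thesis
        using \<omega> unfolding alt_forms_iff_alternating[OF c] \<Omega>_def by auto
    qed
  qed
  ultimately show ?thesis by (rule that)
qed

section \<open>The Schouten bracket\<close>

text \<open>The operator on forms that is represented by contraction with the Schouten bracket.\<close>

definition schouten_op ::
  "nat \<Rightarrow> nat \<Rightarrow> ('a, 'e) mv_field \<Rightarrow> ('a, 'e) mv_field \<Rightarrow> ('a, 'e) form_field \<Rightarrow> ('a, 'e) form_field" where
  "schouten_op p q U V \<omega> = lincomb ((-1) ^ ((p - 1) * q)) (lie_deriv A p U (contract V \<omega>))
     (-1) (contract V (lie_deriv A p U \<omega>))"

lemma tensorial_schouten_op:
  assumes "U \<in> mv_fields A p" "V \<in> mv_fields A q" "\<omega> \<in> forms A k"
  shows "tensorial A (schouten_op p q U V \<omega>)"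
  unfolding schouten_op_def
  by (rule tensorial_lincomb[OF forms_tensorial[OF lie_deriv_forms[OF assms(1) contract_forms[OF assms(2,3)]]]
        forms_tensorial[OF contract_forms[OF assms(2) lie_deriv_forms[OF assms(1,3)]]]])

lemma loc_schouten_op:
  assumes UV: "U \<in> mv_fields A p" "V \<in> mv_fields A q" and p: "1 \<le> p"
    and \<omega>: "\<omega> \<in> forms A k" and c: "c \<in> A" "y \<in> chart_range c"
    and f: "mv_coeffs A c p U f" and g: "mv_coeffs A c q V g"
  shows "loc A c (schouten_op p q U V \<omega>) y es =
    contr (p + q - 1) (bracket_coeff p q f g) (loc A c \<omega>) y es"
proof -
  note S = open_range[OF c(1)] c(2)
  have sm: "smooth_on (chart_range c) (f es)" "smooth_on (chart_range c) (g es)" for es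
    using f g by (simp_all add: mv_coeffs_def)
  have "loc A c (lie_deriv A p U (contract V \<omega>)) y es = lie p f (loc A c (contract V \<omega>)) y es"
    by (rule loc_lie_deriv[OF f UV(1) contract_forms[OF UV(2) \<omega>] c])
  also have "\<dots> = lie p f (contr q g (loc A c \<omega>)) y es"
  proof -
    note eq = loc_contract[OF \<omega> g c(1)]
    have "ext_d (contr p f (loc A c (contract V \<omega>))) y es = ext_d (contr p f (contr q g (loc A c \<omega>))) y es"
      by (rule ext_d_cong[OF S]) (simp add: contr_def[of p] eq)
    moreover have "contr p f (ext_d (loc A c (contract V \<omega>))) y es = contr p f (ext_d (contr q g (loc A c \<omega>))) y es"
      unfolding contr_def[of p] by (simp add: ext_d_cong[OF S eq])
    ultimately show ?thesis by (simp add: lie_def)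
  qed
  moreover have "loc A c (contract V (lie_deriv A p U \<omega>)) y es = contr q g (lie p f (loc A c \<omega>)) y es"
    unfolding loc_contract[OF lie_deriv_forms[OF UV(1) \<omega>] g c] contr_def[of q]
    by (simp add: loc_lie_deriv[OF f UV(1) \<omega> c])
  ultimately show ?thesis
    using local_bracket[OF S forms_local[OF \<omega> c(1)] sm p, where q = q and vs = es]
    by (simp add: schouten_op_def loc_lincomb)
qed

text \<open>
  An element of the exterior power is thus determined by its values on the alternating forms of its
  own degree.
\<close>

lemma decomposable_wrong_degree:
  assumes "length us = m" "\<omega> \<notin> alt_forms A x (int m)"
  shows "decomposable A x us \<omega> = 0"
proof (cases "\<omega> \<in> (\<Union>k. alt_forms A x k)")
  case True
  then obtain k where k: "\<omega> \<in> alt_forms A x k" by blast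
  then have "int (length us) \<noteq> k" using assms by auto
  then show ?thesis
    using k by (simp add: decomposable_def alt_forms_def)
qed (simp add: decomposable_def)

lemma mv_field_eqI:
  assumes "W \<in> mv_fields A m" "W' \<in> mv_fields A m"
    and "\<And>\<omega>. \<omega> \<in> forms A (int m) \<Longrightarrow> contract W \<omega> = contract W' \<omega>"
  shows "W = W'"
proof (intro ext)
  fix x \<omega>
  have off: "V x \<omega> = 0" if V: "V \<in> mv_fields A m" and \<omega>: "\<omega> \<notin> alt_forms A x (int m)" for V
  proof -
    obtain l where "V x = (\<lambda>\<omega>. \<Sum>(r, us)\<leftarrow>l. r * decomposable A x us \<omega>)"
      and l: "\<forall>(r, us)\<in>set l. length us = m \<and> set us \<subseteq> tangent_space A x"
      using V unfolding mv_fields_def ext_power_def by blast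
    moreover have "decomposable A x us \<omega> = 0" if "length us = m" for us
      using decomposable_wrong_degree[OF that \<omega>] .
    then have "(\<Sum>(r, us)\<leftarrow>l. r * decomposable A x us \<omega>) = (\<Sum>(r, us)\<leftarrow>l. 0)"
      using l by (intro arg_cong[where f = sum_list] map_cong) auto
    ultimately show ?thesis by (simp add: case_prod_unfold)
  qed
  show "W x \<omega> = W' x \<omega>"
  proof (cases "\<omega> \<in> alt_forms A x (int m)")
    case True
    then obtain \<Omega> where \<Omega>: "\<Omega> \<in> forms A (int m)" "\<Omega> x = \<omega>" by (rule alt_form_extends)
    from assms(3)[OF \<Omega>(1)] have "contract W \<Omega> x [] = contract W' \<Omega> x []" by simp
    then show ?thesis by (simp add: contract_def \<Omega>(2))
  next
    case False
    then show ?thesis using off[OF assms(1)] off[OF assms(2)] by simp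
  qed
qed

text \<open>
  The value of the field \<open>W\<close> on an alternating form \<open>\<omega>\<close> at \<open>x\<close> is that of the operator on a global
  extension of \<open>\<omega>\<close>. Every chart around \<open>x\<close> shows that it does not depend on the extension, because the
  operator is a contraction in coordinates; so no compatibility of the local expressions has to be
  verified.
\<close>

lemma schouten_op_is_contraction:
  assumes UV: "U \<in> mv_fields A p" "V \<in> mv_fields A q" and p: "1 \<le> p"
  obtains W where "W \<in> mv_fields A (p + q - 1)"
    "\<And>k \<omega>. \<omega> \<in> forms A k \<Longrightarrow> contract W \<omega> = schouten_op p q U V \<omega>"
proof -
  let ?m = "p + q - 1"
  define extn where "extn = (\<lambda>x \<omega>. SOME \<Omega>. \<Omega> \<in> forms A (int ?m) \<and> \<Omega> x = \<omega>)"
  have extn: "extn x \<omega> \<in> forms A (int ?m) \<and> extn x \<omega> x = \<omega>" if \<omega>: "\<omega> \<in> alt_forms A x (int ?m)" for x \<omega>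
  proof -
    obtain \<Omega> where "\<Omega> \<in> forms A (int ?m) \<and> \<Omega> x = \<omega>" by (rule alt_form_extends[OF \<omega>]) blast
    then show ?thesis unfolding extn_def
      by (rule someI[where P = "\<lambda>\<Omega>. \<Omega> \<in> forms A (int ?m) \<and> \<Omega> x = \<omega>"])
  qed
  define W where "W = (\<lambda>x \<omega>. if \<omega> \<in> alt_forms A x (int ?m) then schouten_op p q U V (extn x \<omega>) x [] else 0)"
  have coeffs: "mv_coeffs A c ?m W (bracket_coeff p q f g)"
    if c: "c \<in> A" and f: "mv_coeffs A c p U f" and g: "mv_coeffs A c q V g" for c f g
    unfolding mv_coeffs_def
  proof (intro conjI allI ballI ext)
    show "smooth_on (chart_range c) (bracket_coeff p q f g es)" for es
      using f g by (intro smooth_bracket_coeff open_range[OF c]) (simp_all add: mv_coeffs_def)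
    fix y \<omega> assume y: "y \<in> chart_range c"
    let ?x = "chart_inv c y" and ?C = "map (coord_vector A c (chart_inv c y))"
    show "W ?x \<omega> = (\<Sum>es\<in>basis_lists ?m. bracket_coeff p q f g es y * decomposable A ?x (?C es) \<omega>)"
    proof (cases "\<omega> \<in> alt_forms A ?x (int ?m)")
      case True
      then have "\<omega> \<in> (\<Union>k. alt_forms A ?x k)" by blast
      then have dec: "decomposable A ?x us \<omega> = \<omega> us" for us
        unfolding decomposable_def by simp
      have "W ?x \<omega> = loc A c (schouten_op p q U V (extn ?x \<omega>)) y []"
        using True by (simp add: W_def loc_def)
      also have "\<dots> = contr ?m (bracket_coeff p q f g) (loc A c (extn ?x \<omega>)) y []"
        using extn[OF True] by (intro loc_schouten_op[OF UV p _ c y f g]) auto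
      finally show ?thesis
        using extn[OF True] by (simp add: contr_def loc_def dec)
    next
      case False
      have "decomposable A ?x (?C es) \<omega> = 0" if "es \<in> basis_lists ?m" for es
        by (rule decomposable_wrong_degree[OF _ False]) (use that in simp)
      then show ?thesis using False by (simp add: W_def)
    qed
  qed
  have W: "W \<in> mv_fields A ?m"
    by (rule mv_fieldsI) (meson coeffs mv_fieldsD[OF UV(1)] mv_fieldsD[OF UV(2)])
  moreover have "contract W \<omega> = schouten_op p q U V \<omega>" if \<omega>: "\<omega> \<in> forms A k" for k \<omega>
  proof (rule tensorial_eqI[OF forms_tensorial[OF contract_forms[OF W \<omega>]] tensorial_schouten_op[OF UV \<omega>]])
    fix c y es assume c: "c \<in> A" "y \<in> chart_range c"
    obtain f where f: "mv_coeffs A c p U f" using mv_fieldsD[OF UV(1) c(1)] by blast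
    obtain g where g: "mv_coeffs A c q V g" using mv_fieldsD[OF UV(2) c(1)] by blast
    show "loc A c (contract W \<omega>) y es = loc A c (schouten_op p q U V \<omega>) y es"
      unfolding loc_contract[OF \<omega> coeffs[OF c(1) f g] c] loc_schouten_op[OF UV p \<omega> c f g] ..
  qed
  ultimately show ?thesis by (rule that)
qed

lemma schouten:
  assumes UV: "U \<in> mv_fields A p" "V \<in> mv_fields A q" and p: "1 \<le> p"
  shows "schouten A p q U V \<in> mv_fields A (p + q - 1)"
    and "\<omega> \<in> forms A k \<Longrightarrow> contract (schouten A p q U V) \<omega> = schouten_op p q U V \<omega>"
proof -
  have op: "(\<lambda>x vs. (-1) ^ ((p - 1) * q) * lie_deriv A p U (contract V \<omega>) x vs -
      contract V (lie_deriv A p U \<omega>) x vs) = schouten_op p q U V \<omega>" for \<omega>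
    by (simp add: schouten_op_def lincomb_def)
  let ?P = "\<lambda>W. W \<in> mv_fields A (p + q - 1) \<and>
    (\<forall>k. \<forall>\<omega>\<in>forms A k. contract W \<omega> = schouten_op p q U V \<omega>)"
  obtain W where W: "?P W" using schouten_op_is_contraction[OF assms] by metis
  have "?P (schouten A p q U V)"
    unfolding schouten_def op
  proof (rule theI[where P = ?P])
    show "?P W" by (rule W)
    fix W' assume "?P W'"
    then show "W' = W"
      using W by (intro mv_field_eqI[of W' _ W]) auto
  qed
  then show "schouten A p q U V \<in> mv_fields A (p + q - 1)"
    and "\<omega> \<in> forms A k \<Longrightarrow> contract (schouten A p q U V) \<omega> = schouten_op p q U V \<omega>"
    by blast+
qed

section \<open>Graded Cartan calculus\<close>

lemma contract_zero:
  assumes "U \<in> mv_fields A p"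
  shows "contract U (\<lambda>x vs. 0) = (\<lambda>x vs. 0)"
proof -
  have "(\<lambda>x vs. 0) \<in> forms A 0"
    by (simp add: forms_def zero_alt_form smooth_on_const)
  from contract_lincomb[OF assms this this, of 0 0] show ?thesis
    by (simp add: lincomb_def)
qed

lemma ext_deriv_contract:
  "ext_deriv A (contract U \<omega>) = lincomb 1 (lie_deriv A p U \<omega>) ((-1) ^ p) (contract U (ext_deriv A \<omega>))"
  by (simp add: lie_deriv_def lincomb_def)

lemma lie_deriv_lincomb:
  assumes "U \<in> mv_fields A p" "\<omega> \<in> forms A k" "\<eta> \<in> forms A k"
  shows "lie_deriv A p U (lincomb a \<omega> b \<eta>) = lincomb a (lie_deriv A p U \<omega>) b (lie_deriv A p U \<eta>)"
  using contract_forms[OF assms(1,2)] contract_forms[OF assms(1,3)]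
    ext_deriv_forms[OF assms(2)] ext_deriv_forms[OF assms(3)]
  by (simp add: lie_deriv_def contract_lincomb[OF assms] ext_deriv_lincomb[OF assms(2,3)]
      ext_deriv_lincomb contract_lincomb[OF assms(1)])
    (simp add: lincomb_def algebra_simps)

lemma ext_deriv_lie_deriv:
  assumes "U \<in> mv_fields A p" "\<omega> \<in> forms A k"
  shows "ext_deriv A (lie_deriv A p U \<omega>) =
    lincomb (- ((-1) ^ p)) (lie_deriv A p U (ext_deriv A \<omega>)) 0 (lie_deriv A p U (ext_deriv A \<omega>))"
proof -
  have "ext_deriv A (contract U \<omega>) \<in> forms A (k - int p + 1)"
    by (rule ext_deriv_forms[OF contract_forms[OF assms]])
  moreover have "contract U (ext_deriv A \<omega>) \<in> forms A (k - int p + 1)"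
    using contract_forms[OF assms(1) ext_deriv_forms[OF assms(2)]] by (simp add: algebra_simps)
  ultimately have "ext_deriv A (lie_deriv A p U \<omega>) =
      lincomb 1 (\<lambda>x vs. 0) (- ((-1) ^ p)) (ext_deriv A (contract U (ext_deriv A \<omega>)))"
    by (simp add: lie_deriv_eq ext_deriv_lincomb ext_deriv_ext_deriv[OF contract_forms[OF assms]])
  then show ?thesis
    by (simp add: lie_deriv_def ext_deriv_ext_deriv[OF assms(2)] contract_zero[OF assms(1)] lincomb_def)
qed

text \<open>
  The Lie derivative along the bracket is a graded commutator. Replacing \<open>d \<iota>\<^sub>V\<close> by
  \<open>\<L>\<^sub>V + (-1)\<^bsup>q\<^esup> \<iota>\<^sub>V d\<close> and \<open>d \<L>\<^sub>U\<close> by \<open>- (-1)\<^bsup>p\<^esup> \<L>\<^sub>U d\<close>, all terms that contain \<open>d \<omega>\<close> cancel.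
\<close>

lemma lie_deriv_schouten:
  assumes UV: "U \<in> mv_fields A p" "V \<in> mv_fields A q" and p: "1 \<le> p" and \<omega>: "\<omega> \<in> forms A k"
  shows "lie_deriv A (p + q - 1) (schouten A p q U V) \<omega> x vs =
    - ((-1) ^ ((p - 1) * q + p) * lie_deriv A p U (lie_deriv A q V \<omega>) x vs) -
    lie_deriv A q V (lie_deriv A p U \<omega>) x vs"
proof -
  let ?d = "ext_deriv A" and ?L = "lie_deriv A p U" and ?M = "lie_deriv A q V"
  let ?i = "contract U" and ?j = "contract V" and ?\<epsilon> = "(-1) ^ ((p - 1) * q) :: real"
  note d\<omega> = ext_deriv_forms[OF \<omega>]
  have M: "?M \<omega> \<in> forms A (k - int q + 1)" by (rule lie_deriv_forms[OF UV(2) \<omega>])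
  have jd: "?j (?d \<omega>) \<in> forms A (k - int q + 1)"
    using contract_forms[OF UV(2) d\<omega>] by (simp add: algebra_simps)
  have Lj: "?L (?j \<omega>) \<in> forms A (k - int q - int p + 1)"
    by (rule lie_deriv_forms[OF UV(1) contract_forms[OF UV(2) \<omega>]])
  have jL: "?j (?L \<omega>) \<in> forms A (k - int q - int p + 1)"
    using contract_forms[OF UV(2) lie_deriv_forms[OF UV(1) \<omega>]] by (simp add: algebra_simps)
  have Ld: "?L (?d \<omega>) \<in> forms A (k - int p + 1 + 1)"
    using lie_deriv_forms[OF UV(1) d\<omega>] by (simp add: algebra_simps)
  have 1: "?d (?L (?j \<omega>)) x vs = - ((-1) ^ p * (?L (?M \<omega>) x vs + (-1) ^ q * ?L (?j (?d \<omega>)) x vs))"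
    by (simp add: ext_deriv_lie_deriv[OF UV(1) contract_forms[OF UV(2) \<omega>]]
        ext_deriv_contract[of V \<omega> q] lie_deriv_lincomb[OF UV(1) M jd])
      (simp add: lincomb_def)
  have 2: "?d (?j (?L \<omega>)) x vs = ?M (?L \<omega>) x vs - (-1) ^ q * ((-1) ^ p * ?j (?L (?d \<omega>)) x vs)"
    by (simp add: ext_deriv_contract[of V "?L \<omega>" q] ext_deriv_lie_deriv[OF UV(1) \<omega>]
        contract_lincomb[OF UV(2) Ld Ld])
      (simp add: lincomb_def)
  have "(-1) ^ (p + q - 1) = - ((-1) ^ p * (-1) ^ q :: real)"
    using p by (cases p) (simp_all add: power_add)
  then have "lie_deriv A (p + q - 1) (schouten A p q U V) \<omega> x vs =
      ?d (schouten_op p q U V \<omega>) x vs + (-1) ^ p * (-1) ^ q * schouten_op p q U V (?d \<omega>) x vs"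
    by (simp add: lie_deriv_def schouten(2)[OF UV p \<omega>] schouten(2)[OF UV p d\<omega>])
  also have "\<dots> = ?\<epsilon> * ?d (?L (?j \<omega>)) x vs - ?d (?j (?L \<omega>)) x vs +
      (-1) ^ p * (-1) ^ q * (?\<epsilon> * ?L (?j (?d \<omega>)) x vs - ?j (?L (?d \<omega>)) x vs)"
    by (simp add: schouten_op_def ext_deriv_lincomb[OF Lj jL]) (simp add: lincomb_def)
  also have "\<dots> = - (?\<epsilon> * (-1) ^ p * ?L (?M \<omega>) x vs) - ?M (?L \<omega>) x vs"
    unfolding 1 2 by (simp add: algebra_simps)
  finally show ?thesis by (simp add: power_add)
qed

text \<open>The definition of the Schouten bracket, solved for the Lie derivative of a contraction.\<close>

lemma lie_deriv_contract:
  assumes UV: "U \<in> mv_fields A p" "V \<in> mv_fields A q" and p: "1 \<le> p" and \<omega>: "\<omega> \<in> forms A k"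
  shows "lie_deriv A p U (contract V \<omega>) x vs = (-1) ^ ((p - 1) * q) *
    (contract (schouten A p q U V) \<omega> x vs + contract V (lie_deriv A p U \<omega>) x vs)"
  by (simp add: schouten(2)[OF UV p \<omega>] schouten_op_def lincomb_def neg_one_power_same)

lemma lie_deriv_wedge:
  assumes UV: "U \<in> mv_fields A p" "V \<in> mv_fields A q" and \<omega>: "\<omega> \<in> forms A k"
  shows "lie_deriv A (p + q) (wedge A U V) \<omega> x vs =
    lie_deriv A q V (contract U \<omega>) x vs + (-1) ^ q * contract V (lie_deriv A p U \<omega>) x vs"
proof -
  have "contract U (ext_deriv A \<omega>) \<in> forms A (k - int p + 1)"
    using contract_forms[OF UV(1) ext_deriv_forms[OF \<omega>]] by (simp add: algebra_simps)
  from contract_lincomb[OF UV(2) lie_deriv_forms[OF UV(1) \<omega>] this]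
  have "contract V (ext_deriv A (contract U \<omega>)) x vs =
      contract V (lie_deriv A p U \<omega>) x vs + (-1) ^ p * contract V (contract U (ext_deriv A \<omega>)) x vs"
    by (simp add: ext_deriv_contract[of U \<omega> p]) (simp add: lincomb_def)
  then show ?thesis
    by (simp add: lie_deriv_def contract_wedge[OF \<omega>] contract_wedge[OF ext_deriv_forms[OF \<omega>]]
        power_add algebra_simps)
qed

section \<open>Infinitesimal conformal transformations\<close>

text \<open>Commute both contractions, which costs the same sign on the two sides.\<close>

lemma contract_contract_cong:
  assumes "U \<in> mv_fields A p" "U' \<in> mv_fields A p" "V \<in> mv_fields A q" "\<omega> \<in> forms A k"
    and "contract U \<omega> = contract U' \<omega>"
  shows "contract U (contract V \<omega>) = contract U' (contract V \<omega>)"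
  by (intro ext) (simp add: contract_commute[OF assms(3,1,4)] contract_commute[OF assms(3,2,4)] assms(5))

text \<open>
  With \<open>\<L>\<^sub>X \<Theta> = \<iota>\<^sub>V \<Theta>\<close> and \<open>\<L>\<^sub>Y \<Theta> = \<iota>\<^bsub>V'\<^esub> \<Theta>\<close>, the Lie derivative along the bracket consists of
  \<open>\<L>\<^sub>X \<iota>\<^bsub>V'\<^esub> \<Theta>\<close> and \<open>\<L>\<^sub>Y \<iota>\<^sub>V \<Theta>\<close>, and \<open>lie_deriv_contract\<close> turns both into contractions of \<open>\<Theta>\<close>. The fields
  \<open>V\<close> and \<open>V'\<close> may have degree \<open>0\<close>; for this reason the Schouten bracket is treated for a second
  argument of arbitrary degree.
\<close>

lemma inf_conformal_schouten:
  assumes \<Theta>: "\<Theta> \<in> forms A n" and X: "inf_conformal A \<Theta> p X" and Y: "inf_conformal A \<Theta> q Y"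
  shows "inf_conformal A \<Theta> (p + q - 1) (schouten A p q X Y)"
proof -
  obtain V where V: "V \<in> mv_fields A (p - 1)" "lie_deriv A p X \<Theta> = contract V \<Theta>"
    and p: "1 \<le> p" and Xm: "X \<in> mv_fields A p"
    using X unfolding inf_conformal_def by blast
  obtain V' where V': "V' \<in> mv_fields A (q - 1)" "lie_deriv A q Y \<Theta> = contract V' \<Theta>"
    and q: "1 \<le> q" and Ym: "Y \<in> mv_fields A q"
    using Y unfolding inf_conformal_def by blast
  let ?\<epsilon>1 = "(-1) ^ ((p - 1) * (q - 1)) :: real" and ?\<epsilon>2 = "(-1) ^ ((q - 1) * (p - 1)) :: real"
  define W where "W = lincomb (- ((-1) ^ ((p - 1) * q + p) * ?\<epsilon>1))
      (lincomb 1 (schouten A p (q - 1) X V') 1 (wedge A V V'))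
      (- ?\<epsilon>2) (lincomb 1 (schouten A q (p - 1) Y V) 1 (wedge A V' V))"
  have deg: "p + (q - 1) - 1 = p + q - 1 - 1" "q + (p - 1) - 1 = p + q - 1 - 1"
    "p - 1 + (q - 1) = p + q - 1 - 1" "q - 1 + (p - 1) = p + q - 1 - 1"
    using p q by simp_all
  have "W \<in> mv_fields A (p + q - 1 - 1)"
    unfolding W_def
    by (intro lincomb_mv_fields schouten(1)[OF Xm V'(1) p, unfolded deg]
        schouten(1)[OF Ym V(1) q, unfolded deg] wedge_mv_fields[OF V(1) V'(1), unfolded deg]
        wedge_mv_fields[OF V'(1) V(1), unfolded deg])
  moreover have "lie_deriv A (p + q - 1) (schouten A p q X Y) \<Theta> = contract W \<Theta>"
  proof (intro ext)
    fix x vs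
    have "lie_deriv A (p + q - 1) (schouten A p q X Y) \<Theta> x vs =
        - ((-1) ^ ((p - 1) * q + p) * lie_deriv A p X (contract V' \<Theta>) x vs) - lie_deriv A q Y (contract V \<Theta>) x vs"
      by (rule lie_deriv_schouten[OF Xm Ym p \<Theta>, unfolded V(2) V'(2)])
    also have "\<dots> = contract W \<Theta> x vs"
      unfolding lie_deriv_contract[OF Xm V'(1) p \<Theta>] lie_deriv_contract[OF Ym V(1) q \<Theta>] W_def
        contract_lincomb_left contract_wedge[OF \<Theta>] V(2) V'(2)
      by (simp add: lincomb_def mult.assoc)
    finally show "lie_deriv A (p + q - 1) (schouten A p q X Y) \<Theta> x vs = contract W \<Theta> x vs" .
  qed
  ultimately show ?thesis
    unfolding inf_conformal_def using schouten(1)[OF Xm Ym p] p q by auto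
qed

lemma inf_conformal_wedge:
  assumes \<Theta>: "\<Theta> \<in> forms A n" and X: "inf_conformal A \<Theta> p X" and Y: "inf_conformal A \<Theta> q Y"
  shows "inf_conformal A \<Theta> (p + q) (wedge A X Y)"
proof -
  obtain V where V: "V \<in> mv_fields A (p - 1)" "lie_deriv A p X \<Theta> = contract V \<Theta>"
    and p: "1 \<le> p" and Xm: "X \<in> mv_fields A p"
    using X unfolding inf_conformal_def by blast
  obtain V' where V': "V' \<in> mv_fields A (q - 1)" "lie_deriv A q Y \<Theta> = contract V' \<Theta>"
    and q: "1 \<le> q" and Ym: "Y \<in> mv_fields A q"
    using Y unfolding inf_conformal_def by blast
  define W where "W = lincomb ((-1) ^ ((q - 1) * p))
      (lincomb 1 (schouten A q p Y X) 1 (wedge A V' X)) ((-1) ^ q) (wedge A V Y)"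
  have deg: "q + p - 1 = p + q - 1" "q - 1 + p = p + q - 1" "p - 1 + q = p + q - 1"
    using p q by simp_all
  have "W \<in> mv_fields A (p + q - 1)"
    unfolding W_def
    by (intro lincomb_mv_fields schouten(1)[OF Ym Xm q, unfolded deg]
        wedge_mv_fields[OF V'(1) Xm, unfolded deg] wedge_mv_fields[OF V(1) Ym, unfolded deg])
  moreover have "lie_deriv A (p + q) (wedge A X Y) \<Theta> = contract W \<Theta>"
  proof (intro ext)
    fix x vs
    show "lie_deriv A (p + q) (wedge A X Y) \<Theta> x vs = contract W \<Theta> x vs"
      unfolding lie_deriv_wedge[OF Xm Ym \<Theta>] lie_deriv_contract[OF Ym Xm q \<Theta>] W_def
        contract_lincomb_left contract_wedge[OF \<Theta>] V(2) V'(2)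
      by (simp add: lincomb_def)
  qed
  ultimately show ?thesis
    unfolding inf_conformal_def using wedge_mv_fields[OF Xm Ym] p by auto
qed

lemma associated_ham_mv:
  assumes "associated_mv A \<Theta> p \<alpha> X"
  shows "associated_mv A \<Theta> p \<alpha> (ham_mv A \<Theta> p \<alpha>)"
  unfolding ham_mv_def by (rule someI[where P = "associated_mv A \<Theta> p \<alpha>", OF assms])

text \<open>
  The field that is chosen for a bracket or a cup product is conformal, and its contraction with \<open>\<Theta>\<close> is
  that of the bracket or the wedge product itself.
\<close>

lemma ham_mv_contract:
  assumes "inf_conformal A \<Theta> p X"
  shows "inf_conformal A \<Theta> p (ham_mv A \<Theta> p (\<lambda>x vs. - contract X \<Theta> x vs))"
    and "contract (ham_mv A \<Theta> p (\<lambda>x vs. - contract X \<Theta> x vs)) \<Theta> = contract X \<Theta>"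
proof -
  have "associated_mv A \<Theta> p (\<lambda>x vs. - contract X \<Theta> x vs) X"
    using assms by (simp add: associated_mv_def)
  from associated_ham_mv[OF this]
  show "inf_conformal A \<Theta> p (ham_mv A \<Theta> p (\<lambda>x vs. - contract X \<Theta> x vs))"
    and "contract (ham_mv A \<Theta> p (\<lambda>x vs. - contract X \<Theta> x vs)) \<Theta> = contract X \<Theta>"
    by (simp_all add: associated_mv_def)
qed

end

section \<open>The graded Leibniz rule\<close>

theorem corollary2p11:
  fixes A :: "('a::{t2_space, second_countable_topology}, 'e::euclidean_space) chart set"
    and \<Theta> \<alpha> \<beta> \<gamma> :: "('a, 'e) form_field"
    and n p q r :: nat
  assumes "smooth_atlas A"
    and "\<Theta> \<in> forms A (int n)"
    and "p \<in> {1..n}" and "q \<in> {1..n}" and "r \<in> {1..n}"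
    and "conformal_hamiltonian A n \<Theta> p \<alpha>"
    and "conformal_hamiltonian A n \<Theta> q \<beta>"
    and "conformal_hamiltonian A n \<Theta> r \<gamma>"
  shows "jacobi_bracket A \<Theta> p (q + r) \<alpha> (cup_product A \<Theta> q r \<beta> \<gamma>) =
    (\<lambda>x vs. cup_product A \<Theta> (p + q - 1) r (jacobi_bracket A \<Theta> p q \<alpha> \<beta>) \<gamma> x vs
       + (-1) ^ ((p - 1) * q) *
         cup_product A \<Theta> q (p + r - 1) \<beta> (jacobi_bracket A \<Theta> p r \<alpha> \<gamma>) x vs)"
proof (intro ext)
  fix x vs
  interpret smooth_manifold A by unfold_locales (rule assms(1))
  note \<Theta> = assms(2)
  define X where "X = ham_mv A \<Theta> p \<alpha>"
  define Y where "Y = ham_mv A \<Theta> q \<beta>"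
  define Z where "Z = ham_mv A \<Theta> r \<gamma>"
  have conf: "inf_conformal A \<Theta> p X" "inf_conformal A \<Theta> q Y" "inf_conformal A \<Theta> r Z"
    using assms(6-8) associated_ham_mv unfolding conformal_hamiltonian_def X_def Y_def Z_def associated_mv_def
    by blast+
  have p: "1 \<le> p" using assms(3) by simp
  have X: "X \<in> mv_fields A p" and Y: "Y \<in> mv_fields A q" and Z: "Z \<in> mv_fields A r"
    using conf by (simp_all add: inf_conformal_def)
  obtain V where V: "V \<in> mv_fields A (p - 1)" "lie_deriv A p X \<Theta> = contract V \<Theta>"
    using conf(1) unfolding inf_conformal_def by blast
  let ?L = "lie_deriv A p X"
  note Y\<Theta> = contract_forms[OF Y \<Theta>] and V\<Theta> = contract_forms[OF V(1) \<Theta>]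

  \<comment> \<open>\<open>G\<close> has the contraction of \<open>Y \<and> Z\<close> with \<open>\<Theta>\<close>, hence also with \<open>\<L>\<^sub>X \<Theta> = \<iota>\<^sub>V \<Theta>\<close>.\<close>
  define G where "G = ham_mv A \<Theta> (q + r) (\<lambda>x vs. - contract (wedge A Y Z) \<Theta> x vs)"
  note G0 = ham_mv_contract[OF inf_conformal_wedge[OF \<Theta> conf(2,3)], folded G_def]
  have G: "G \<in> mv_fields A (q + r)" using G0(1) by (simp add: inf_conformal_def)
  have "contract G (contract V \<Theta>) = contract (wedge A Y Z) (contract V \<Theta>)"
    by (rule contract_contract_cong[OF G wedge_mv_fields[OF Y Z] V(1) \<Theta> G0(2)])
  then have lhs: "contract (schouten A p (q + r) X G) \<Theta> x vs =
      (-1) ^ ((p - 1) * (q + r)) * ?L (contract Z (contract Y \<Theta>)) x vs -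
      contract Z (contract Y (contract V \<Theta>)) x vs"
    by (simp add: schouten(2)[OF X G p \<Theta>] schouten_op_def lincomb_def G0(2) V(2)
        contract_wedge[OF \<Theta>] contract_wedge[OF V\<Theta>])

  \<comment> \<open>\<open>P\<close> stands for \<open>[X, Y]\<close>; it is contracted with \<open>\<Theta>\<close> itself here.\<close>
  define P where "P = ham_mv A \<Theta> (p + q - 1) (\<lambda>x vs. - contract (schouten A p q X Y) \<Theta> x vs)"
  note P0 = ham_mv_contract[OF inf_conformal_schouten[OF \<Theta> conf(1,2)], folded P_def]
  have LY: "?L (contract Y \<Theta>) \<in> forms A (int n - int q - int p + 1)"
    by (rule lie_deriv_forms[OF X Y\<Theta>])
  have YL: "contract Y (contract V \<Theta>) \<in> forms A (int n - int q - int p + 1)"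
    using contract_forms[OF Y V\<Theta>] p by (simp add: algebra_simps of_nat_diff)
  have "contract (wedge A P Z) \<Theta> = contract Z (schouten_op p q X Y \<Theta>)"
    by (simp add: contract_wedge[OF \<Theta>] P0(2) schouten(2)[OF X Y p \<Theta>])
  also have "\<dots> = lincomb ((-1) ^ ((p - 1) * q)) (contract Z (?L (contract Y \<Theta>)))
      (-1) (contract Z (contract Y (contract V \<Theta>)))"
    unfolding schouten_op_def V(2) by (rule contract_lincomb[OF Z LY YL])
  finally have rhs1: "contract (wedge A P Z) \<Theta> x vs =
      (-1) ^ ((p - 1) * q) * contract Z (?L (contract Y \<Theta>)) x vs - contract Z (contract Y (contract V \<Theta>)) x vs"
    by (simp add: lincomb_def)

  \<comment> \<open>\<open>R\<close> stands for \<open>[X, Z]\<close>, and may be replaced by it in the contraction with \<open>\<iota>\<^sub>Y \<Theta>\<close>.\<close>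
  define R where "R = ham_mv A \<Theta> (p + r - 1) (\<lambda>x vs. - contract (schouten A p r X Z) \<Theta> x vs)"
  note R0 = ham_mv_contract[OF inf_conformal_schouten[OF \<Theta> conf(1,3)], folded R_def]
  have R: "R \<in> mv_fields A (p + r - 1)" using R0(1) by (simp add: inf_conformal_def)
  have "contract (wedge A Y R) \<Theta> = contract (schouten A p r X Z) (contract Y \<Theta>)"
    unfolding contract_wedge[OF \<Theta>]
    by (rule contract_contract_cong[OF R schouten(1)[OF X Z p] Y \<Theta> R0(2)])
  then have rhs2: "contract (wedge A Y R) \<Theta> x vs =
      (-1) ^ ((p - 1) * r) * ?L (contract Z (contract Y \<Theta>)) x vs - contract Z (?L (contract Y \<Theta>)) x vs"
    by (simp add: schouten(2)[OF X Z p Y\<Theta>] schouten_op_def lincomb_def)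

  \<comment> \<open>The terms with \<open>\<iota>\<^sub>Z \<L>\<^sub>X \<iota>\<^sub>Y \<Theta>\<close> cancel.\<close>
  have "jacobi_bracket A \<Theta> p (q + r) \<alpha> (cup_product A \<Theta> q r \<beta> \<gamma>) x vs =
      - contract (schouten A p (q + r) X G) \<Theta> x vs"
    by (simp add: jacobi_bracket_def cup_product_def X_def Y_def Z_def G_def)
  also have "\<dots> = - contract (wedge A P Z) \<Theta> x vs + (-1) ^ ((p - 1) * q) * - contract (wedge A Y R) \<Theta> x vs"
    unfolding lhs rhs1 rhs2 by (simp add: distrib_left power_add right_diff_distrib neg_one_power_same)
  also have "\<dots> = cup_product A \<Theta> (p + q - 1) r (jacobi_bracket A \<Theta> p q \<alpha> \<beta>) \<gamma> x vs
       + (-1) ^ ((p - 1) * q) * cup_product A \<Theta> q (p + r - 1) \<beta> (jacobi_bracket A \<Theta> p r \<alpha> \<gamma>) x vs"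
    by (simp add: jacobi_bracket_def cup_product_def X_def Y_def Z_def P_def R_def)
  finally show "jacobi_bracket A \<Theta> p (q + r) \<alpha> (cup_product A \<Theta> q r \<beta> \<gamma>) x vs =
    cup_product A \<Theta> (p + q - 1) r (jacobi_bracket A \<Theta> p q \<alpha> \<beta>) \<gamma> x vs
       + (-1) ^ ((p - 1) * q) * cup_product A \<Theta> q (p + r - 1) \<beta> (jacobi_bracket A \<Theta> p r \<alpha> \<gamma>) x vs" .
qed

end
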